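(* Suppose $M_1$ and $M_2$ are two dense random countable sets over the Wiener noise, both of them local and both of them stationary-in-law. Then $M_1$ and $M_2$ have the same law. Moreover, for any probability law $\mathcal{L}$ on the Borel sets of $\mathbb{R}$ that is equivalent to Lebesgue measure, and for any measurable enumeration $S$ of $M_1$, there exists a coupling $R$ of $\mathcal{L}^{\times\mathbb{N}}$ and $S_\star\mathsf{W}$ such that $[x]=[y]$ for $R$-a.e. $(x,y)$.
   Context: $\Omega_0:=\{\omega:\mathbb{R}\to\mathbb{R}\text{ continuous},\ \omega(0)=0\}$, with canonical process $B=(B_t)_{t\in\mathbb{R}}$. $\mathsf{W}$ is the completed two-sided Wiener measure: $(B_t)_{t\ge0}$ and $(B_{-t})_{t\ge 0}$ are independent standard Brownian motions under $\mathsf{W}$; its domain $\mathcal{G}$ is the $\mathsf{W}$-completion of the Borel $\sigma$-field of $\Omega_0$ (locally uniform topology). For extended-real $s<t$, $\mathcal{F}_{s,t}$ is the $\sigma$-field generated by the increments of $B$ between the times $s$ and $t$ and by all events of $\mathsf{W}$-probability $0$ or $1$. $Z_\star\mathsf{W}$ denotes the law of a random element $Z$ under $\mathsf{W}$. $\dagger\notin\mathbb{R}$ is a coffin state; $\mathbb{R}^\dagger:=\mathbb{R}\cup\{\dagger\}$ with the $\sigma$-field generated by the Borel sets of $\mathbb{R}$ and $\{\dagger\}$. For a sequence $s=(s_i)_{i\in\mathbb{N}}$ in $\mathbb{R}^\dagger$, $[s]:=\{s_i:i\in\mathbb{N}\}\setminus\{\dagger\}$. A random set is a map $M:\Omega_0\to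 2^{\mathbb{R}}$. For a sub-$\sigma$-field $\mathcal{A}$ of $\mathcal{G}$, an $\mathcal{A}$-measurable enumeration of $M$ is a sequence $S=(S_i)_{i\in\mathbb{N}}$ of $\mathcal{A}$-measurable $\mathbb{R}^\dagger$-valued random variables with $M=[S]$ $\mathsf{W}$-a.s.; "measurable enumeration" means $\mathcal{A}=\mathcal{G}$. $M$ is a random countable set if it has a measurable enumeration. Two random countable sets $M,M'$ have the same law if there are measurable enumerations $S$ of $M$ and $S'$ of $M'$ and a coupling $R$ of $S_\star\mathsf{W}$ and $S'_\star\mathsf{W}$ with $[s]=[s']$ for $R$-a.e. $(s,s')$. A random countable set $M$ is: dense if it is $\mathsf{W}$-a.s. dense in $\mathbb{R}$; local if for all extended-real $s<t$ the set $M\cap(s,t)$ has an $\mathcal{F}_{s,t}$-measurable enumeration; stationary-in-law if for every $u\in\mathbb{R}$ the sets $M$ and $u+M$ have the same law. *)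

theory Defs
  imports "HOL-Probability.Probability"
begin

section \<open>Two-sided Wiener space\<close>

definition Omega0 :: "(real \<Rightarrow> real) set" where
  "Omega0 = {\<omega>. continuous_on UNIV \<omega> \<and> \<omega> 0 = 0}"

definition locally_uniform_topology :: "(real \<Rightarrow> real) topology" where
  "locally_uniform_topology = topology (\<lambda>U. U \<subseteq> Omega0 \<and>
     (\<forall>\<omega>\<in>U. \<exists>K e. compact K \<and> e > 0 \<and> {\<eta>\<in>Omega0. \<forall>t\<in>K. dist (\<eta> t) (\<omega> t) < e} \<subseteq> U))"

text \<open>The following shows that \<^const>\<open>topology\<close> is applied to a genuine system of open sets above.\<close>

lemma openin_locally_uniform_topology:
  "openin locally_uniform_topology U \<longleftrightarrow> U \<subseteq> Omega0 \<and>
     (\<forall>\<omega>\<in>U. \<exists>K e. compact K \<and> e > 0 \<and> {\<eta>\<in>Omega0. \<forall>t\<in>K. dist (\<eta> t) (\<omega> t) < e} \<subseteq> U)"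
proof -
  let ?nb = "\<lambda>U \<omega>. \<exists>K e. compact K \<and> e > 0 \<and> {\<eta>\<in>Omega0. \<forall>t\<in>K. dist (\<eta> t) (\<omega> t) < e} \<subseteq> U"
  have "istopology (\<lambda>U. U \<subseteq> Omega0 \<and> (\<forall>\<omega>\<in>U. ?nb U \<omega>))"
    unfolding istopology_def
  proof (intro conjI allI impI)
    fix S T assume S: "S \<subseteq> Omega0 \<and> (\<forall>\<omega>\<in>S. ?nb S \<omega>)" and T: "T \<subseteq> Omega0 \<and> (\<forall>\<omega>\<in>T. ?nb T \<omega>)"
    show "S \<inter> T \<subseteq> Omega0" using S by blast
    show "\<forall>\<omega>\<in>S \<inter> T. ?nb (S \<inter> T) \<omega>"
    proof
      fix \<omega> assume "\<omega> \<in> S \<inter> T"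
      then have "?nb S \<omega>" "?nb T \<omega>"
        using S T by simp_all
      then obtain K e K' e' where
        "compact K" "e > 0" and KS: "{\<eta>\<in>Omega0. \<forall>t\<in>K. dist (\<eta> t) (\<omega> t) < e} \<subseteq> S" and
        "compact K'" "e' > 0" and KT: "{\<eta>\<in>Omega0. \<forall>t\<in>K'. dist (\<eta> t) (\<omega> t) < e'} \<subseteq> T"
        by auto
      have "{\<eta>\<in>Omega0. \<forall>t\<in>K \<union> K'. dist (\<eta> t) (\<omega> t) < min e e'} \<subseteq> S \<inter> T"
        using KS KT by fastforce
      moreover have "compact (K \<union> K')" "min e e' > 0"
        using \<open>compact K\<close> \<open>compact K'\<close> \<open>e > 0\<close> \<open>e' > 0\<close> by auto
      ultimately show "?nb (S \<inter> T) \<omega>" by blast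
    qed
  next
    fix \<K> assume K: "\<forall>U\<in>\<K>. U \<subseteq> Omega0 \<and> (\<forall>\<omega>\<in>U. ?nb U \<omega>)"
    then show "\<Union>\<K> \<subseteq> Omega0" by blast
    show "\<forall>\<omega>\<in>\<Union>\<K>. ?nb (\<Union>\<K>) \<omega>"
    proof
      fix \<omega> assume "\<omega> \<in> \<Union>\<K>"
      then obtain U where "U \<in> \<K>" "\<omega> \<in> U" by blast
      with K have "?nb U \<omega>" by blast
      with \<open>U \<in> \<K>\<close> show "?nb (\<Union>\<K>) \<omega>" by (meson Union_upper order_trans)
    qed
  qed
  then show ?thesis
    unfolding locally_uniform_topology_def by (simp add: topology_inverse')
qed

definition Omega0_borel :: "(real \<Rightarrow> real) measure" where
  "Omega0_borel = sigma Omega0 {U. openin locally_uniform_topology U}"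

text \<open>Only the values of \<open>X t\<close> for \<open>t \<ge> 0\<close> matter.\<close>

definition standard_brownian_motion :: "'a measure \<Rightarrow> (real \<Rightarrow> 'a \<Rightarrow> real) \<Rightarrow> bool" where
  "standard_brownian_motion P X \<longleftrightarrow>
     (AE \<omega> in P. X 0 \<omega> = 0) \<and>
     (AE \<omega> in P. continuous_on {0..} (\<lambda>t. X t \<omega>)) \<and>
     (\<forall>s t. 0 \<le> s \<and> s < t \<longrightarrow>
        distributed P lborel (\<lambda>\<omega>. X t \<omega> - X s \<omega>) (normal_density 0 (sqrt (t - s)))) \<and>
     (\<forall>(n::nat) \<tau>. 0 \<le> \<tau> 0 \<and> strict_mono_on {..n} \<tau> \<longrightarrow>
        prob_space.indep_vars P (\<lambda>_. borel) (\<lambda>i \<omega>. X (\<tau> (Suc i)) \<omega> - X (\<tau> i) \<omega>) {..<n})"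

text \<open>
  The two-sided Wiener measure is characterised by the laws of its two halves and their
  independence; it is specified by a predicate rather than constructed. The domain of
  \<open>W\<close> is the completed Borel \<open>\<sigma>\<close>-field.
\<close>

definition two_sided_wiener_measure :: "(real \<Rightarrow> real) measure \<Rightarrow> bool" where
  "two_sided_wiener_measure W \<longleftrightarrow> (\<exists>P.
     prob_space P \<and> space P = Omega0 \<and> sets P = sets Omega0_borel \<and>
     standard_brownian_motion P (\<lambda>t \<omega>. \<omega> t) \<and>
     standard_brownian_motion P (\<lambda>t \<omega>. \<omega> (- t)) \<and>
     prob_space.indep_var P
       (PiM {0..} (\<lambda>_. borel)) (\<lambda>\<omega>. \<lambda>t\<in>{0..}. \<omega> t)
       (PiM {0..} (\<lambda>_. borel)) (\<lambda>\<omega>. \<lambda>t\<in>{0..}. \<omega> (- t)) \<and>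
     W = completion P)"

text \<open>
  Sub-\<open>\<sigma>\<close>-fields of the domain of \<open>W\<close> are represented by measures on \<^const>\<open>Omega0\<close>
  of which only the measurable sets matter.
\<close>

definition increment_field :: "(real \<Rightarrow> real) measure \<Rightarrow> ereal \<Rightarrow> ereal \<Rightarrow> (real \<Rightarrow> real) measure" where
  "increment_field W s t = sigma Omega0
     ({{\<omega>\<in>Omega0. \<omega> v - \<omega> u \<in> A} | u v A. s \<le> ereal u \<and> u \<le> v \<and> ereal v \<le> t \<and> A \<in> sets borel} \<union>
      {E \<in> sets W. measure W E = 0 \<or> measure W E = 1})"

section \<open>Random countable sets\<close>

text \<open>The coffin state is \<^const>\<open>None\<close>.\<close>

definition coffin_borel :: "real option measure" where
  "coffin_borel = sigma UNIV ({Some ` A | A. A \<in> sets borel} \<union> {{None}})"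

definition seq_set :: "(nat \<Rightarrow> real option) \<Rightarrow> real set" where
  "seq_set s = Option.these (range s)"

type_synonym random_set = "(real \<Rightarrow> real) \<Rightarrow> real set"

definition measurable_enumeration ::
  "(real \<Rightarrow> real) measure \<Rightarrow> (real \<Rightarrow> real) measure \<Rightarrow> random_set \<Rightarrow>
     (nat \<Rightarrow> (real \<Rightarrow> real) \<Rightarrow> real option) \<Rightarrow> bool" where
  "measurable_enumeration W \<A> M S \<longleftrightarrow>
     (\<forall>i. S i \<in> measurable \<A> coffin_borel) \<and> (AE \<omega> in W. M \<omega> = seq_set (\<lambda>i. S i \<omega>))"

definition random_countable_set :: "(real \<Rightarrow> real) measure \<Rightarrow> random_set \<Rightarrow> bool" where
  "random_countable_set W M \<longleftrightarrow> (\<exists>S. measurable_enumeration W W M S)"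

definition seq_law ::
  "(real \<Rightarrow> real) measure \<Rightarrow> (nat \<Rightarrow> (real \<Rightarrow> real) \<Rightarrow> real option) \<Rightarrow> (nat \<Rightarrow> real option) measure" where
  "seq_law W S = distr W (PiM UNIV (\<lambda>_. coffin_borel)) (\<lambda>\<omega> i. S i \<omega>)"

definition is_coupling :: "('a \<times> 'b) measure \<Rightarrow> 'a measure \<Rightarrow> 'b measure \<Rightarrow> bool" where
  "is_coupling R P Q \<longleftrightarrow>
     prob_space R \<and> sets R = sets (P \<Otimes>\<^sub>M Q) \<and> distr R P fst = P \<and> distr R Q snd = Q"

definition same_law :: "(real \<Rightarrow> real) measure \<Rightarrow> random_set \<Rightarrow> random_set \<Rightarrow> bool" where
  "same_law W M M' \<longleftrightarrow> (\<exists>S S' R.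
     measurable_enumeration W W M S \<and> measurable_enumeration W W M' S' \<and>
     is_coupling R (seq_law W S) (seq_law W S') \<and>
     (AE (s, s') in R. seq_set s = seq_set s'))"

definition dense_random_set :: "(real \<Rightarrow> real) measure \<Rightarrow> random_set \<Rightarrow> bool" where
  "dense_random_set W M \<longleftrightarrow> (AE \<omega> in W. closure (M \<omega>) = UNIV)"

definition local_random_set :: "(real \<Rightarrow> real) measure \<Rightarrow> random_set \<Rightarrow> bool" where
  "local_random_set W M \<longleftrightarrow> (\<forall>s t :: ereal. s < t \<longrightarrow>
     (\<exists>S. measurable_enumeration W (increment_field W s t)
        (\<lambda>\<omega>. M \<omega> \<inter> {x. s < ereal x \<and> ereal x < t}) S))"

definition stationary_in_law :: "(real \<Rightarrow> real) measure \<Rightarrow> random_set \<Rightarrow> bool" where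
  "stationary_in_law W M \<longleftrightarrow> (\<forall>u. same_law W M (\<lambda>\<omega>. (\<lambda>x. u + x) ` M \<omega>))"

end

theory Submission
  imports Defs
begin

text \<open>
  Call a random sequence sample-like if, conditionally on finitely many of its values, a set
  depending measurably on these values is hit by a further value iff it is not Lebesgue-null.
  An i.i.d. sample from a law equivalent to Lebesgue measure is sample-like. So is an enumeration
  of a dense local set \<open>M\<close> that is stationary in law: by Fubini over the shift and a
  Steinhaus argument, \<open>M\<close> meets a fixed Borel set with probability \<open>0\<close> or \<open>1\<close> according to
  whether the set is null, and locality allows the fixed set to be replaced by one that depends on
  points of \<open>M\<close> outside a small interval.

  Two sample-like sequences are matched by going back and forth. A step takes the first unused
  value of one sequence; its conditional law given the past has a density, and since every
  non-null set is hit by unused values of the other sequence, a greedy randomised selection finds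
  one among them with exactly this conditional law. In the limit both sequences are enumerated by
  sequences of the same law. The two enumerations are then identified, and one of the original
  sequences is resampled conditionally on its enumeration. Its entries lie in a countable set
  that is known given the enumeration, so no general disintegration theorem is needed.
\<close>

section \<open>Selecting a value with a prescribed conditional law\<close>

text \<open>Being hit almost surely says nothing about how much mass a single entry puts on a set,
  so one entry need not dominate a prescribed conditional law; the selection therefore spreads the
  law over all entries, each taking a share of what the earlier ones left. Matching in one direction
  only would place a copy of one sequence inside the other set without exhausting it; hence the two
  sides dictate the next value in turn. Selected values depend on auxiliary uniform noise. For this
  reason sample-likeness quantifies over all histories inside the almost sure statement: only
  countably many occur, and a noise-dependent one can be inserted afterwards. The final coupling
  keeps one of the probability spaces unchanged as a component, so only one sequence has to be
  recovered from its reordering. On the Wiener side, the points on which the target set depends are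
  named by indices of an enumeration that is not adapted to any interval; renaming them through
  enumerations of the two outer parts of \<open>M\<close> makes them independent of what happens
  inside.\<close>

definition U01 :: "real measure" where
  "U01 = uniform_measure lborel {0..<1}"

lemma sets_U01[simp, measurable_cong]: "sets U01 = sets borel"
  by (simp add: U01_def)

lemma space_U01[simp]: "space U01 = UNIV"
  by (simp add: U01_def)

lemma prob_space_U01: "prob_space U01"
  unfolding U01_def by (rule prob_space_uniform_measure) auto

lemma emeasure_U01_less:
  assumes "b \<le> 1" shows "emeasure U01 {r. ennreal r < b} = b"
proof -
  obtain b' where b': "b = ennreal b'" "0 \<le> b'" "b' \<le> 1"
    using assms by (cases b) (auto simp: top_unique)
  \<comment> \<open>For \<open>b > 0\<close> the negative \<open>r\<close> satisfy the inequality as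
    well, since \<open>ennreal\<close> truncates them to 0; the uniform law does not charge
    them.\<close>
  have "{0..<1} \<inter> {r. ennreal r < b} = {0..<b'}"
    using b' by (auto simp: ennreal_less_iff)
  moreover have "{r. ennreal r < b} \<in> sets borel" by measurable
  ultimately show ?thesis using b' by (simp add: U01_def emeasure_uniform_measure flip: ennreal_1 add: divide_ennreal)
qed

text \<open>The unit interval is cut into consecutive pieces of lengths \<open>c n x\<close>, and
  the uniform variable decides by the piece it falls into. The integral identity, with
  \<open>G\<close> depending on the chosen index and on \<open>x\<close>, says that index
  \<open>n\<close> has conditional probability \<open>c n x\<close> given \<open>x\<close>, without
  mentioning conditional expectations.\<close>

lemma random_choice:
  fixes Q :: "'a measure" and c :: "nat \<Rightarrow> 'a \<Rightarrow> ennreal"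
  assumes Q: "prob_space Q" and c[measurable]: "\<And>n. c n \<in> borel_measurable Q"
    and sum1: "AE x in Q. (\<Sum>n. c n x) = 1"
  obtains J :: "'a \<times> real \<Rightarrow> nat" where "J \<in> measurable (Q \<Otimes>\<^sub>M U01) (count_space UNIV)"
    "\<And>G. (\<And>n. G n \<in> borel_measurable Q) \<Longrightarrow>
       (\<integral>\<^sup>+z. G (J z) (fst z) \<partial>(Q \<Otimes>\<^sub>M U01)) = (\<Sum>n. \<integral>\<^sup>+x. c n x * G n x \<partial>Q)"
proof -
  interpret Q: prob_space Q by fact
  interpret U: prob_space U01 by (rule prob_space_U01)
  define s where "s n x = (\<Sum>m<n. c m x)" for n x
  \<comment> \<open>Piece \<open>n\<close> runs from \<open>s n\<close> to \<open>s (Suc n)\<close>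
    and is closed on the left, so the first \<open>n\<close> with \<open>r\<close> below the right
    end \<open>s (Suc n)\<close> is the piece that contains \<open>r\<close>.\<close>
  define J where "J = (\<lambda>(x, r). LEAST n. ennreal r < s (Suc n) x)"
  have [measurable]: "s n \<in> borel_measurable Q" for n unfolding s_def by measurable
  have J[measurable]: "J \<in> measurable (Q \<Otimes>\<^sub>M U01) (count_space UNIV)"
    unfolding J_def by measurable
  have mono: "s m x \<le> s n x" if "m \<le> n" for m n x
    unfolding s_def using that by (intro sum_mono2) auto
  have le1: "s n x \<le> 1" if "(\<Sum>n. c n x) = 1" for n x
    using sum_le_suminf[of "\<lambda>n. c n x" "{..<n}"] that by (auto simp: s_def)
  have Jn: "emeasure U01 {r. J (x, r) = n} = c n x" if 1: "(\<Sum>n. c n x) = 1" and x: "x \<in> space Q" for x n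
  proof -
    have lim: "(\<lambda>n. s n x) \<longlonglongrightarrow> 1"
      using 1 unfolding s_def by (metis summable_LIMSEQ summableI)
    have Jiff: "J (x, r) < Suc m \<longleftrightarrow> ennreal r < s (Suc m) x" if r: "ennreal r < 1" for r m
    proof
      have "\<exists>n. ennreal r < s n x"
        using order_tendstoD(1)[OF lim r] by (auto simp: eventually_sequentially)
      then have ex: "\<exists>n. ennreal r < s (Suc n) x"
        using mono[of _ "Suc _" x] by (meson le_SucI less_le_trans order_refl)
      assume "J (x, r) < Suc m"
      with LeastI_ex[OF ex] mono[of "Suc (J (x, r))" "Suc m" x] show "ennreal r < s (Suc m) x"
        by (auto simp: J_def intro: less_le_trans)
    next
      assume "ennreal r < s (Suc m) x"
      then show "J (x, r) < Suc m" unfolding J_def by (auto intro: le_less_trans[OF Least_le])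
    qed
    have AE1: "AE r in U01. ennreal r < 1"
    proof (rule AE_I[where N="{1..}"])
      have "{0..<1} \<inter> {1..} = ({} :: real set)" by auto
      then show "emeasure U01 {1..} = 0" by (simp add: U01_def emeasure_uniform_measure)
      show "{r \<in> space U01. \<not> ennreal r < 1} \<subseteq> {1..}"
        by (auto simp: not_less)
    qed simp
    have Jlt: "emeasure U01 {r. J (x, r) < m} = s m x" for m
    proof (cases m)
      case (Suc k)
      have "emeasure U01 {r. J (x, r) < m} = emeasure U01 {r. ennreal r < s m x}"
      proof (rule emeasure_eq_AE)
        show "AE r in U01. r \<in> {r. J (x, r) < m} \<longleftrightarrow> r \<in> {r. ennreal r < s m x}"
          using AE1 Jiff Suc by auto
        have "Measurable.pred U01 (\<lambda>r. J (x, r) < m)" using x by measurable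
        then show "{r. J (x, r) < m} \<in> sets U01" by (simp add: pred_def)
      qed measurable
      with emeasure_U01_less[OF le1[OF 1]] show ?thesis by simp
    qed (simp add: s_def)
    have m: "{r. J (x, r) < k} \<in> sets U01" for k
    proof -
      have "Measurable.pred U01 (\<lambda>r. J (x, r) < k)" using x by measurable
      then show ?thesis by (simp add: pred_def)
    qed
    have "{r. J (x, r) = n} = {r. J (x, r) < Suc n} - {r. J (x, r) < n}" by auto
    also have "emeasure U01 \<dots> = s (Suc n) x - s n x"
      using m le1[OF 1, of n] by (subst emeasure_Diff) (auto simp: Jlt top_unique)
    also have "\<dots> = c n x" using le1[OF 1, of n] unfolding s_def by (simp add: top_unique ennreal_add_diff_cancel_left[of "sum _ _"]) (metis ennreal_add_diff_cancel_left ennreal_one_less_top infinity_ennreal_def leD)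
    finally show ?thesis .
  qed
  have "(\<integral>\<^sup>+z. G (J z) (fst z) \<partial>(Q \<Otimes>\<^sub>M U01)) = (\<Sum>n. \<integral>\<^sup>+x. c n x * G n x \<partial>Q)"
    if G[measurable]: "\<And>n. G n \<in> borel_measurable Q" for G
  proof -
    have "(\<integral>\<^sup>+z. G (J z) (fst z) \<partial>(Q \<Otimes>\<^sub>M U01)) = (\<integral>\<^sup>+x. \<integral>\<^sup>+r. G (J (x, r)) x \<partial>U01 \<partial>Q)"
      by (subst U.nn_integral_fst[symmetric]) auto
    also have "\<dots> = (\<integral>\<^sup>+x. (\<Sum>n. c n x * G n x) \<partial>Q)"
    proof (rule nn_integral_cong_AE)
      show "AE x in Q. (\<integral>\<^sup>+r. G (J (x, r)) x \<partial>U01) = (\<Sum>n. c n x * G n x)"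
        using sum1 AE_space
      proof eventually_elim
        case (elim x)
        have m: "{r. J (x, r) = n} \<in> sets U01" for n
        proof -
          have "Measurable.pred U01 (\<lambda>r. J (x, r) = n)" using elim by measurable
          then show ?thesis by (simp add: pred_def)
        qed
        have "(\<integral>\<^sup>+r. G (J (x, r)) x \<partial>U01) = (\<integral>\<^sup>+r. (\<Sum>n. G n x * indicator {r. J (x, r) = n} r) \<partial>U01)"
        proof (rule nn_integral_cong)
          fix r
          have "(\<Sum>n. G n x * indicator {r. J (x, r) = n} r) = (\<Sum>n\<in>{J (x, r)}. G n x * indicator {r. J (x, r) = n} r)"
            by (rule suminf_finite) (auto simp: indicator_def)
          then show "G (J (x, r)) x = (\<Sum>n. G n x * indicator {r. J (x, r) = n} r)" by simp
        qed
        also have "\<dots> = (\<Sum>n. G n x * emeasure U01 {r. J (x, r) = n})"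
          using m by (subst nn_integral_suminf) (auto simp: nn_integral_cmult_indicator)
        finally show ?case using Jn elim by (simp add: mult.commute)
      qed
    qed
    also have "\<dots> = (\<Sum>n. \<integral>\<^sup>+x. c n x * G n x \<partial>Q)"
      by (rule nn_integral_suminf) auto
    finally show ?thesis .
  qed
  with J that show thesis by blast
qed

text \<open>Says that a candidate accepted with ratio other than 1 has used up the remaining target
  density at its value. At \<open>h = 0\<close> the quotient is 0 by convention whatever
  \<open>e\<close> is, and would carry no such information.\<close>

lemma ennreal_ratio_neq_1:
  fixes h e :: ennreal
  assumes "h \<noteq> 0" "h \<noteq> \<top>" "min h e / h \<noteq> 1"
  shows "min h e = e"
proof (rule ccontr)
  assume "min h e \<noteq> e"
  then have "min h e = h" by (auto simp: min_def split: if_splits)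
  with assms show False by (simp add: less_top)
qed

text \<open>Everything is expressed by densities against \<open>\<nu>\<close>, the law of
  \<open>H\<close> times Lebesgue measure: \<open>null\<close> gives one to every valid candidate
  and \<open>ac\<close> gives one to the target. Unspent weight at a point is compatible with
  \<open>nonnull\<close> only if the target is fully covered over its history; and full coverage
  over a set of histories forces all weight there to be spent, because \<open>\<tau>\<close> has the
  law of \<open>H\<close> as first marginal.\<close>

lemma selection_weights:
  fixes Q :: "'a measure" and N :: "'h measure" and H :: "'a \<Rightarrow> 'h"
    and Z :: "nat \<Rightarrow> 'a \<Rightarrow> real" and V :: "nat \<Rightarrow> 'a \<Rightarrow> bool"
  assumes Q: "prob_space Q"
    and H[measurable]: "H \<in> measurable Q N"
    and Z[measurable]: "\<And>n. Z n \<in> borel_measurable Q"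
    and V[measurable]: "\<And>n. Measurable.pred Q (V n)"
    and null: "\<And>A. A \<in> sets (N \<Otimes>\<^sub>M borel) \<Longrightarrow>
       AE x in Q. emeasure lborel (Pair (H x) -` A) = 0 \<longrightarrow> (\<forall>n. V n x \<longrightarrow> (H x, Z n x) \<notin> A)"
    and nonnull: "\<And>A. A \<in> sets (N \<Otimes>\<^sub>M borel) \<Longrightarrow>
       AE x in Q. emeasure lborel (Pair (H x) -` A) \<noteq> 0 \<longrightarrow> (\<exists>n. V n x \<and> (H x, Z n x) \<in> A)"
    and \<tau>: "sets \<tau> = sets (N \<Otimes>\<^sub>M borel)" "distr \<tau> N fst = distr Q N H"
    and ac: "absolutely_continuous (distr Q N H \<Otimes>\<^sub>M lborel) \<tau>"
  obtains c :: "nat \<Rightarrow> 'a \<Rightarrow> ennreal" where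
    "\<And>n. c n \<in> borel_measurable Q" "AE x in Q. (\<Sum>n. c n x) = 1"
    "\<And>n x. \<not> V n x \<Longrightarrow> c n x = 0"
    "\<And>A. A \<in> sets (N \<Otimes>\<^sub>M borel) \<Longrightarrow>
       (\<Sum>n. \<integral>\<^sup>+x. c n x * indicator A (H x, Z n x) \<partial>Q) = emeasure \<tau> A"
proof -
  interpret Q: prob_space Q by fact
  interpret D: prob_space "distr Q N H" by (rule Q.prob_space_distr) fact
  define \<nu> where "\<nu> = distr Q N H \<Otimes>\<^sub>M (lborel :: real measure)"
  interpret \<nu>: pair_sigma_finite "distr Q N H" "lborel :: real measure" ..
  have sf: "sigma_finite_measure \<nu>" unfolding \<nu>_def ..
  interpret nu: sigma_finite_measure \<nu> by fact
  have sets_\<nu>[measurable_cong, simp]: "sets \<nu> = sets (N \<Otimes>\<^sub>M borel)"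
    unfolding \<nu>_def by (intro sets_pair_measure_cong) auto
  have \<nu>0: "emeasure \<nu> A = (\<integral>\<^sup>+x. emeasure lborel (Pair (H x) -` A) \<partial>Q)" if [measurable]: "A \<in> sets (N \<Otimes>\<^sub>M borel)" for A
  proof -
    have A: "A \<in> sets (distr Q N H \<Otimes>\<^sub>M lborel)" using that sets_\<nu> \<nu>_def by simp
    have "(\<lambda>x. emeasure lborel (Pair x -` A)) \<in> borel_measurable (distr Q N H)"
      by (rule \<nu>.measurable_emeasure_Pair1) (use A in simp)
    then show ?thesis unfolding \<nu>_def
      by (subst lborel.emeasure_pair_measure_alt[OF A]) (simp add: nn_integral_distr)
  qed
  define HZ where "HZ n x = (H x, Z n x)" for n x
  have [measurable]: "HZ n \<in> measurable Q (N \<Otimes>\<^sub>M borel)" for n unfolding HZ_def by measurable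
  have HZ_space: "HZ n x \<in> space \<nu>" if "x \<in> space Q" for n x
    unfolding sets_eq_imp_space_eq[OF sets_\<nu>] by (rule measurable_space[OF _ that]) measurable
  define \<eta> where "\<eta> n w = distr (density Q (\<lambda>x. w x * indicator {x. V n x} x)) (N \<Otimes>\<^sub>M borel) (HZ n)" for n and w :: "'a \<Rightarrow> ennreal"
  define dn where "dn n w = RN_deriv \<nu> (\<eta> n w)" for n w
  define rat where "rat n w e y = min (dn n w y) (e y) / dn n w y" for n w and e :: "'h \<times> real \<Rightarrow> ennreal" and y
  \<comment> \<open>Greedy selection: \<open>w n\<close> is the weight not yet assigned and \<open>e n\<close> the part of the density of \<open>\<tau>\<close>
    not yet covered; \<open>Z n\<close>, whose density under the remaining weight is \<open>h n\<close>, is selected with weight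
    \<open>min (h n) (e n) / h n\<close>. Where weight remains, \<open>e\<close> is exhausted at every valid value,
    which contradicts the assumption on non-null sets unless no weight remains.\<close>
  define step where "step n = (\<lambda>(w, e).
     (\<lambda>x. w x * (1 - (if V n x then rat n w e (HZ n x) else 0)),
      \<lambda>y. e y - min (dn n w y) (e y)))" for n
  define st where "st = rec_nat (\<lambda>_::'a. 1::ennreal, RN_deriv \<nu> \<tau>) step"
  define w where "w n = fst (st n)" for n
  define e where "e n = snd (st n)" for n
  define h where "h n = dn n (w n)" for n
  define m where "m n y = min (h n y) (e n y)" for n y
  define \<rho> where "\<rho> n y = m n y / h n y" for n y
  define c where "c n x = w n x * (if V n x then \<rho> n (HZ n x) else 0)" for n x
  have w0: "w 0 x = 1" and e0: "e 0 = RN_deriv \<nu> \<tau>" for x by (simp_all add: w_def e_def st_def)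
  have wS: "w (Suc n) x = w n x * (1 - (if V n x then \<rho> n (HZ n x) else 0))"
    and eS: "e (Suc n) y = e n y - m n y" for n x y
    by (simp_all add: w_def e_def st_def step_def split_beta h_def \<rho>_def m_def rat_def)
  have \<rho>1: "\<rho> n y \<le> 1" for n y
    unfolding \<rho>_def m_def by (cases "h n y = 0 \<or> h n y = \<top>")
      (auto simp: ennreal_divide_top divide_le_posI_ennreal zero_less_iff_neq_zero)
  have mh[measurable]: "h n \<in> borel_measurable \<nu>" for n unfolding h_def dn_def by simp
  have me[measurable]: "e n \<in> borel_measurable \<nu>" for n
    by (induction n) (auto simp: e0 eS[abs_def] m_def)
  have mm[measurable]: "m n \<in> borel_measurable \<nu>" for n unfolding m_def by measurable
  have m\<rho>[measurable]: "\<rho> n \<in> borel_measurable \<nu>" for n unfolding \<rho>_def by measurable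
  have meas_N: "f \<in> borel_measurable \<nu> \<Longrightarrow> f \<in> borel_measurable (N \<Otimes>\<^sub>M borel)" for f :: "_ \<Rightarrow> ennreal"
    using measurable_cong_sets[OF sets_\<nu> refl] by blast
  have m\<rho>HZ[measurable]: "(\<lambda>x. \<rho> n (HZ n x)) \<in> borel_measurable Q" for n
    by (rule measurable_compose[OF _ meas_N[OF m\<rho>]]) measurable
  have mw[measurable]: "w n \<in> borel_measurable Q" for n
    by (induction n) (auto simp: w0[abs_def] wS[abs_def])
  have mc[measurable]: "c n \<in> borel_measurable Q" for n unfolding c_def by measurable
  have wc: "w (Suc n) x + c n x = w n x" for n x
    unfolding wS c_def distrib_left[symmetric] using \<rho>1 by (simp add: diff_add_cancel_ennreal)
  \<comment> \<open>Conservation of weight: what is left and what has been assigned add up to 1.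
    \<open>e_sum\<close> is the same balance for the target density.\<close>
  have w_sum: "w n x + (\<Sum>k<n. c k x) = 1" for n x
  proof (induction n)
    case (Suc n)
    have "w (Suc n) x + (\<Sum>k<Suc n. c k x) = (w (Suc n) x + c n x) + (\<Sum>k<n. c k x)"
      by (simp add: add_ac)
    with Suc wc[of n x] show ?case by simp
  qed (simp add: w0)
  have em: "e (Suc n) y + m n y = e n y" for n y
    unfolding eS by (rule diff_add_cancel_ennreal) (simp add: m_def)
  have e_sum: "e n y + (\<Sum>k<n. m k y) = e 0 y" for n y
  proof (induction n)
    case (Suc n)
    have "e (Suc n) y + (\<Sum>k<Suc n. m k y) = (e (Suc n) y + m n y) + (\<Sum>k<n. m k y)"
      by (simp add: add_ac)
    with Suc em[of n y] show ?case by simp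
  qed simp
  have w1: "w n x \<le> 1" for n x using w_sum[of n x] by (metis le_iff_add)
  define C where "C x = (\<Sum>n. c n x)" for x
  define K where "K y = (\<Sum>n. m n y)" for y
  have [measurable]: "C \<in> borel_measurable Q" "K \<in> borel_measurable \<nu>" unfolding C_def K_def by measurable
  have C1: "C x \<le> 1" for x
    unfolding C_def by (rule suminf_le_const) (auto, metis w_sum add.commute le_iff_add)
  have Ke: "K y \<le> e 0 y" for y
    unfolding K_def by (rule suminf_le_const) (auto, metis e_sum add.commute le_iff_add)
  have \<eta>_int: "(\<integral>\<^sup>+y. f y \<partial>\<eta> n (w n)) = (\<integral>\<^sup>+x. w n x * indicator {x. V n x} x * f (HZ n x) \<partial>Q)"
    if f[measurable]: "f \<in> borel_measurable (N \<Otimes>\<^sub>M borel)" for f n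
    unfolding \<eta>_def by (subst nn_integral_distr, simp, simp, subst nn_integral_density) (auto simp: mult_ac)
  have sets_\<eta>: "sets (\<eta> n (w n)) = sets \<nu>" for n by (simp add: \<eta>_def)
  have \<eta>_em: "emeasure (\<eta> n (w n)) A = (\<integral>\<^sup>+x. w n x * indicator {x. V n x} x * indicator A (HZ n x) \<partial>Q)"
    if "A \<in> sets (N \<Otimes>\<^sub>M borel)" for A n
    using \<eta>_int[of "indicator A" n] that sets_\<eta> by simp
  \<comment> \<open>Here \<open>null\<close> enters: a \<open>\<nu>\<close>-null set has null fibres
    over almost every history, and valid candidates avoid these.\<close>
  have \<eta>_ac: "absolutely_continuous \<nu> (\<eta> n (w n))" for n
    unfolding absolutely_continuous_def
  proof
    fix A assume "A \<in> null_sets \<nu>"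
    then have A[measurable]: "A \<in> sets (N \<Otimes>\<^sub>M borel)" and A0: "emeasure \<nu> A = 0" by auto
    have mA: "(\<lambda>x. emeasure lborel (Pair (H x) -` A)) \<in> borel_measurable Q"
      by (rule measurable_compose[OF H]) (rule lborel.measurable_emeasure_Pair, simp)
    from A0 have "AE x in Q. emeasure lborel (Pair (H x) -` A) = 0"
      unfolding \<nu>0[OF A] using mA by (subst (asm) nn_integral_0_iff_AE) auto
    with null[OF A] have "AE x in Q. V n x \<longrightarrow> HZ n x \<notin> A" by eventually_elim (auto simp: HZ_def)
    then have "emeasure (\<eta> n (w n)) A = 0"
      unfolding \<eta>_em[OF A] by (subst nn_integral_0_iff_AE) (auto elim!: eventually_mono simp: indicator_def)
    then show "A \<in> null_sets (\<eta> n (w n))" using A sets_\<eta> by auto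
  qed
  have \<eta>_fin: "finite_measure (\<eta> n (w n))" for n
  proof
    have "emeasure (\<eta> n (w n)) (space (\<eta> n (w n))) \<le> (\<integral>\<^sup>+x. 1 \<partial>Q)"
      by (subst \<eta>_em) (auto simp: \<eta>_def indicator_def w1 simp del: nn_integral_const intro!: nn_integral_mono)
    then show "emeasure (\<eta> n (w n)) (space (\<eta> n (w n))) \<noteq> \<infinity>" by (auto simp: Q.emeasure_space_1 top_unique)
  qed
  have \<eta>_dens: "density \<nu> (h n) = \<eta> n (w n)" for n
    unfolding h_def dn_def using \<eta>_ac sets_\<eta> by (intro nu.density_RN_deriv) auto
  have h_fin: "AE y in \<nu>. h n y \<noteq> \<infinity>" for n
  proof -
    interpret finite_measure "\<eta> n (w n)" by (rule \<eta>_fin)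
    show ?thesis unfolding h_def dn_def
      by (rule nu.RN_deriv_finite) (auto simp: \<eta>_ac sets_\<eta> intro: sigma_finite_measure_axioms)
  qed
  \<comment> \<open>Multiplying the density \<open>h n\<close> by the acceptance ratio leaves
    exactly \<open>m n\<close>, so a selection covers precisely the part of the target that is
    subtracted from \<open>e n\<close>.\<close>
  have c_int: "(\<integral>\<^sup>+x. c n x * indicator A (HZ n x) \<partial>Q) = (\<integral>\<^sup>+y. m n y * indicator A y \<partial>\<nu>)"
    if A[measurable]: "A \<in> sets (N \<Otimes>\<^sub>M borel)" for A n
  proof -
    have "(\<integral>\<^sup>+x. c n x * indicator A (HZ n x) \<partial>Q) = (\<integral>\<^sup>+y. \<rho> n y * indicator A y \<partial>\<eta> n (w n))"
      by (subst \<eta>_int) (auto simp: c_def indicator_def meas_N intro!: nn_integral_cong)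
    also have "\<dots> = (\<integral>\<^sup>+y. h n y * (\<rho> n y * indicator A y) \<partial>\<nu>)"
      unfolding \<eta>_dens[symmetric] by (subst nn_integral_density) auto
    also have "\<dots> = (\<integral>\<^sup>+y. m n y * indicator A y \<partial>\<nu>)"
    proof (rule nn_integral_cong_AE)
      show "AE y in \<nu>. h n y * (\<rho> n y * indicator A y) = m n y * indicator A y"
        using h_fin[of n]
      proof eventually_elim
        case (elim y)
        have "h n y * \<rho> n y = m n y"
        proof (cases "h n y = 0")
          case False
          then show ?thesis using elim unfolding \<rho>_def
            by (simp add: ennreal_times_divide mult.commute[of "h n y"] less_top mult_divide_eq_ennreal)
        qed (simp add: m_def)
        then show ?case by (simp add: mult.assoc[symmetric])
      qed
    qed
    finally show ?thesis .
  qed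
  have CK: "(\<Sum>n. \<integral>\<^sup>+x. c n x * indicator A (HZ n x) \<partial>Q) = (\<integral>\<^sup>+y. K y * indicator A y \<partial>\<nu>)"
    if A[measurable]: "A \<in> sets (N \<Otimes>\<^sub>M borel)" for A
    unfolding c_int[OF A] K_def by (subst nn_integral_suminf[symmetric]) (auto simp: ennreal_suminf_multc)
  have \<tau>_dens: "density \<nu> (e 0) = \<tau>"
    unfolding e0 using ac \<tau> by (intro nu.density_RN_deriv) (auto simp: \<nu>_def[symmetric])
  have \<tau>_em: "emeasure \<tau> A = (\<integral>\<^sup>+y. e 0 y * indicator A y \<partial>\<nu>)" if "A \<in> sets (N \<Otimes>\<^sub>M borel)" for A
    unfolding \<tau>_dens[symmetric] using that by (subst emeasure_density) auto
  \<comment> \<open>Under the law with density \<open>h n\<close> the value of \<open>h n\<close> is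
    almost surely positive and finite, so at a valid candidate with weight left the ratio is a
    genuine quotient, unaffected by the conventions for 0 and infinity.\<close>
  have good: "AE x in Q. \<forall>n. V n x \<and> w n x \<noteq> 0 \<longrightarrow> h n (HZ n x) \<noteq> 0 \<and> h n (HZ n x) \<noteq> \<infinity>"
    unfolding AE_all_countable
  proof
    fix n
    define A where "A = {y \<in> space \<nu>. h n y = 0 \<or> h n y = \<infinity>}"
    have A\<nu>: "A \<in> sets \<nu>" unfolding A_def by measurable
    then have A[measurable]: "A \<in> sets (N \<Otimes>\<^sub>M borel)" by simp
    have "emeasure (\<eta> n (w n)) A = (\<integral>\<^sup>+y. h n y * indicator A y \<partial>\<nu>)"
      unfolding \<eta>_dens[symmetric] using A\<nu> by (subst emeasure_density) auto
    also have "\<dots> = 0"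
      using h_fin[of n] A\<nu> by (subst nn_integral_0_iff_AE) (auto elim!: eventually_mono simp: A_def indicator_def)
    finally have "(\<integral>\<^sup>+x. w n x * indicator {x. V n x} x * indicator A (HZ n x) \<partial>Q) = 0"
      by (simp add: \<eta>_em)
    then have "AE x in Q. w n x * indicator {x. V n x} x * indicator A (HZ n x) = 0"
      by (subst (asm) nn_integral_0_iff_AE) auto
    then show "AE x in Q. V n x \<and> w n x \<noteq> 0 \<longrightarrow> h n (HZ n x) \<noteq> 0 \<and> h n (HZ n x) \<noteq> \<infinity>"
      using AE_space by eventually_elim (auto simp: A_def HZ_space indicator_def split: if_splits)
  qed
  \<comment> \<open>The part of the target that is never covered. If weight survives at
    \<open>x\<close>, every valid candidate was accepted with ratio other than 1, so the target was
    exhausted at its value; hence no valid candidate lies in \<open>B\<close>.\<close>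
  define B where "B = {y \<in> space \<nu>. K y < e 0 y}"
  have B\<nu>: "B \<in> sets \<nu>" unfolding B_def by measurable
  then have B[measurable]: "B \<in> sets (N \<Otimes>\<^sub>M borel)" by simp
  have avoid: "AE x in Q. C x < 1 \<longrightarrow> (\<forall>n. V n x \<longrightarrow> HZ n x \<notin> B)"
    using good
  proof eventually_elim
    case (elim x)
    show ?case
    proof (intro impI allI notI)
      fix n assume C: "C x < 1" and Vn: "V n x" and inB: "HZ n x \<in> B"
      have wpos: "w k x \<noteq> 0" for k
      proof
        assume "w k x = 0"
        with w_sum[of k x] have "1 \<le> C x" unfolding C_def using sum_le_suminf[of "\<lambda>n. c n x" "{..<k}"] by auto
        with C show False by auto
      qed
      have "\<rho> n (HZ n x) \<noteq> 1" using wpos[of "Suc n"] Vn by (auto simp: wS)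
      then have "m n (HZ n x) = e n (HZ n x)"
        using elim wpos Vn ennreal_ratio_neq_1[of "h n (HZ n x)" "e n (HZ n x)"] by (auto simp: \<rho>_def m_def)
      then have "e 0 (HZ n x) = (\<Sum>k<Suc n. m k (HZ n x))"
        using e_sum[of n "HZ n x"] by (simp add: add.commute)
      also have "\<dots> \<le> K (HZ n x)" unfolding K_def by (rule sum_le_suminf) auto
      finally show False using inB by (auto simp: B_def)
    qed
  qed
  have mB: "(\<lambda>y. emeasure lborel (Pair y -` B)) \<in> borel_measurable N"
    by (rule lborel.measurable_emeasure_Pair) simp
  have "AE x in Q. C x < 1 \<longrightarrow> emeasure lborel (Pair (H x) -` B) = 0"
    using avoid nonnull[OF B] by eventually_elim (auto simp: HZ_def)
  \<comment> \<open>Nullity of the fibre of \<open>B\<close> is a condition \<open>A\<close> on the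
    history alone. Over \<open>A\<close> the covered density is the whole target, whose mass there
    equals the probability of \<open>A\<close> by the marginal condition. Since
    \<open>C \<le> 1\<close>, equality of the integrals forces \<open>C = 1\<close> over
    \<open>A\<close>.\<close>
  moreover have "AE x in Q. emeasure lborel (Pair (H x) -` B) = 0 \<longrightarrow> C x = 1"
  proof -
    define A where "A = {y \<in> space N. emeasure lborel (Pair y -` B) = 0}"
    have A[measurable]: "A \<in> sets N" unfolding A_def using mB by measurable
    define AR where "AR = A \<times> (UNIV :: real set)"
    have AR[measurable]: "AR \<in> sets (N \<Otimes>\<^sub>M borel)" unfolding AR_def by measurable
    have [simp]: "indicator AR (HZ n x) = indicator A (H x)" for n x by (auto simp: AR_def HZ_def indicator_def)
    have "emeasure \<nu> (B \<inter> AR) = 0"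
      unfolding \<nu>0[OF sets.Int[OF B AR]]
    proof (subst nn_integral_0_iff_AE)
      show "(\<lambda>x. emeasure lborel (Pair (H x) -` (B \<inter> AR))) \<in> borel_measurable Q"
        by (rule measurable_compose[OF H]) (rule lborel.measurable_emeasure_Pair, simp)
      have "emeasure lborel (Pair y -` (B \<inter> AR)) = 0" for y
      proof (cases "y \<in> A")
        case True
        then have "Pair y -` (B \<inter> AR) = Pair y -` B" by (auto simp: AR_def)
        with True show ?thesis by (simp add: A_def)
      next
        case False
        then have "Pair y -` (B \<inter> AR) = {}" by (auto simp: AR_def)
        then show ?thesis by simp
      qed
      then show "AE x in Q. emeasure lborel (Pair (H x) -` (B \<inter> AR)) = 0" by simp
    qed
    then have "AE y in \<nu>. y \<notin> B \<inter> AR"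
      using B\<nu> AR by (intro AE_not_in) (auto intro!: null_setsI)
    then have "AE y in \<nu>. K y * indicator AR y = e 0 y * indicator AR y"
      using AE_space
    proof eventually_elim
      case (elim y)
      then show ?case using Ke[of y] by (auto simp: B_def indicator_def not_less)
    qed
    then have KAR: "(\<integral>\<^sup>+y. K y * indicator AR y \<partial>\<nu>) = (\<integral>\<^sup>+y. e 0 y * indicator AR y \<partial>\<nu>)"
      by (rule nn_integral_cong_AE)
    have "(\<integral>\<^sup>+x. C x * indicator A (H x) \<partial>Q) = (\<Sum>n. \<integral>\<^sup>+x. c n x * indicator AR (HZ n x) \<partial>Q)"
      unfolding C_def by (subst nn_integral_suminf[symmetric]) (auto simp: ennreal_suminf_multc)
    also have "\<dots> = emeasure \<tau> AR" unfolding CK[OF AR] KAR \<tau>_em[OF AR] ..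
    also have "\<dots> = emeasure (distr \<tau> N fst) A"
    proof (subst emeasure_distr)
      show "fst \<in> measurable \<tau> N" using \<tau>(1) by (simp cong: measurable_cong_sets)
      have "space \<tau> = space N \<times> UNIV" using sets_eq_imp_space_eq[OF \<tau>(1)] by (simp add: space_pair_measure)
      then have "fst -` A \<inter> space \<tau> = AR" using sets.sets_into_space[OF A] by (auto simp: AR_def)
      then show "emeasure \<tau> AR = emeasure \<tau> (fst -` A \<inter> space \<tau>)" by simp
    qed simp
    also have "\<dots> = (\<integral>\<^sup>+x. indicator A (H x) \<partial>Q)"
      unfolding \<tau>(2) by (subst nn_integral_indicator[symmetric], simp, subst nn_integral_distr) auto
    finally have eq: "(\<integral>\<^sup>+x. C x * indicator A (H x) \<partial>Q) = (\<integral>\<^sup>+x. indicator A (H x) \<partial>Q)" .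
    have "(\<integral>\<^sup>+x. indicator A (H x) - C x * indicator A (H x) \<partial>Q) = 0"
    proof -
      have "(\<integral>\<^sup>+x. C x * indicator A (H x) \<partial>Q) \<le> (\<integral>\<^sup>+x. 1 \<partial>Q)"
        using C1 by (intro nn_integral_mono) (auto simp: indicator_def)
      then have fin: "(\<integral>\<^sup>+x. C x * indicator A (H x) \<partial>Q) \<noteq> \<infinity>"
        by (auto simp: Q.emeasure_space_1 top_unique)
      have "(\<integral>\<^sup>+x. indicator A (H x) - C x * indicator A (H x) \<partial>Q)
          = (\<integral>\<^sup>+x. indicator A (H x) \<partial>Q) - (\<integral>\<^sup>+x. C x * indicator A (H x) \<partial>Q)"
        by (rule nn_integral_diff) (use C1 fin in \<open>auto simp: indicator_def\<close>)
      also have "\<dots> = 0" using fin unfolding eq by (simp add: less_top)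
      finally show ?thesis .
    qed
    then have "AE x in Q. indicator A (H x) - C x * indicator A (H x) = 0"
      by (subst (asm) nn_integral_0_iff_AE) auto
    then show ?thesis using AE_space
    proof eventually_elim
      case (elim x)
      then show ?case using C1[of x] measurable_space[OF H, of x]
        by (auto simp: A_def indicator_def diff_eq_0_iff_ennreal split: if_splits)
    qed
  qed
  ultimately have C_eq1: "AE x in Q. C x = 1"
    by eventually_elim (use C1 in \<open>force simp: order.strict_iff_order\<close>)
  have "(\<Sum>n. \<integral>\<^sup>+x. c n x * indicator A (HZ n x) \<partial>Q) = emeasure \<tau> A" if A[measurable]: "A \<in> sets (N \<Otimes>\<^sub>M borel)" for A
  proof -
    \<comment> \<open>\<open>K\<close> is dominated by the target density and both integrate to
      1.\<close>
    have "AE y in \<nu>. K y = e 0 y"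
    proof -
      have S: "space \<nu> \<in> sets (N \<Otimes>\<^sub>M borel)" using sets_\<nu> by (metis sets.top)
      have inS: "x \<in> space Q \<Longrightarrow> HZ n x \<in> space \<nu>" for x n
        by (rule HZ_space)
      have "(\<integral>\<^sup>+y. K y \<partial>\<nu>) = (\<Sum>n. \<integral>\<^sup>+x. c n x * indicator (space \<nu>) (HZ n x) \<partial>Q)"
        unfolding CK[OF S] by (intro nn_integral_cong) (auto simp: indicator_def)
      also have "\<dots> = (\<Sum>n. \<integral>\<^sup>+x. c n x \<partial>Q)"
        by (intro suminf_cong nn_integral_cong) (auto simp: inS indicator_def)
      also have "\<dots> = (\<integral>\<^sup>+x. C x \<partial>Q)" unfolding C_def by (subst nn_integral_suminf) auto
      also have "\<dots> = (\<integral>\<^sup>+x. 1 \<partial>Q)" using C_eq1 by (intro nn_integral_cong_AE)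
      finally have K1: "(\<integral>\<^sup>+y. K y \<partial>\<nu>) = 1" by (simp add: Q.emeasure_space_1)
      have "(\<integral>\<^sup>+y. e 0 y \<partial>\<nu>) = emeasure \<tau> (space \<nu>)"
        unfolding \<tau>_em[OF S] by (intro nn_integral_cong) (auto simp: indicator_def)
      also have "\<dots> = emeasure (distr \<tau> N fst) (space N)"
      proof (subst emeasure_distr)
        show "fst \<in> measurable \<tau> N" using \<tau>(1) by (simp cong: measurable_cong_sets)
        have "space \<tau> = space \<nu>" using sets_eq_imp_space_eq[of \<tau> \<nu>] \<tau>(1) by simp
        moreover have "fst -` space N \<inter> space \<nu> = space \<nu>"
          using sets_eq_imp_space_eq[OF sets_\<nu>] by (auto simp: space_pair_measure)
        ultimately show "emeasure \<tau> (space \<nu>) = emeasure \<tau> (fst -` space N \<inter> space \<tau>)" by simp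
      qed simp
      also have "\<dots> = 1" unfolding \<tau>(2) using D.emeasure_space_1 by simp
      finally have E1: "(\<integral>\<^sup>+y. e 0 y \<partial>\<nu>) = 1" .
      have "(\<integral>\<^sup>+y. e 0 y - K y \<partial>\<nu>) = 0"
        by (subst nn_integral_diff) (auto simp: K1 E1 Ke)
      then have "AE y in \<nu>. e 0 y - K y = 0"
        by (subst (asm) nn_integral_0_iff_AE) auto
      then show ?thesis
      proof eventually_elim
        case (elim y)
        then have "e 0 y \<le> K y"
          using Ke[of y] by (cases "e 0 y = \<top>") (auto simp: diff_eq_0_iff_ennreal ennreal_top_minus less_top split: if_splits)
        with Ke[of y] show ?case by simp
      qed
    qed
    then have "(\<integral>\<^sup>+y. K y * indicator A y \<partial>\<nu>) = (\<integral>\<^sup>+y. e 0 y * indicator A y \<partial>\<nu>)"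
      by (intro nn_integral_cong_AE) (auto elim!: eventually_mono)
    then show ?thesis using CK[OF A] \<tau>_em[OF A] by simp
  qed
  moreover have "c n x = 0" if "\<not> V n x" for n x using that by (simp add: c_def)
  ultimately show thesis
    using that[of c] mc C_eq1 by (simp add: C_def HZ_def)
qed

text \<open>The weights are realised by one independent uniform variable. They vanish at invalid
  indices, so the outcome is almost surely a valid candidate.\<close>

lemma selection:
  fixes Q :: "'a measure" and N :: "'h measure" and H :: "'a \<Rightarrow> 'h"
    and Z :: "nat \<Rightarrow> 'a \<Rightarrow> real" and V :: "nat \<Rightarrow> 'a \<Rightarrow> bool"
  assumes Q: "prob_space Q"
    and H[measurable]: "H \<in> measurable Q N"
    and Z[measurable]: "\<And>n. Z n \<in> borel_measurable Q"
    and V[measurable]: "\<And>n. Measurable.pred Q (V n)"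
    and null: "\<And>A. A \<in> sets (N \<Otimes>\<^sub>M borel) \<Longrightarrow>
       AE x in Q. emeasure lborel (Pair (H x) -` A) = 0 \<longrightarrow> (\<forall>n. V n x \<longrightarrow> (H x, Z n x) \<notin> A)"
    and nonnull: "\<And>A. A \<in> sets (N \<Otimes>\<^sub>M borel) \<Longrightarrow>
       AE x in Q. emeasure lborel (Pair (H x) -` A) \<noteq> 0 \<longrightarrow> (\<exists>n. V n x \<and> (H x, Z n x) \<in> A)"
    and \<tau>: "sets \<tau> = sets (N \<Otimes>\<^sub>M borel)" "distr \<tau> N fst = distr Q N H"
    and ac: "absolutely_continuous (distr Q N H \<Otimes>\<^sub>M lborel) \<tau>"
  obtains \<psi> :: "'a \<times> real \<Rightarrow> real" where
    "\<psi> \<in> borel_measurable (Q \<Otimes>\<^sub>M U01)"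
    "distr (Q \<Otimes>\<^sub>M U01) (N \<Otimes>\<^sub>M borel) (\<lambda>z. (H (fst z), \<psi> z)) = \<tau>"
    "AE z in Q \<Otimes>\<^sub>M U01. \<exists>n. V n (fst z) \<and> \<psi> z = Z n (fst z)"
proof -
  obtain c :: "nat \<Rightarrow> 'a \<Rightarrow> ennreal" where c[measurable]: "\<And>n. c n \<in> borel_measurable Q"
    and sum1: "AE x in Q. (\<Sum>n. c n x) = 1" and c0: "\<And>n x. \<not> V n x \<Longrightarrow> c n x = 0"
    and c\<tau>: "\<And>A. A \<in> sets (N \<Otimes>\<^sub>M borel) \<Longrightarrow>
       (\<Sum>n. \<integral>\<^sup>+x. c n x * indicator A (H x, Z n x) \<partial>Q) = emeasure \<tau> A"
    by (rule selection_weights[OF assms]) blast+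
  obtain J where J[measurable]: "J \<in> measurable (Q \<Otimes>\<^sub>M U01) (count_space UNIV)"
    and int: "\<And>G. (\<And>n. G n \<in> borel_measurable Q) \<Longrightarrow>
       (\<integral>\<^sup>+z. G (J z) (fst z) \<partial>(Q \<Otimes>\<^sub>M U01)) = (\<Sum>n. \<integral>\<^sup>+x. c n x * G n x \<partial>Q)"
    by (rule random_choice[OF Q c sum1]) blast
  define \<psi> where "\<psi> z = Z (J z) (fst z)" for z
  have m[measurable]: "\<psi> \<in> borel_measurable (Q \<Otimes>\<^sub>M U01)"
    unfolding \<psi>_def by (rule measurable_compose_countable[OF _ J]) measurable
  have "distr (Q \<Otimes>\<^sub>M U01) (N \<Otimes>\<^sub>M borel) (\<lambda>z. (H (fst z), \<psi> z)) = \<tau>"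
  proof (rule measure_eqI)
    fix A assume "A \<in> sets (distr (Q \<Otimes>\<^sub>M U01) (N \<Otimes>\<^sub>M borel) (\<lambda>z. (H (fst z), \<psi> z)))"
    then have A[measurable]: "A \<in> sets (N \<Otimes>\<^sub>M borel)" by simp
    have "emeasure (distr (Q \<Otimes>\<^sub>M U01) (N \<Otimes>\<^sub>M borel) (\<lambda>z. (H (fst z), \<psi> z))) A
      = (\<integral>\<^sup>+z. (\<lambda>n x. indicator A (H x, Z n x)) (J z) (fst z) \<partial>(Q \<Otimes>\<^sub>M U01))"
      by (subst nn_integral_indicator[symmetric], simp, subst nn_integral_distr) (auto simp: \<psi>_def)
    also have "\<dots> = emeasure \<tau> A"
      by (subst int) (auto simp: c\<tau>)
    finally show "emeasure (distr (Q \<Otimes>\<^sub>M U01) (N \<Otimes>\<^sub>M borel) (\<lambda>z. (H (fst z), \<psi> z))) A = emeasure \<tau> A" .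
  qed (simp add: \<tau>)
  moreover have "AE z in Q \<Otimes>\<^sub>M U01. \<exists>n. V n (fst z) \<and> \<psi> z = Z n (fst z)"
  proof -
    have "(\<integral>\<^sup>+z. (\<lambda>n x. indicator {x. \<not> V n x} x) (J z) (fst z) \<partial>(Q \<Otimes>\<^sub>M U01))
      = (\<Sum>n. \<integral>\<^sup>+x. c n x * indicator {x. \<not> V n x} x \<partial>Q)"
      by (rule int) simp
    also have "\<dots> = (\<Sum>n. \<integral>\<^sup>+x. 0 \<partial>Q)"
      by (intro suminf_cong nn_integral_cong) (auto simp: indicator_def c0)
    finally have "(\<integral>\<^sup>+z. indicator {x. \<not> V (J z) x} (fst z) \<partial>(Q \<Otimes>\<^sub>M U01)) = 0" by simp
    moreover have "(\<lambda>z. indicator {x. \<not> V (J z) x} (fst z) :: ennreal) \<in> borel_measurable (Q \<Otimes>\<^sub>M U01)"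
      by (rule measurable_compose_countable[OF _ J]) measurable
    ultimately have "AE z in Q \<Otimes>\<^sub>M U01. (indicator {x. \<not> V (J z) x} (fst z) :: ennreal) = 0"
      by (subst (asm) nn_integral_0_iff_AE) auto
    then show ?thesis by eventually_elim (auto simp: \<psi>_def indicator_def split: if_splits)
  qed
  ultimately show thesis using that[OF m] by blast
qed

text \<open>The conditional law of the second component is carried by the countably many values
  \<open>\<phi> n\<close>, so it is given by Radon-Nikodym densities alone.\<close>

lemma discrete_transfer:
  fixes \<mu> :: "('k \<times> 'c) measure" and \<phi> :: "nat \<Rightarrow> 'k \<Rightarrow> 'c"
  assumes \<mu>: "prob_space \<mu>" "sets \<mu> = sets (N \<Otimes>\<^sub>M C)"
    and \<phi>[measurable]: "\<And>n. \<phi> n \<in> measurable N C"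
    and diag[measurable]: "\<And>n. Measurable.pred (N \<Otimes>\<^sub>M C) (\<lambda>z. snd z = \<phi> n (fst z))"
    and ex: "AE z in \<mu>. \<exists>n. snd z = \<phi> n (fst z)"
  obtains \<psi> where "\<psi> \<in> measurable (N \<Otimes>\<^sub>M borel) C"
    "distr (distr \<mu> N fst \<Otimes>\<^sub>M U01) (N \<Otimes>\<^sub>M C) (\<lambda>z. (fst z, \<psi> z)) = \<mu>"
proof -
  interpret \<mu>: prob_space \<mu> by fact
  note \<mu>(2)[measurable_cong]
  define K where "K = distr \<mu> N fst"
  interpret K: prob_space K unfolding K_def by (rule \<mu>.prob_space_distr) simp
  have sK[simp, measurable_cong]: "sets K = sets N" by (simp add: K_def)
  \<comment> \<open>Taking the least index keeps the events \<open>\<nu> = n\<close> disjoint even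
    where several \<open>\<phi> n\<close> coincide.\<close>
  define \<nu> where "\<nu> z = (LEAST n. snd z = \<phi> n (fst z))" for z
  have \<nu>[measurable]: "\<nu> \<in> measurable \<mu> (count_space UNIV)" unfolding \<nu>_def by measurable
  define \<eta> where "\<eta> n = distr (density \<mu> (indicator {z. \<nu> z = n})) N fst" for n
  have [measurable]: "{z \<in> space \<mu>. \<nu> z = n} \<in> sets \<mu>" for n by measurable
  have \<eta>_int: "(\<integral>\<^sup>+x. f x \<partial>\<eta> n) = (\<integral>\<^sup>+z. indicator {z. \<nu> z = n} z * f (fst z) \<partial>\<mu>)"
    if [measurable]: "f \<in> borel_measurable N" for f n
    unfolding \<eta>_def by (subst nn_integral_distr, simp, simp, subst nn_integral_density) auto
  have K_int: "(\<integral>\<^sup>+x. f x \<partial>K) = (\<integral>\<^sup>+z. f (fst z) \<partial>\<mu>)"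
    if [measurable]: "f \<in> borel_measurable N" for f
    unfolding K_def by (subst nn_integral_distr) auto
  \<comment> \<open>The conditional probability of \<open>\<nu> = n\<close> given the first
    component, obtained as a density with respect to the first marginal.\<close>
  define c where "c n = RN_deriv K (\<eta> n)" for n
  have mc[measurable]: "c n \<in> borel_measurable N" for n
    using borel_measurable_RN_deriv[of K "\<eta> n"] by (simp add: c_def cong: measurable_cong_sets)
  have c_dens: "density K (c n) = \<eta> n" for n
    unfolding c_def
  proof (rule K.density_RN_deriv)
    show "absolutely_continuous K (\<eta> n)"
      unfolding absolutely_continuous_def
    proof
      fix A assume A: "A \<in> null_sets K"
      then have [measurable]: "A \<in> sets N" by auto
      have "emeasure (\<eta> n) A = (\<integral>\<^sup>+x. indicator A x \<partial>\<eta> n)" by (simp add: \<eta>_def)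
      also have "\<dots> \<le> (\<integral>\<^sup>+z. indicator A (fst z) \<partial>\<mu>)"
        by (subst \<eta>_int) (auto intro!: nn_integral_mono simp: indicator_def)
      also have "\<dots> = emeasure K A" by (subst K_int[symmetric]) auto
      finally have "emeasure (\<eta> n) A = 0" using A by (simp add: null_setsD1)
      then show "A \<in> null_sets (\<eta> n)" by (rule null_setsI) (simp add: \<eta>_def)
    qed
  qed (simp add: \<eta>_def)
  have c_int: "(\<integral>\<^sup>+x. c n x * f x \<partial>K) = (\<integral>\<^sup>+z. indicator {z. \<nu> z = n} z * f (fst z) \<partial>\<mu>)"
    if [measurable]: "f \<in> borel_measurable N" for f n
    by (subst \<eta>_int[symmetric], simp, subst c_dens[symmetric], subst nn_integral_density) auto
  have sum_ind: "(\<Sum>n. indicator {z. \<nu> z = n} z * F n z) = F (\<nu> z) z" for z and F :: "nat \<Rightarrow> _ \<Rightarrow> ennreal"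
  proof -
    have "(\<Sum>n. indicator {z. \<nu> z = n} z * F n z) = (\<Sum>n\<in>{\<nu> z}. indicator {z. \<nu> z = n} z * F n z)"
      by (rule suminf_finite) (auto simp: indicator_def)
    then show ?thesis by simp
  qed
  have csum: "AE x in K. (\<Sum>n. c n x) = 1"
  proof -
    have "density K (\<lambda>x. \<Sum>n. c n x) = density K (\<lambda>_. 1)"
    proof (rule measure_eqI)
      fix A assume "A \<in> sets (density K (\<lambda>x. \<Sum>n. c n x))"
      then have [measurable]: "A \<in> sets N" by simp
      have "emeasure (density K (\<lambda>x. \<Sum>n. c n x)) A = (\<integral>\<^sup>+x. (\<Sum>n. c n x * indicator A x) \<partial>K)"
        by (subst emeasure_density) (auto simp: ennreal_suminf_multc)
      also have "\<dots> = (\<Sum>n. \<integral>\<^sup>+z. indicator {z. \<nu> z = n} z * indicator A (fst z) \<partial>\<mu>)"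
        by (subst nn_integral_suminf) (auto simp: c_int)
      also have "\<dots> = (\<integral>\<^sup>+z. indicator A (fst z) \<partial>\<mu>)"
        by (subst nn_integral_suminf[symmetric]) (auto simp: sum_ind[of _ "\<lambda>_ z. indicator A (fst z)"] simp del: ennreal_suminf_multc)
      also have "\<dots> = emeasure (density K (\<lambda>_. 1)) A"
        by (subst K_int[symmetric]) (auto simp: emeasure_density)
      finally show "emeasure (density K (\<lambda>x. \<Sum>n. c n x)) A = emeasure (density K (\<lambda>_. 1)) A" .
    qed simp
    then show ?thesis by (subst (asm) K.density_unique_iff) auto
  qed
  have mcK: "c n \<in> borel_measurable K" for n by simp
  obtain J where J[measurable]: "J \<in> measurable (K \<Otimes>\<^sub>M U01) (count_space UNIV)"
    and int: "\<And>G. (\<And>n. G n \<in> borel_measurable K) \<Longrightarrow>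
       (\<integral>\<^sup>+z. G (J z) (fst z) \<partial>(K \<Otimes>\<^sub>M U01)) = (\<Sum>n. \<integral>\<^sup>+x. c n x * G n x \<partial>K)"
    by (rule random_choice[OF K.prob_space_axioms mcK csum]) blast
  define \<psi> where "\<psi> z = \<phi> (J z) (fst z)" for z
  have m: "\<psi> \<in> measurable (K \<Otimes>\<^sub>M U01) C"
    unfolding \<psi>_def by (rule measurable_compose_countable[OF _ J]) measurable
  have sKU: "sets (K \<Otimes>\<^sub>M U01) = sets (N \<Otimes>\<^sub>M borel)" by (intro sets_pair_measure_cong) auto
  have "distr (K \<Otimes>\<^sub>M U01) (N \<Otimes>\<^sub>M C) (\<lambda>z. (fst z, \<psi> z)) = \<mu>"
  proof (rule measure_eqI)
    fix A assume "A \<in> sets (distr (K \<Otimes>\<^sub>M U01) (N \<Otimes>\<^sub>M C) (\<lambda>z. (fst z, \<psi> z)))"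
    then have A[measurable]: "A \<in> sets (N \<Otimes>\<^sub>M C)" by simp
    note m[measurable]
    have "emeasure (distr (K \<Otimes>\<^sub>M U01) (N \<Otimes>\<^sub>M C) (\<lambda>z. (fst z, \<psi> z))) A
      = (\<integral>\<^sup>+z. (\<lambda>n x. indicator A (x, \<phi> n x)) (J z) (fst z) \<partial>(K \<Otimes>\<^sub>M U01))"
      by (subst nn_integral_indicator[symmetric], simp, subst nn_integral_distr) (auto simp: \<psi>_def)
    also have "\<dots> = (\<Sum>n. \<integral>\<^sup>+z. indicator {z. \<nu> z = n} z * indicator A (fst z, \<phi> n (fst z)) \<partial>\<mu>)"
      by (subst int) (auto simp: c_int)
    also have "\<dots> = (\<integral>\<^sup>+z. indicator A (fst z, \<phi> (\<nu> z) (fst z)) \<partial>\<mu>)"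
      by (subst nn_integral_suminf[symmetric]) (auto simp: sum_ind[of _ "\<lambda>n z. indicator A (fst z, \<phi> n (fst z))"])
    also have "\<dots> = (\<integral>\<^sup>+z. indicator A z \<partial>\<mu>)"
    proof (rule nn_integral_cong_AE)
      show "AE z in \<mu>. indicator A (fst z, \<phi> (\<nu> z) (fst z)) = (indicator A z :: ennreal)"
        using ex
      proof eventually_elim
        case (elim z)
        from LeastI_ex[OF elim] show ?case unfolding \<nu>_def by (metis prod.collapse)
      qed
    qed
    also have "\<dots> = emeasure \<mu> A" using A \<mu>(2) by simp
    finally show "emeasure (distr (K \<Otimes>\<^sub>M U01) (N \<Otimes>\<^sub>M C) (\<lambda>z. (fst z, \<psi> z))) A = emeasure \<mu> A" .
  qed (simp add: \<mu>)
  with m that show thesis unfolding K_def[symmetric] measurable_cong_sets[OF sKU refl] by blast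
qed

section \<open>Back and forth\<close>

abbreviation "seqM \<equiv> PiM (UNIV :: nat set) (\<lambda>_. borel :: real measure)"

abbreviation "noise \<equiv> PiM (UNIV :: nat set) (\<lambda>_. U01)"

lemma prob_space_noise: "prob_space noise"
  by (rule prob_space_PiM) (rule prob_space_U01)

lemma sets_noise[simp, measurable_cong]: "sets noise = sets seqM"
  by (rule sets_PiM_cong) simp_all

lemma space_noise[simp]: "space noise = UNIV"
  by (simp add: space_PiM)

lemma measurable_fun_upd_seq[measurable (raw)]:
  assumes f: "f \<in> measurable M seqM" and g: "g \<in> borel_measurable M"
  shows "(\<lambda>x. (f x)(k := g x)) \<in> measurable M seqM"
proof (rule measurable_PiM_single')
  fix i
  have [measurable]: "(\<lambda>x. f x i) \<in> borel_measurable M" using f by measurable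
  note g[measurable]
  show "(\<lambda>x. ((f x)(k := g x)) i) \<in> borel_measurable M" by (cases "i = k") simp_all
qed auto

text \<open>Cylinders suffice: after the update, the constraint at \<open>k\<close> concerns only
  the new draw and the remaining constraints only the old sequence. In this form the independence of
  one coordinate from the others is used both for the noise and for independent samples.\<close>

lemma distr_PiM_upd:
  fixes L :: "real measure" and k :: nat
  assumes L: "prob_space L" "sets L = sets borel"
  shows "distr (PiM UNIV (\<lambda>_. L) \<Otimes>\<^sub>M L) (PiM UNIV (\<lambda>_. L)) (\<lambda>(u, r). u(k := r)) = PiM UNIV (\<lambda>_. L)"
proof -
  interpret U: prob_space L by fact
  note L(2)[measurable_cong, simp]
  have [simp]: "space L = UNIV" using sets_eq_imp_space_eq[OF L(2)] by simp
  let ?noise = "PiM (UNIV :: nat set) (\<lambda>_. L)"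
  have sets_noise[measurable_cong]: "sets ?noise = sets seqM" by (rule sets_PiM_cong) simp_all
  have space_noise[simp]: "space ?noise = UNIV" by (simp add: space_PiM)
  interpret PP: product_prob_space "\<lambda>_::nat. L" UNIV ..
  interpret N: prob_space ?noise by (rule prob_space_PiM) (rule L)
  show ?thesis
  proof (rule PP.PiM_eq)
    fix J :: "nat set" and F :: "nat \<Rightarrow> real set"
    assume J: "finite J" and F: "\<And>j. j \<in> J \<Longrightarrow> F j \<in> sets L"
    \<comment> \<open>If \<open>k\<close> is unconstrained, the whole line stands in and contributes
      the factor 1.\<close>
    define Fk where "Fk = (if k \<in> J then F k else UNIV)"
    define E where "E = {u \<in> space ?noise. \<forall>j\<in>J - {k}. u j \<in> F j}"
    have [measurable]: "Fk \<in> sets borel" using F by (auto simp: Fk_def)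
    have emb: "prod_emb UNIV (\<lambda>_. L) J (\<Pi>\<^sub>E j\<in>J. F j) = {u. \<forall>j\<in>J. u j \<in> F j}"
      by (auto simp: prod_emb_def restrict_PiE_iff space_PiM)
    have S: "prod_emb UNIV (\<lambda>_. L) J (\<Pi>\<^sub>E j\<in>J. F j) \<in> sets ?noise"
      using J F by (intro sets_PiM_I) auto
    have E[measurable]: "E \<in> sets ?noise"
    proof -
      have Ej: "{u \<in> space ?noise. u j \<in> F j} \<in> sets ?noise" if "j \<in> J - {k}" for j
      proof -
        have [measurable]: "F j \<in> sets L" using F that by simp
        have [measurable]: "(\<lambda>u. u j) \<in> measurable ?noise L" by (rule measurable_component_singleton) simp
        show ?thesis by measurable
      qed
      show ?thesis unfolding E_def
        by (rule sets.sets_Collect_finite_All[OF Ej finite_Diff[OF J]])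
    qed
    have "emeasure (distr (?noise \<Otimes>\<^sub>M L) ?noise (\<lambda>(u, r). u(k := r))) (prod_emb UNIV (\<lambda>_. L) J (\<Pi>\<^sub>E j\<in>J. F j))
        = emeasure (?noise \<Otimes>\<^sub>M L) (E \<times> Fk)"
    proof (subst emeasure_distr[OF _ S])
      have "(\<lambda>(u, r). u(k := r)) -` {u. \<forall>j\<in>J. u j \<in> F j} = E \<times> Fk"
        by (auto simp: E_def Fk_def split: if_splits)
      then show "emeasure (?noise \<Otimes>\<^sub>M L) ((\<lambda>(u, r). u(k := r)) -` prod_emb UNIV (\<lambda>_. L) J (\<Pi>\<^sub>E j\<in>J. F j) \<inter> space (?noise \<Otimes>\<^sub>M L))
        = emeasure (?noise \<Otimes>\<^sub>M L) (E \<times> Fk)"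
        unfolding emb by (simp add: space_pair_measure)
    qed measurable
    also have "\<dots> = emeasure ?noise E * emeasure L Fk"
      by (rule U.emeasure_pair_measure_Times[OF E]) simp
    also have "emeasure ?noise E = (\<Prod>j\<in>J - {k}. emeasure L (F j))"
      unfolding E_def using J F by (intro PP.emeasure_PiM_Collect) auto
    also have "\<dots> * emeasure L Fk = (\<Prod>j\<in>J. emeasure L (F j))"
    proof (cases "k \<in> J")
      case True
      then show ?thesis using J by (simp add: Fk_def prod.remove[of J k] mult.commute)
    next
      case False
      then show ?thesis using U.emeasure_space_1 by (simp add: Fk_def)
    qed
    finally show "emeasure (distr (?noise \<Otimes>\<^sub>M L) ?noise (\<lambda>(u, r). u(k := r))) (prod_emb UNIV (\<lambda>_. L) J (\<Pi>\<^sub>E j\<in>J. F j))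
      = (\<Prod>j\<in>J. emeasure L (F j))" .
  qed simp
qed

lemma nn_integral_PiM_upd:
  fixes L :: "real measure" and k :: nat
  assumes L: "prob_space L" "sets L = sets borel" and f[measurable]: "f \<in> borel_measurable (PiM UNIV (\<lambda>_. L))"
  shows "(\<integral>\<^sup>+x. f x \<partial>PiM UNIV (\<lambda>_. L)) = (\<integral>\<^sup>+x. \<integral>\<^sup>+r. f (x(k := r)) \<partial>L \<partial>PiM UNIV (\<lambda>_. L))"
proof -
  interpret L: prob_space L by fact
  note L(2)[measurable_cong]
  have [measurable_cong]: "sets (PiM (UNIV :: nat set) (\<lambda>_. L)) = sets seqM" by (rule sets_PiM_cong) (simp_all add: L)
  have "(\<integral>\<^sup>+x. f x \<partial>PiM UNIV (\<lambda>_. L)) =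
      (\<integral>\<^sup>+x. f x \<partial>distr (PiM UNIV (\<lambda>_. L) \<Otimes>\<^sub>M L) (PiM UNIV (\<lambda>_. L)) (\<lambda>(u, r). u(k := r)))"
    by (simp only: distr_PiM_upd[OF L])
  also have "\<dots> = (\<integral>\<^sup>+z. f ((fst z)(k := snd z)) \<partial>(PiM UNIV (\<lambda>_. L) \<Otimes>\<^sub>M L))"
    by (subst nn_integral_distr) (auto simp: split_beta)
  also have "\<dots> = (\<integral>\<^sup>+x. \<integral>\<^sup>+r. f (x(k := r)) \<partial>L \<partial>PiM UNIV (\<lambda>_. L))"
    by (subst L.nn_integral_fst[symmetric]) auto
  finally show ?thesis .
qed

lemma nn_integral_noise_upd:
  assumes "prob_space P" and f[measurable]: "f \<in> borel_measurable (P \<Otimes>\<^sub>M noise)"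
  shows "(\<integral>\<^sup>+z. f z \<partial>(P \<Otimes>\<^sub>M noise)) = (\<integral>\<^sup>+z. \<integral>\<^sup>+r. f (fst z, (snd z)(k := r)) \<partial>U01 \<partial>(P \<Otimes>\<^sub>M noise))"
proof -
  interpret P: prob_space P by fact
  interpret U: prob_space U01 by (rule prob_space_U01)
  interpret N: prob_space noise by (rule prob_space_noise)
  have upd[measurable]: "(\<lambda>(u, r). u(k := r)) \<in> measurable (noise \<Otimes>\<^sub>M U01) noise" by measurable
  have "(\<integral>\<^sup>+z. f z \<partial>(P \<Otimes>\<^sub>M noise)) = (\<integral>\<^sup>+\<omega>. \<integral>\<^sup>+u. f (\<omega>, u) \<partial>noise \<partial>P)"
    by (rule N.nn_integral_fst[symmetric]) measurable
  also have "\<dots> = (\<integral>\<^sup>+\<omega>. \<integral>\<^sup>+u. \<integral>\<^sup>+r. f (\<omega>, u(k := r)) \<partial>U01 \<partial>noise \<partial>P)"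
  proof (rule nn_integral_cong)
    fix \<omega> assume \<omega>[measurable]: "\<omega> \<in> space P"
    have [measurable]: "(\<lambda>u. f (\<omega>, u)) \<in> borel_measurable noise" by measurable
    show "(\<integral>\<^sup>+u. f (\<omega>, u) \<partial>noise) = (\<integral>\<^sup>+u. \<integral>\<^sup>+r. f (\<omega>, u(k := r)) \<partial>U01 \<partial>noise)"
      by (rule nn_integral_PiM_upd[OF prob_space_U01 sets_U01]) measurable
  qed
  also have "\<dots> = (\<integral>\<^sup>+z. \<integral>\<^sup>+r. f (fst z, (snd z)(k := r)) \<partial>U01 \<partial>(P \<Otimes>\<^sub>M noise))"
    by (subst N.nn_integral_fst[symmetric]) (auto intro!: U.borel_measurable_nn_integral)
  finally show ?thesis .
qed

text \<open>Coordinate \<open>k\<close> can be integrated out first, since \<open>G\<close> does not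
  feel its being overwritten. Invariance under overwriting is a pointwise condition and therefore
  easy to maintain along a recursive construction.\<close>

lemma distr_fresh_coordinate:
  assumes "prob_space P" and G[measurable]: "G \<in> measurable (P \<Otimes>\<^sub>M noise) N"
    and inv: "\<And>\<omega> u r. G (\<omega>, u(k := r)) = G (\<omega>, u)"
  shows "distr (P \<Otimes>\<^sub>M noise) (N \<Otimes>\<^sub>M borel) (\<lambda>z. (G z, snd z k)) = distr (P \<Otimes>\<^sub>M noise) N G \<Otimes>\<^sub>M U01"
proof -
  interpret P: prob_space P by fact
  interpret U: prob_space U01 by (rule prob_space_U01)
  interpret Ns: prob_space noise by (rule prob_space_noise)
  interpret PN: pair_prob_space P noise ..
  interpret D: prob_space "distr (P \<Otimes>\<^sub>M noise) N G" by (rule PN.prob_space_distr) fact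
  show ?thesis
  proof (rule measure_eqI)
    have sts: "sets (distr (P \<Otimes>\<^sub>M noise) N G \<Otimes>\<^sub>M U01) = sets (N \<Otimes>\<^sub>M borel)"
      by (intro sets_pair_measure_cong) auto
    then show "sets (distr (P \<Otimes>\<^sub>M noise) (N \<Otimes>\<^sub>M borel) (\<lambda>z. (G z, snd z k))) = sets (distr (P \<Otimes>\<^sub>M noise) N G \<Otimes>\<^sub>M U01)"
      by simp
    fix A assume "A \<in> sets (distr (P \<Otimes>\<^sub>M noise) (N \<Otimes>\<^sub>M borel) (\<lambda>z. (G z, snd z k)))"
    then have A[measurable]: "A \<in> sets (N \<Otimes>\<^sub>M borel)" by simp
    have A': "A \<in> sets (distr (P \<Otimes>\<^sub>M noise) N G \<Otimes>\<^sub>M U01)" using A sts by simp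
    have "emeasure (distr (P \<Otimes>\<^sub>M noise) (N \<Otimes>\<^sub>M borel) (\<lambda>z. (G z, snd z k))) A
      = (\<integral>\<^sup>+z. indicator A (G z, snd z k) \<partial>(P \<Otimes>\<^sub>M noise))"
      by (subst nn_integral_indicator[symmetric], simp, subst nn_integral_distr) auto
    also have "\<dots> = (\<integral>\<^sup>+z. \<integral>\<^sup>+r. indicator A (G z, r) \<partial>U01 \<partial>(P \<Otimes>\<^sub>M noise))"
      by (subst nn_integral_noise_upd[OF assms(1), where k=k]) (auto simp: inv)
    also have "\<dots> = (\<integral>\<^sup>+z. emeasure U01 (Pair (G z) -` A) \<partial>(P \<Otimes>\<^sub>M noise))"
    proof (rule nn_integral_cong)
      fix z
      have "(\<integral>\<^sup>+r. indicator A (G z, r) \<partial>U01) = (\<integral>\<^sup>+r. indicator (Pair (G z) -` A) r \<partial>U01)"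
        by (intro nn_integral_cong) (auto simp: indicator_def)
      also have "\<dots> = emeasure U01 (Pair (G z) -` A)"
        by (rule nn_integral_indicator) (use sets_Pair1[OF A] in simp)
      finally show "(\<integral>\<^sup>+r. indicator A (G z, r) \<partial>U01) = emeasure U01 (Pair (G z) -` A)" .
    qed
    also have "\<dots> = emeasure (distr (P \<Otimes>\<^sub>M noise) N G \<Otimes>\<^sub>M U01) A"
      by (subst U.emeasure_pair_measure_alt[OF A'], subst nn_integral_distr)
         (auto intro!: U.measurable_emeasure_Pair simp: A cong: measurable_cong_sets)
    finally show "emeasure (distr (P \<Otimes>\<^sub>M noise) (N \<Otimes>\<^sub>M borel) (\<lambda>z. (G z, snd z k))) A
      = emeasure (distr (P \<Otimes>\<^sub>M noise) N G \<Otimes>\<^sub>M U01) A" .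
  qed
qed

section \<open>Histories and their extension by one value\<close>

definition hist :: "nat \<Rightarrow> (nat \<Rightarrow> 'a \<Rightarrow> real) \<Rightarrow> 'a \<Rightarrow> nat \<Rightarrow> real" where
  "hist k X z = (\<lambda>n. if n < k then X n z else 0)"

lemma measurable_hist:
  assumes "\<And>n. n < k \<Longrightarrow> X n \<in> borel_measurable M"
  shows "hist k X \<in> measurable M seqM"
  unfolding hist_def
proof (rule measurable_PiM_single')
  fix i show "(\<lambda>x. if i < k then X i x else 0) \<in> borel_measurable M"
    using assms by (cases "i < k") auto
qed auto

lemma hist_image: "hist k X z ` {..<k} = (\<lambda>n. X n z) ` {..<k}"
  by (auto simp: hist_def image_iff)

text \<open>
  In the following definition \<open>h\<close> is a history of \<open>k\<close> values, padded with zeros so that all histories live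
  in \<open>seqM\<close>; the set depending on the history is the fibre of \<open>A\<close> over \<open>h\<close>.
\<close>

definition sample_like :: "'a measure \<Rightarrow> (nat \<Rightarrow> 'a \<Rightarrow> real) \<Rightarrow> bool" where
  "sample_like P T \<longleftrightarrow> (\<forall>i. T i \<in> borel_measurable P) \<and>
    (\<forall>k. \<forall>A\<in>sets (seqM \<Otimes>\<^sub>M borel). AE \<omega> in P. \<forall>h.
       (\<forall>n<k. h n \<in> range (\<lambda>i. T i \<omega>)) \<and> (\<forall>n\<ge>k. h n = 0) \<longrightarrow>
       (emeasure lborel (Pair h -` A) = 0 \<longrightarrow> (\<forall>j. T j \<omega> \<notin> h ` {..<k} \<longrightarrow> (h, T j \<omega>) \<notin> A)) \<and>
       (emeasure lborel (Pair h -` A) \<noteq> 0 \<longrightarrow> (\<exists>j. T j \<omega> \<notin> h ` {..<k} \<and> (h, T j \<omega>) \<in> A)))"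

text \<open>The last clause keeps the noise coordinates from \<open>k\<close> on fresh for later steps.\<close>

definition partial_enum :: "'a measure \<Rightarrow> (nat \<Rightarrow> 'a \<Rightarrow> real) \<Rightarrow> nat \<Rightarrow> (nat \<Rightarrow> 'a \<times> (nat \<Rightarrow> real) \<Rightarrow> real) \<Rightarrow> bool" where
  "partial_enum P T k X \<longleftrightarrow> (\<forall>n<k. X n \<in> borel_measurable (P \<Otimes>\<^sub>M noise) \<and>
     (AE z in P \<Otimes>\<^sub>M noise. X n z \<in> range (\<lambda>i. T i (fst z))) \<and>
     (\<forall>m\<ge>k. \<forall>\<omega> u r. X n (\<omega>, u(m := r)) = X n (\<omega>, u)))"

text \<open>The quantifier over histories stands inside the almost sure statement of
  \<open>sample_like\<close>, so a history that depends on the noise may be substituted point by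
  point.\<close>

lemma sample_like_hist:
  assumes P: "prob_space P" and T: "sample_like P T" and X: "partial_enum P T k X" and A: "A \<in> sets (seqM \<Otimes>\<^sub>M borel)"
  shows "AE z in P \<Otimes>\<^sub>M noise.
     (emeasure lborel (Pair (hist k X z) -` A) = 0 \<longrightarrow> (\<forall>j. T j (fst z) \<notin> hist k X z ` {..<k} \<longrightarrow> (hist k X z, T j (fst z)) \<notin> A)) \<and>
     (emeasure lborel (Pair (hist k X z) -` A) \<noteq> 0 \<longrightarrow> (\<exists>j. T j (fst z) \<notin> hist k X z ` {..<k} \<and> (hist k X z, T j (fst z)) \<in> A))"
proof -
  interpret P: prob_space P by fact
  interpret N: prob_space noise by (rule prob_space_noise)
  interpret PN: pair_prob_space P noise ..
  have "AE \<omega> in P. \<forall>h. (\<forall>n<k. h n \<in> range (\<lambda>i. T i \<omega>)) \<and> (\<forall>n\<ge>k. h n = 0) \<longrightarrow>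
       (emeasure lborel (Pair h -` A) = 0 \<longrightarrow> (\<forall>j. T j \<omega> \<notin> h ` {..<k} \<longrightarrow> (h, T j \<omega>) \<notin> A)) \<and>
       (emeasure lborel (Pair h -` A) \<noteq> 0 \<longrightarrow> (\<exists>j. T j \<omega> \<notin> h ` {..<k} \<and> (h, T j \<omega>) \<in> A))"
    (is "AE \<omega> in P. ?\<Phi> \<omega>") using T A unfolding sample_like_def by blast
  then have "AE \<omega> in distr (P \<Otimes>\<^sub>M noise) P fst. ?\<Phi> \<omega>"
    unfolding N.distr_pair_fst .
  then have "AE z in P \<Otimes>\<^sub>M noise. ?\<Phi> (fst z)"
    by (rule AE_distrD[rotated]) simp
  moreover have "AE z in P \<Otimes>\<^sub>M noise. \<forall>n<k. X n z \<in> range (\<lambda>i. T i (fst z))"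
    using X unfolding partial_enum_def by (subst AE_all_countable) auto
  ultimately show ?thesis
    by eventually_elim (erule allE[of _ "hist k X _"], auto simp: hist_def)
qed

text \<open>The selection only needs the joint law \<open>Q\<close> of the history and the whole
  sequence, and is carried out on that law. Coordinate \<open>k\<close> of the noise, on which
  neither component depends, supplies its uniform variable.\<close>

lemma match_next:
  assumes P: "prob_space P" and T: "sample_like P T" and X: "partial_enum P T k X"
    and \<tau>: "sets \<tau> = sets (seqM \<Otimes>\<^sub>M borel)" "distr \<tau> seqM fst = distr (P \<Otimes>\<^sub>M noise) seqM (hist k X)"
      "absolutely_continuous (distr (P \<Otimes>\<^sub>M noise) seqM (hist k X) \<Otimes>\<^sub>M lborel) \<tau>"
  obtains Y where "partial_enum P T (Suc k) (X(k := Y))"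
    "distr (P \<Otimes>\<^sub>M noise) (seqM \<Otimes>\<^sub>M borel) (\<lambda>z. (hist k X z, Y z)) = \<tau>"
proof -
  interpret P: prob_space P by fact
  interpret N: prob_space noise by (rule prob_space_noise)
  interpret U: prob_space U01 by (rule prob_space_U01)
  interpret PN: pair_prob_space P noise ..
  have mX[measurable]: "\<And>n. n < k \<Longrightarrow> X n \<in> borel_measurable (P \<Otimes>\<^sub>M noise)" using X by (auto simp: partial_enum_def)
  have mT[measurable]: "\<And>n. T n \<in> borel_measurable P" using T by (auto simp: sample_like_def)
  have mh[measurable]: "hist k X \<in> measurable (P \<Otimes>\<^sub>M noise) seqM" by (rule measurable_hist) (rule mX)
  define G where "G z = (hist k X z, \<lambda>i. T i (fst z))" for z :: "'a \<times> (nat \<Rightarrow> real)"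
  have mG[measurable]: "G \<in> measurable (P \<Otimes>\<^sub>M noise) (seqM \<Otimes>\<^sub>M seqM)"
    unfolding G_def by (intro measurable_Pair mh measurable_PiM_single') auto
  have fstG: "fst (G z) = hist k X z" for z by (simp add: G_def)
  define Q where "Q = distr (P \<Otimes>\<^sub>M noise) (seqM \<Otimes>\<^sub>M seqM) G"
  have Q: "prob_space Q" unfolding Q_def by (rule PN.prob_space_distr) fact
  have sQ[simp, measurable_cong]: "sets Q = sets (seqM \<Otimes>\<^sub>M seqM)" by (simp add: Q_def)
  define V where "V n x \<longleftrightarrow> snd x n \<notin> fst x ` {..<k}" for n and x :: "(nat \<Rightarrow> real) \<times> (nat \<Rightarrow> real)"
  have V[measurable]: "Measurable.pred Q (V n)" for n
  proof -
    have "V n = (\<lambda>x. \<forall>i<k. snd x n \<noteq> fst x i)" by (auto simp: V_def fun_eq_iff)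
    moreover have [measurable]: "(\<lambda>x. snd x n) \<in> borel_measurable Q" "(\<lambda>x. fst x n) \<in> borel_measurable Q" for n
      by measurable
    have "Measurable.pred Q (\<lambda>x. \<forall>i<k. snd x n \<noteq> fst x i)"
      by measurable
    ultimately show ?thesis by simp
  qed
  have fstQ: "distr Q seqM fst = distr (P \<Otimes>\<^sub>M noise) seqM (hist k X)"
    unfolding Q_def by (subst distr_distr) (auto simp: G_def comp_def)
  have AEQ: "AE x in Q. (emeasure lborel (Pair (fst x) -` A) = 0 \<longrightarrow> (\<forall>n. V n x \<longrightarrow> (fst x, snd x n) \<notin> A)) \<and>
      (emeasure lborel (Pair (fst x) -` A) \<noteq> 0 \<longrightarrow> (\<exists>n. V n x \<and> (fst x, snd x n) \<in> A))"
    if A[measurable]: "A \<in> sets (seqM \<Otimes>\<^sub>M borel)" for A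
  proof -
    have [measurable]: "(\<lambda>y. emeasure lborel (Pair y -` A)) \<in> borel_measurable seqM"
      by (rule lborel.measurable_emeasure_Pair) simp
    note V[unfolded pred_def sQ sets_eq_imp_space_eq[OF sQ], folded pred_def, measurable]
    show ?thesis unfolding Q_def
    proof (subst AE_distr_iff)
      show "AE z in P \<Otimes>\<^sub>M noise. (emeasure lborel (Pair (fst (G z)) -` A) = 0 \<longrightarrow> (\<forall>n. V n (G z) \<longrightarrow> (fst (G z), snd (G z) n) \<notin> A)) \<and>
      (emeasure lborel (Pair (fst (G z)) -` A) \<noteq> 0 \<longrightarrow> (\<exists>n. V n (G z) \<and> (fst (G z), snd (G z) n) \<in> A))"
        using sample_like_hist[OF P T X A] by (simp add: G_def V_def)
    qed measurable
  qed
  obtain \<psi> where \<psi>: "\<psi> \<in> borel_measurable (Q \<Otimes>\<^sub>M U01)"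
    and law: "distr (Q \<Otimes>\<^sub>M U01) (seqM \<Otimes>\<^sub>M borel) (\<lambda>z. (fst (fst z), \<psi> z)) = \<tau>"
    and AE\<psi>: "AE z in Q \<Otimes>\<^sub>M U01. \<exists>n. V n (fst z) \<and> \<psi> z = snd (fst z) n"
  proof (rule selection[OF Q, where N=seqM and H=fst and Z="\<lambda>n x. snd x n" and V=V and \<tau>=\<tau>])
    fix A :: "((nat \<Rightarrow> real) \<times> real) set" assume A: "A \<in> sets (seqM \<Otimes>\<^sub>M borel)"
    show "AE x in Q. emeasure lborel (Pair (fst x) -` A) = 0 \<longrightarrow> (\<forall>n. V n x \<longrightarrow> (fst x, snd x n) \<notin> A)"
      "AE x in Q. emeasure lborel (Pair (fst x) -` A) \<noteq> 0 \<longrightarrow> (\<exists>n. V n x \<and> (fst x, snd x n) \<in> A)"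
      using AEQ[OF A] by (auto elim!: eventually_mono)
  next
    show "absolutely_continuous (distr Q seqM fst \<Otimes>\<^sub>M lborel) \<tau>" using \<tau> fstQ by simp
  qed (use \<tau> fstQ V in \<open>auto\<close>)
  have sQU: "sets (Q \<Otimes>\<^sub>M U01) = sets ((seqM \<Otimes>\<^sub>M seqM) \<Otimes>\<^sub>M borel)" by (intro sets_pair_measure_cong) auto
  have m\<psi>[measurable]: "\<psi> \<in> borel_measurable ((seqM \<Otimes>\<^sub>M seqM) \<Otimes>\<^sub>M borel)"
    using \<psi> unfolding measurable_cong_sets[OF sQU refl] .
  have ins: "X n (\<omega>, u(m := r)) = X n (\<omega>, u)" if "n < k" "m \<ge> k" for n m \<omega> u r
    using X that by (auto simp: partial_enum_def)
  have insG: "G (\<omega>, u(m := r)) = G (\<omega>, u)" if "m \<ge> k" for m \<omega> u r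
    using ins[OF _ that] by (auto simp: G_def hist_def fun_eq_iff)
  have fresh: "distr (P \<Otimes>\<^sub>M noise) ((seqM \<Otimes>\<^sub>M seqM) \<Otimes>\<^sub>M borel) (\<lambda>z. (G z, snd z k)) = Q \<Otimes>\<^sub>M U01"
    unfolding Q_def by (rule distr_fresh_coordinate[OF P mG]) (simp add: insG)
  define Y where "Y z = \<psi> (G z, snd z k)" for z
  have mGk[measurable]: "(\<lambda>z. (G z, snd z k)) \<in> measurable (P \<Otimes>\<^sub>M noise) ((seqM \<Otimes>\<^sub>M seqM) \<Otimes>\<^sub>M borel)" by measurable
  have mY[measurable]: "Y \<in> borel_measurable (P \<Otimes>\<^sub>M noise)" unfolding Y_def by measurable
  have "distr (P \<Otimes>\<^sub>M noise) (seqM \<Otimes>\<^sub>M borel) (\<lambda>z. (hist k X z, Y z)) = \<tau>"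
  proof -
    have comp: "(\<lambda>z. (fst (fst z), \<psi> z)) \<circ> (\<lambda>z. (G z, snd z k)) = (\<lambda>z. (hist k X z, Y z))"
      by (simp add: comp_def fstG Y_def)
    have "distr (distr (P \<Otimes>\<^sub>M noise) ((seqM \<Otimes>\<^sub>M seqM) \<Otimes>\<^sub>M borel) (\<lambda>z. (G z, snd z k)))
       (seqM \<Otimes>\<^sub>M borel) (\<lambda>z. (fst (fst z), \<psi> z)) =
       distr (P \<Otimes>\<^sub>M noise) (seqM \<Otimes>\<^sub>M borel) (\<lambda>z. (hist k X z, Y z))"
      unfolding comp[symmetric]
      by (rule distr_distr[OF measurable_Pair[OF measurable_compose[OF measurable_fst measurable_fst] m\<psi>] mGk])
    then have "distr (Q \<Otimes>\<^sub>M U01) (seqM \<Otimes>\<^sub>M borel) (\<lambda>z. (fst (fst z), \<psi> z)) =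
       distr (P \<Otimes>\<^sub>M noise) (seqM \<Otimes>\<^sub>M borel) (\<lambda>z. (hist k X z, Y z))"
      unfolding fresh .
    from trans[OF sym[OF this] law] show ?thesis .
  qed
  moreover have "AE z in P \<Otimes>\<^sub>M noise. Y z \<in> range (\<lambda>i. T i (fst z))"
  proof -
    have "AE z in distr (P \<Otimes>\<^sub>M noise) ((seqM \<Otimes>\<^sub>M seqM) \<Otimes>\<^sub>M borel) (\<lambda>z. (G z, snd z k)). \<exists>n. V n (fst z) \<and> \<psi> z = snd (fst z) n"
      unfolding fresh by (rule AE\<psi>)
    then have "AE z in P \<Otimes>\<^sub>M noise. \<exists>n. V n (G z) \<and> \<psi> (G z, snd z k) = snd (G z) n"
      using AE_distrD[OF mGk] by fastforce
    then show ?thesis by eventually_elim (auto simp: Y_def G_def)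
  qed
  moreover have "Y (\<omega>, u(m := r)) = Y (\<omega>, u)" if "m \<ge> Suc k" for m \<omega> u r
    using insG[of m] that by (simp add: Y_def)
  ultimately have "partial_enum P T (Suc k) (X(k := Y))"
    using X ins mY unfolding partial_enum_def
    by (intro allI impI, case_tac "n = k") (simp_all del: split_paired_All)
  with \<open>distr _ _ (\<lambda>z. (hist k X z, Y z)) = \<tau>\<close> that show thesis by blast
qed

text \<open>Where every value is already used, \<open>LEAST\<close> yields an unspecified index; for
  a partial enumeration of a sample-like sequence this has probability 0.\<close>

definition first_unused :: "(nat \<Rightarrow> 'a \<Rightarrow> real) \<Rightarrow> nat \<Rightarrow> (nat \<Rightarrow> 'a \<times> 'u \<Rightarrow> real) \<Rightarrow> 'a \<times> 'u \<Rightarrow> real" where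
  "first_unused T k X z = T (LEAST j. T j (fst z) \<notin> (\<lambda>n. X n z) ` {..<k}) (fst z)"

lemma next_unused:
  assumes P: "prob_space P" and T: "sample_like P T" and X: "partial_enum P T k X"
  defines "Y \<equiv> first_unused T k X"
  shows "partial_enum P T (Suc k) (X(k := Y))"
    and "absolutely_continuous (distr (P \<Otimes>\<^sub>M noise) seqM (hist k X) \<Otimes>\<^sub>M (lborel :: real measure))
           (distr (P \<Otimes>\<^sub>M noise) (seqM \<Otimes>\<^sub>M borel) (\<lambda>z. (hist k X z, Y z)))"
    and "Y \<in> borel_measurable (P \<Otimes>\<^sub>M noise)"
proof -
  interpret P: prob_space P by fact
  interpret N: prob_space noise by (rule prob_space_noise)
  interpret PN: pair_prob_space P noise ..
  have mX[measurable]: "\<And>n. n < k \<Longrightarrow> X n \<in> borel_measurable (P \<Otimes>\<^sub>M noise)" using X by (auto simp: partial_enum_def)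
  have mT[measurable]: "\<And>n. T n \<in> borel_measurable P" using T by (auto simp: sample_like_def)
  have mh[measurable]: "hist k X \<in> measurable (P \<Otimes>\<^sub>M noise) seqM" by (rule measurable_hist) (rule mX)
  define L where "L z = (LEAST j. T j (fst z) \<notin> (\<lambda>n. X n z) ` {..<k})" for z
  have "Measurable.pred (P \<Otimes>\<^sub>M noise) (\<lambda>z. T j (fst z) \<notin> (\<lambda>n. X n z) ` {..<k})" for j
  proof -
    have "(\<lambda>z. T j (fst z) \<notin> (\<lambda>n. X n z) ` {..<k}) = (\<lambda>z. \<forall>n\<in>{..<k}. T j (fst z) \<noteq> X n z)" by auto
    moreover have "Measurable.pred (P \<Otimes>\<^sub>M noise) (\<lambda>z. \<forall>n\<in>{..<k}. T j (fst z) \<noteq> X n z)"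
      by (rule pred_intros_finite(3)) (use mX in \<open>auto intro!: pred_intros_logic borel_measurable_eq\<close>)
    ultimately show ?thesis by simp
  qed
  then have mL[measurable]: "L \<in> measurable (P \<Otimes>\<^sub>M noise) (count_space UNIV)"
    unfolding L_def by (rule measurable_Least)
  have Y: "Y z = T (L z) (fst z)" for z by (simp add: Y_def first_unused_def L_def)
  show mY[measurable]: "Y \<in> borel_measurable (P \<Otimes>\<^sub>M noise)"
    unfolding Y[abs_def] by (rule measurable_compose_countable[OF _ mL]) measurable
  have ins: "X n (\<omega>, u(m := r)) = X n (\<omega>, u)" if "n < k" "m \<ge> k" for n m \<omega> u r
    using X that by (auto simp: partial_enum_def)
  have insL: "L (\<omega>, u(m := r)) = L (\<omega>, u)" if "m \<ge> k" for m \<omega> u r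
  proof -
    have "(\<lambda>n. X n (\<omega>, u(m := r))) ` {..<k} = (\<lambda>n. X n (\<omega>, u)) ` {..<k}"
      using ins[OF _ that] by (intro image_cong) auto
    then show ?thesis by (simp add: L_def)
  qed
  show "partial_enum P T (Suc k) (X(k := Y))"
    using X mY insL unfolding partial_enum_def Y
    by (intro allI impI, case_tac "n = k") (simp_all del: split_paired_All)
  show "absolutely_continuous (distr (P \<Otimes>\<^sub>M noise) seqM (hist k X) \<Otimes>\<^sub>M (lborel :: real measure))
           (distr (P \<Otimes>\<^sub>M noise) (seqM \<Otimes>\<^sub>M borel) (\<lambda>z. (hist k X z, Y z)))"
    unfolding absolutely_continuous_def
  proof (rule subsetI)
    fix A :: "((nat \<Rightarrow> real) \<times> real) set" assume A: "A \<in> null_sets (distr (P \<Otimes>\<^sub>M noise) seqM (hist k X) \<Otimes>\<^sub>M (lborel :: real measure))"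
    have sts: "sets (distr (P \<Otimes>\<^sub>M noise) seqM (hist k X) \<Otimes>\<^sub>M lborel) = sets (seqM \<Otimes>\<^sub>M (borel :: real measure))"
      by (intro sets_pair_measure_cong) auto
    have mA[measurable]: "A \<in> sets (seqM \<Otimes>\<^sub>M borel)" using A sts by auto
    have mE[measurable]: "(\<lambda>y. emeasure lborel (Pair y -` A)) \<in> borel_measurable seqM"
      by (rule lborel.measurable_emeasure_Pair) simp
    have "(\<integral>\<^sup>+z. emeasure lborel (Pair (hist k X z) -` A) \<partial>(P \<Otimes>\<^sub>M noise)) = 0"
      using null_setsD1[OF A] null_setsD2[OF A]
      by (subst (asm) lborel.emeasure_pair_measure_alt) (simp_all add: nn_integral_distr)
    then have "AE z in P \<Otimes>\<^sub>M noise. emeasure lborel (Pair (hist k X z) -` A) = 0"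
      by (subst (asm) nn_integral_0_iff_AE) auto
    moreover have "UNIV \<in> sets (seqM \<Otimes>\<^sub>M (borel :: real measure))"
      using sets.top[of "seqM \<Otimes>\<^sub>M (borel :: real measure)"] by (simp add: space_pair_measure space_PiM)
    note sample_like_hist[OF P T X this]
    ultimately have "AE z in P \<Otimes>\<^sub>M noise. (hist k X z, Y z) \<notin> A"
      using sample_like_hist[OF P T X mA]
    proof eventually_elim
      case (elim z)
      then have "\<exists>j. T j (fst z) \<notin> (\<lambda>n. X n z) ` {..<k}" by (auto simp: hist_image)
      then have "T (L z) (fst z) \<notin> (\<lambda>n. X n z) ` {..<k}" unfolding L_def by (rule LeastI_ex)
      with elim show ?case by (auto simp: Y hist_image)
    qed
    then have "emeasure (P \<Otimes>\<^sub>M noise) {z \<in> space (P \<Otimes>\<^sub>M noise). (hist k X z, Y z) \<in> A} = 0"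
      by (intro emeasure_eq_0_AE) simp
    then show "A \<in> null_sets (distr (P \<Otimes>\<^sub>M noise) (seqM \<Otimes>\<^sub>M borel) (\<lambda>z. (hist k X z, Y z)))"
      by (intro null_setsI) (simp_all add: emeasure_distr vimage_def Int_def conj_commute)
  qed
qed

lemma hist_Suc: "hist (Suc k) X z = (hist k X z)(k := X k z)"
  by (auto simp: hist_def fun_eq_iff less_Suc_eq)

lemma hist_upd: "hist k (X(k := Y)) = hist k X"
  by (auto simp: hist_def fun_eq_iff)

lemma extend_match:
  assumes P: "prob_space P" "sample_like P T" "partial_enum P T k X"
    and P': "prob_space P'" "sample_like P' T'" "partial_enum P' T' k X'"
    and law: "distr (P \<Otimes>\<^sub>M noise) seqM (hist k X) = distr (P' \<Otimes>\<^sub>M noise) seqM (hist k X')"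
  obtains Y' where "partial_enum P' T' (Suc k) (X'(k := Y'))"
    "distr (P \<Otimes>\<^sub>M noise) seqM (hist (Suc k) (X(k := first_unused T k X))) =
     distr (P' \<Otimes>\<^sub>M noise) seqM (hist (Suc k) (X'(k := Y')))"
proof -
  define Y where "Y = first_unused T k X"
  define \<tau> where "\<tau> = distr (P \<Otimes>\<^sub>M noise) (seqM \<Otimes>\<^sub>M borel) (\<lambda>z. (hist k X z, Y z))"
  note Yp = next_unused[OF P, folded Y_def]
  note Yp(3)[measurable]
  have mh[measurable]: "hist k X \<in> measurable (P \<Otimes>\<^sub>M noise) seqM"
    by (rule measurable_hist) (use P in \<open>auto simp: partial_enum_def\<close>)
  have mh'[measurable]: "hist k X' \<in> measurable (P' \<Otimes>\<^sub>M noise) seqM"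
    by (rule measurable_hist) (use P' in \<open>auto simp: partial_enum_def\<close>)
  have fst\<tau>: "distr \<tau> seqM fst = distr (P' \<Otimes>\<^sub>M noise) seqM (hist k X')"
    unfolding \<tau>_def law[symmetric] by (subst distr_distr) (auto simp: comp_def)
  obtain Y' where Y': "partial_enum P' T' (Suc k) (X'(k := Y'))"
    and law': "distr (P' \<Otimes>\<^sub>M noise) (seqM \<Otimes>\<^sub>M borel) (\<lambda>z. (hist k X' z, Y' z)) = \<tau>"
  proof (rule match_next[OF P', of \<tau>])
    show "distr \<tau> seqM fst = distr (P' \<Otimes>\<^sub>M noise) seqM (hist k X')" by fact
    show "absolutely_continuous (distr (P' \<Otimes>\<^sub>M noise) seqM (hist k X') \<Otimes>\<^sub>M lborel) \<tau>"
      using Yp(2) by (simp only: \<tau>_def law)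
  qed (auto simp: \<tau>_def)
  have mY'[measurable]: "Y' \<in> borel_measurable (P' \<Otimes>\<^sub>M noise)"
    using Y' by (auto simp: partial_enum_def dest: spec[of _ k])
  have upd[measurable]: "(\<lambda>x. (fst x)(k := snd x)) \<in> measurable (seqM \<Otimes>\<^sub>M borel) seqM" by measurable
  have "distr (P \<Otimes>\<^sub>M noise) seqM (hist (Suc k) (X(k := Y))) = distr \<tau> seqM (\<lambda>x. (fst x)(k := snd x))"
    unfolding \<tau>_def by (subst distr_distr) (auto simp: comp_def hist_Suc[abs_def] hist_upd intro!: distr_cong)
  also have "\<dots> = distr (P' \<Otimes>\<^sub>M noise) seqM (hist (Suc k) (X'(k := Y')))"
    unfolding law'[symmetric] by (subst distr_distr) (auto simp: comp_def hist_Suc[abs_def] hist_upd intro!: distr_cong)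
  finally show thesis using that Y' by (simp add: Y_def)
qed

text \<open>If \<open>t j\<close> were never used, then each step in \<open>E\<close> would use up a new one of the finitely many
  values \<open>t 0, \<dots>, t j\<close>.\<close>

lemma range_exhausted:
  fixes x t :: "nat \<Rightarrow> 'b" and E :: "nat set"
  assumes E: "infinite E"
    and x: "\<And>k. k \<in> E \<Longrightarrow> x k = t (LEAST j. t j \<notin> x ` {..<k})"
  shows "range t \<subseteq> range x"
proof
  fix y assume "y \<in> range t"
  then obtain j where j: "y = t j" by auto
  show "y \<in> range x"
  proof (rule ccontr)
    assume y: "y \<notin> range x"
    have *: "x k \<in> t ` {..j} \<and> x k \<notin> x ` {..<k}" if k: "k \<in> E" for k
    proof -
      let ?L = "LEAST j. t j \<notin> x ` {..<k}"
      have "t j \<notin> x ` {..<k}" using y j by auto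
      then have "t ?L \<notin> x ` {..<k}" "?L \<le> j" by (rule LeastI, rule Least_le)
      then show ?thesis using x[OF k] by auto
    qed
    have "inj_on x E"
    proof (rule linorder_inj_onI')
      fix a b assume "a \<in> E" "b \<in> E" "a < b"
      then show "x a \<noteq> x b" using *[OF \<open>b \<in> E\<close>] by (metis imageI lessThan_iff)
    qed
    moreover have "finite (x ` E)" by (rule finite_subset[of _ "t ` {..j}"]) (use * in auto)
    ultimately show False using E finite_imageD by blast
  qed
qed

theorem back_and_forth:
  assumes P: "prob_space P" "sample_like P T" and P': "prob_space P'" "sample_like P' T'"
  obtains X X' where
    "\<And>n. X n \<in> borel_measurable (P \<Otimes>\<^sub>M noise)" "AE z in P \<Otimes>\<^sub>M noise. range (\<lambda>n. X n z) = range (\<lambda>i. T i (fst z))"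
    "\<And>n. X' n \<in> borel_measurable (P' \<Otimes>\<^sub>M noise)" "AE z in P' \<Otimes>\<^sub>M noise. range (\<lambda>n. X' n z) = range (\<lambda>i. T' i (fst z))"
    "distr (P \<Otimes>\<^sub>M noise) seqM (\<lambda>z n. X n z) = distr (P' \<Otimes>\<^sub>M noise) seqM (\<lambda>z n. X' n z)"
proof -
  define Inv where "Inv k s \<longleftrightarrow> partial_enum P T k (fst s) \<and> partial_enum P' T' k (snd s) \<and>
     distr (P \<Otimes>\<^sub>M noise) seqM (hist k (fst s)) = distr (P' \<Otimes>\<^sub>M noise) seqM (hist k (snd s))" for k s
  define Step where "Step k s t \<longleftrightarrow> (\<exists>Y Y'. t = ((fst s)(k := Y), (snd s)(k := Y')) \<and>
     (even k \<longrightarrow> Y = first_unused T k (fst s)) \<and> (odd k \<longrightarrow> Y' = first_unused T' k (snd s)))" for k and s t :: "(nat \<Rightarrow> 'a \<times> (nat \<Rightarrow> real) \<Rightarrow> real) \<times> (nat \<Rightarrow> 'b \<times> (nat \<Rightarrow> real) \<Rightarrow> real)"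
  have "\<exists>f. \<forall>n. Inv n (f n) \<and> Step n (f n) (f (Suc n))"
  proof (rule dependent_nat_choice)
    interpret P: prob_space P by fact
    interpret P': prob_space P' by fact
    interpret N: prob_space noise by (rule prob_space_noise)
    interpret PN: pair_prob_space P noise ..
    interpret PN': pair_prob_space P' noise ..
    \<comment> \<open>A history of length 0 is the constant zero sequence, so its law is the same on
      every probability space.\<close>
    have "distr M seqM (hist 0 X) = return seqM (\<lambda>_. 0)" if "prob_space M" for M :: "'z measure" and X
    proof -
      interpret M: prob_space M by fact
      show ?thesis unfolding hist_def
        by (intro measure_eqI) (auto simp: emeasure_distr M.emeasure_space_1 indicator_def space_PiM)
    qed
    note this[OF PN.prob_space_axioms] this[OF PN'.prob_space_axioms]
    then show "\<exists>s. Inv 0 s" by (auto simp: Inv_def partial_enum_def)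
  next
    fix s k assume "Inv k s"
    then have s: "partial_enum P T k (fst s)" "partial_enum P' T' k (snd s)"
     and law: "distr (P \<Otimes>\<^sub>M noise) seqM (hist k (fst s)) = distr (P' \<Otimes>\<^sub>M noise) seqM (hist k (snd s))"
      by (auto simp: Inv_def)
    show "\<exists>t. Inv (Suc k) t \<and> Step k s t"
    proof (cases "even k")
      case True
      obtain Y' where Y': "partial_enum P' T' (Suc k) ((snd s)(k := Y'))"
        "distr (P \<Otimes>\<^sub>M noise) seqM (hist (Suc k) ((fst s)(k := first_unused T k (fst s)))) =
         distr (P' \<Otimes>\<^sub>M noise) seqM (hist (Suc k) ((snd s)(k := Y')))"
        using extend_match[OF P s(1) P' s(2) law] by blast
      have "partial_enum P T (Suc k) ((fst s)(k := first_unused T k (fst s)))"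
        by (rule next_unused(1)[OF P s(1)])
      with Y' True show ?thesis
        by (intro exI[of _ "((fst s)(k := first_unused T k (fst s)), (snd s)(k := Y'))"]) (auto simp: Inv_def Step_def)
    next
      case False
      obtain Y where Y: "partial_enum P T (Suc k) ((fst s)(k := Y))"
        "distr (P' \<Otimes>\<^sub>M noise) seqM (hist (Suc k) ((snd s)(k := first_unused T' k (snd s)))) =
         distr (P \<Otimes>\<^sub>M noise) seqM (hist (Suc k) ((fst s)(k := Y)))"
        using extend_match[OF P' s(2) P s(1) law[symmetric]] by blast
      have "partial_enum P' T' (Suc k) ((snd s)(k := first_unused T' k (snd s)))"
        by (rule next_unused(1)[OF P' s(2)])
      with Y False show ?thesis
        by (intro exI[of _ "((fst s)(k := Y), (snd s)(k := first_unused T' k (snd s)))"]) (auto simp: Inv_def Step_def)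
    qed
  qed
  then obtain f where Inv: "\<And>n. Inv n (f n)" and Step: "\<And>n. Step n (f n) (f (Suc n))" by blast
  define X where "X n = fst (f (Suc n)) n" for n
  define X' where "X' n = snd (f (Suc n)) n" for n
  have f_Suc: "fst (f (Suc k)) n = (if n = k then X k else fst (f k) n)"
    "snd (f (Suc k)) n = (if n = k then X' k else snd (f k) n)" for k n
    using Step[of k] by (auto simp: Step_def X_def X'_def)
  \<comment> \<open>A step changes only its own position, so the successive stages have a common
    limit.\<close>
  have agree: "fst (f k) n = X n \<and> snd (f k) n = X' n" if "n < k" for n k
    using that by (induction k) (auto simp: f_Suc less_Suc_eq)
  have X_step: "X k z = T (LEAST j. T j (fst z) \<notin> (\<lambda>n. X n z) ` {..<k}) (fst z)" if "even k" for k z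
  proof -
    have "X k = first_unused T k (fst (f k))" using Step[of k] that by (auto simp: Step_def X_def)
    moreover have "(\<lambda>n. fst (f k) n z) ` {..<k} = (\<lambda>n. X n z) ` {..<k}" by (intro image_cong) (auto simp: agree)
    ultimately show ?thesis by (simp add: first_unused_def)
  qed
  have X'_step: "X' k z = T' (LEAST j. T' j (fst z) \<notin> (\<lambda>n. X' n z) ` {..<k}) (fst z)" if "odd k" for k z
  proof -
    have "X' k = first_unused T' k (snd (f k))" using Step[of k] that by (auto simp: Step_def X'_def)
    moreover have "(\<lambda>n. snd (f k) n z) ` {..<k} = (\<lambda>n. X' n z) ` {..<k}" by (intro image_cong) (auto simp: agree)
    ultimately show ?thesis by (simp add: first_unused_def)
  qed
  have pX: "partial_enum P T k X" and pX': "partial_enum P' T' k X'" for k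
    using Inv[of k] agree[of _ k] by (auto simp: Inv_def partial_enum_def)
  have mX[measurable]: "X n \<in> borel_measurable (P \<Otimes>\<^sub>M noise)" and mX'[measurable]: "X' n \<in> borel_measurable (P' \<Otimes>\<^sub>M noise)" for n
    using pX[of "Suc n"] pX'[of "Suc n"] by (auto simp: partial_enum_def)
  have law: "distr (P \<Otimes>\<^sub>M noise) seqM (hist k X) = distr (P' \<Otimes>\<^sub>M noise) seqM (hist k X')" for k
  proof -
    have "hist k (fst (f k)) = hist k X" "hist k (snd (f k)) = hist k X'"
      using agree[of _ k] by (auto simp: hist_def fun_eq_iff)
    then show ?thesis using Inv[of k] by (simp add: Inv_def)
  qed
  have inf: "infinite {k::nat. even k}" "infinite {k::nat. odd k}"
    unfolding infinite_nat_iff_unbounded_le mem_Collect_eq by (metis even_Suc le_SucI order_refl)+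
  have "AE z in P \<Otimes>\<^sub>M noise. \<forall>n. X n z \<in> range (\<lambda>i. T i (fst z))"
    unfolding AE_all_countable using pX[of "Suc _"] by (auto simp: partial_enum_def)
  then have rX: "AE z in P \<Otimes>\<^sub>M noise. range (\<lambda>n. X n z) = range (\<lambda>i. T i (fst z))"
  proof eventually_elim
    case (elim z)
    then have "range (\<lambda>n. X n z) \<subseteq> range (\<lambda>i. T i (fst z))" by auto
    moreover have "range (\<lambda>i. T i (fst z)) \<subseteq> range (\<lambda>n. X n z)"
      by (rule range_exhausted[OF inf(1)]) (use X_step in auto)
    ultimately show ?case by (rule subset_antisym)
  qed
  have "AE z in P' \<Otimes>\<^sub>M noise. \<forall>n. X' n z \<in> range (\<lambda>i. T' i (fst z))"
    unfolding AE_all_countable using pX'[of "Suc _"] by (auto simp: partial_enum_def)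
  then have rX': "AE z in P' \<Otimes>\<^sub>M noise. range (\<lambda>n. X' n z) = range (\<lambda>i. T' i (fst z))"
  proof eventually_elim
    case (elim z)
    then have "range (\<lambda>n. X' n z) \<subseteq> range (\<lambda>i. T' i (fst z))" by auto
    moreover have "range (\<lambda>i. T' i (fst z)) \<subseteq> range (\<lambda>n. X' n z)"
      by (rule range_exhausted[OF inf(2)]) (use X'_step in auto)
    ultimately show ?case by (rule subset_antisym)
  qed
  have "distr (P \<Otimes>\<^sub>M noise) seqM (\<lambda>z n. X n z) = distr (P' \<Otimes>\<^sub>M noise) seqM (\<lambda>z n. X' n z)"
    (is "?D = ?D'")
  proof (rule measure_eqI_PiM_infinite[where I=UNIV and M="\<lambda>_. borel"])
    interpret P: prob_space P by fact
    interpret N: prob_space noise by (rule prob_space_noise)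
    interpret PN: pair_prob_space P noise ..
    have m: "(\<lambda>z n. X n z) \<in> measurable (P \<Otimes>\<^sub>M noise) seqM" "(\<lambda>z n. X' n z) \<in> measurable (P' \<Otimes>\<^sub>M noise) seqM"
      by (auto intro!: measurable_PiM_single')
    interpret D: prob_space ?D by (rule PN.prob_space_distr) (rule m)
    show "finite_measure ?D" by (rule D.finite_measure_axioms)
    fix A :: "nat \<Rightarrow> real set" and J :: "nat set" assume J: "finite J" and A: "\<And>i. i \<in> J \<Longrightarrow> A i \<in> sets borel"
    obtain k where k: "J \<subseteq> {..<k}" using finite_nat_iff_bounded[of J] J by auto
    define E where "E = prod_emb UNIV (\<lambda>_. borel :: real measure) J (Pi\<^sub>E J A)"
    have E: "E \<in> sets seqM" unfolding E_def using J A by (intro sets_PiM_I) auto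
    have Eiff: "x \<in> E \<longleftrightarrow> (\<forall>j\<in>J. x j \<in> A j)" for x
      by (auto simp: E_def prod_emb_def restrict_PiE_iff space_PiM)
    \<comment> \<open>\<open>E\<close> restricts coordinates below \<open>k\<close> only, so it
      cannot distinguish the full sequence from its padded history.\<close>
    have h: "hist k Z z \<in> E \<longleftrightarrow> (\<lambda>n. Z n z) \<in> E" for Z :: "nat \<Rightarrow> 'z \<Rightarrow> real" and z
      using k by (auto simp: Eiff hist_def)
    have h': "hist k Z z \<in> E \<longleftrightarrow> (\<lambda>n. Z n z) \<in> E" for Z :: "nat \<Rightarrow> 'y \<Rightarrow> real" and z
      using k by (auto simp: Eiff hist_def)
    have "emeasure ?D E = emeasure (distr (P \<Otimes>\<^sub>M noise) seqM (hist k X)) E"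
      using m E by (subst (1 2) emeasure_distr) (auto intro!: measurable_hist arg_cong2[where f=emeasure] simp: h)
    also have "\<dots> = emeasure ?D' E"
      unfolding law using m E by (subst (1 2) emeasure_distr) (auto intro!: measurable_hist arg_cong2[where f=emeasure] simp: h')
    finally show "emeasure ?D (prod_emb UNIV (\<lambda>_. borel) J (Pi\<^sub>E J A)) = emeasure ?D' (prod_emb UNIV (\<lambda>_. borel) J (Pi\<^sub>E J A))"
      unfolding E_def .
  qed auto
  with rX rX' mX mX' that show thesis by blast
qed

section \<open>Resampling an enumeration\<close>

lemma space_coffin[simp]: "space coffin_borel = UNIV"
  unfolding coffin_borel_def by (rule space_measure_of) auto

lemma sets_coffin: "sets coffin_borel = sigma_sets UNIV ({Some ` A | A. A \<in> sets borel} \<union> {{None}})"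
  unfolding coffin_borel_def by (rule sets_measure_of) auto

lemma measurable_Some_coffin[measurable]: "Some \<in> measurable borel coffin_borel"
  unfolding coffin_borel_def
  by (rule measurable_measure_of) (auto simp: inj_image_mem_iff vimage_def)

lemma None_coffin[measurable, simp]: "{None} \<in> sets coffin_borel"
  unfolding sets_coffin by (rule sigma_sets.Basic) auto

lemma measurable_the_coffin[measurable]: "the \<in> measurable coffin_borel borel"
proof (rule measurableI)
  fix A :: "real set" assume A: "A \<in> sets borel"
  have "Some ` A \<in> sets coffin_borel" unfolding sets_coffin using A by (intro sigma_sets.Basic) auto
  \<comment> \<open>\<open>the None\<close> is a fixed unspecified real, so whether the coffin state
    belongs to the preimage depends on \<open>A\<close>.\<close>
  moreover have "the -` A \<inter> space coffin_borel = Some ` A \<union> (if the None \<in> A then {None} else {})"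
    by (auto split: if_splits) (metis image_eqI not_Some_eq option.sel)+
  ultimately show "the -` A \<inter> space coffin_borel \<in> sets coffin_borel"
    using sets.Un[OF _ None_coffin, of "Some ` A"] by (auto split: if_splits)
qed simp

lemma pred_eq_None_coffin[measurable (raw)]:
  assumes "f \<in> measurable M coffin_borel" shows "Measurable.pred M (\<lambda>x. f x = None)"
proof -
  have "f -` {None} \<inter> space M \<in> sets M" using assms by (rule measurable_sets) simp
  then show ?thesis unfolding pred_def by (simp add: vimage_def Int_def conj_commute)
qed

lemma pred_eq_Some_coffin[measurable (raw)]:
  assumes [measurable]: "f \<in> measurable M coffin_borel" "g \<in> borel_measurable M"
  shows "Measurable.pred M (\<lambda>x. f x = Some (g x))"
proof -
  have "(\<lambda>x. f x = Some (g x)) = (\<lambda>x. f x \<noteq> None \<and> the (f x) = g x)" by auto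
  moreover have "Measurable.pred M (\<lambda>x. f x \<noteq> None \<and> the (f x) = g x)" by measurable
  ultimately show ?thesis by simp
qed

lemma pred_Some_in_coffin[measurable (raw)]:
  assumes [measurable]: "f \<in> measurable M coffin_borel" and "Measurable.pred M (\<lambda>x. P x (the (f x)))"
  shows "Measurable.pred M (\<lambda>x. \<exists>y. f x = Some y \<and> P x y)"
proof -
  have "(\<lambda>x. \<exists>y. f x = Some y \<and> P x y) = (\<lambda>x. f x \<noteq> None \<and> P x (the (f x)))" by force
  moreover have "Measurable.pred M (\<lambda>x. f x \<noteq> None \<and> P x (the (f x)))" using assms by measurable
  ultimately show ?thesis by simp
qed

abbreviation "cseqM \<equiv> PiM (UNIV :: nat set) (\<lambda>_. coffin_borel)"

text \<open>Turns an equality of sets into countably many conditions on single entries, which makes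
  it a measurable event in the pair of sequences.\<close>

lemma seq_set_eq_range_iff:
  "seq_set s = range t \<longleftrightarrow> (\<forall>i. s i = None \<or> (\<exists>n. s i = Some (t n))) \<and> (\<forall>n. \<exists>i. s i = Some (t n))"
  unfolding seq_set_def
proof safe
  fix i assume *: "Option.these (range s) = range t" "\<nexists>n. s i = Some (t n)"
  show "s i = None"
  proof (rule ccontr)
    assume "s i \<noteq> None"
    then obtain y where y: "s i = Some y" by auto
    then have "y \<in> Option.these (range s)" by (metis in_these_eq rangeI)
    with * y show False by auto
  qed
next
  fix n assume "Option.these (range s) = range t"
  then have "t n \<in> Option.these (range s)" by auto
  then show "\<exists>i. s i = Some (t n)" by (metis in_these_eq rangeE)
next
  fix y assume *: "\<forall>i. s i = None \<or> (\<exists>n. s i = Some (t n))" "y \<in> Option.these (range s)"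
  then obtain i where "s i = Some y" by (auto simp: in_these_eq)
  then show "y \<in> range t" using * by (metis option.distinct(1) option.inject rangeI)
next
  fix n assume "\<forall>n. \<exists>i. s i = Some (t n)"
  then show "t n \<in> Option.these (range s)" by (metis in_these_eq rangeI)
qed

lemma pred_seq_set_eq_range[measurable (raw)]:
  fixes t :: "'a \<Rightarrow> nat \<Rightarrow> real"
  assumes [measurable]: "\<And>i. (\<lambda>x. s x i) \<in> measurable M coffin_borel" "\<And>i. (\<lambda>x. t x i) \<in> borel_measurable M"
  shows "Measurable.pred M (\<lambda>x. seq_set (s x) = range (t x))"
proof -
  have p: "Measurable.pred M (\<lambda>x. s x i = Some (t x n))" "Measurable.pred M (\<lambda>x. s x i = None)" for i n
    by (rule pred_eq_Some_coffin[OF assms(1,2)] pred_eq_None_coffin[OF assms(1)])+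
  show ?thesis unfolding seq_set_eq_range_iff
    by (intro pred_intros_logic(3,5) pred_intros_countable p)
qed

definition ohist :: "nat \<Rightarrow> (nat \<Rightarrow> 'a \<Rightarrow> real option) \<Rightarrow> 'a \<Rightarrow> nat \<Rightarrow> real option" where
  "ohist k S z = (\<lambda>n. if n < k then S n z else None)"

lemma measurable_ohist:
  assumes "\<And>n. n < k \<Longrightarrow> S n \<in> measurable M coffin_borel"
  shows "ohist k S \<in> measurable M cseqM"
  unfolding ohist_def
proof (rule measurable_PiM_single')
  fix i show "(\<lambda>x. if i < k then S i x else None) \<in> measurable M coffin_borel"
    using assms by (cases "i < k") auto
qed auto

lemma ohist_Suc: "ohist (Suc k) S z = (ohist k S z)(k := S k z)"
  by (auto simp: ohist_def fun_eq_iff less_Suc_eq)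

lemma ohist_upd: "ohist k (S(k := Y)) = ohist k S"
  by (auto simp: ohist_def fun_eq_iff)

lemma measurable_fun_upd_cseq[measurable (raw)]:
  assumes f: "f \<in> measurable M cseqM" and g: "g \<in> measurable M coffin_borel"
  shows "(\<lambda>x. (f x)(k := g x)) \<in> measurable M cseqM"
proof (rule measurable_PiM_single')
  fix i
  have [measurable]: "(\<lambda>x. f x i) \<in> measurable M coffin_borel" using f by measurable
  note g[measurable]
  show "(\<lambda>x. ((f x)(k := g x)) i) \<in> measurable M coffin_borel" by (cases "i = k") simp_all
qed auto

text \<open>The entries are redrawn one after the other, each from its conditional law given all of
  \<open>X\<close> and the earlier entries. Given \<open>X\<close>, only \<open>None\<close> and the
  values \<open>X n\<close> are possible, so \<open>discrete_transfer\<close> applies; step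
  \<open>k\<close> uses noise coordinate \<open>k\<close>, which the earlier steps left
  untouched.\<close>

lemma transfer_enumeration:
  assumes Q: "prob_space Q" and X[measurable]: "\<And>n. X n \<in> borel_measurable Q"
    and S[measurable]: "\<And>i. S i \<in> measurable Q coffin_borel"
    and sub: "AE z in Q. \<forall>i. S i z = None \<or> (\<exists>n. S i z = Some (X n z))"
    and Q': "prob_space Q'" and X'[measurable]: "\<And>n. X' n \<in> borel_measurable Q'"
    and law: "distr Q seqM (\<lambda>z n. X n z) = distr Q' seqM (\<lambda>z n. X' n z)"
  obtains S' where "\<And>i. S' i \<in> measurable (Q' \<Otimes>\<^sub>M noise) coffin_borel"
    "distr Q (PiM UNIV (\<lambda>_::nat. borel \<Otimes>\<^sub>M coffin_borel)) (\<lambda>z n. (X n z, S n z)) =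
     distr (Q' \<Otimes>\<^sub>M noise) (PiM UNIV (\<lambda>_::nat. borel \<Otimes>\<^sub>M coffin_borel)) (\<lambda>z n. (X' n (fst z), S' n z))"
proof -
  interpret Q: prob_space Q by fact
  interpret Q': prob_space Q' by fact
  interpret N: prob_space noise by (rule prob_space_noise)
  interpret QN: pair_prob_space Q' noise ..
  let ?H = "seqM \<Otimes>\<^sub>M cseqM"
  have mX[measurable]: "(\<lambda>z n. X n z) \<in> measurable Q seqM" by (rule measurable_PiM_single') auto
  have mX'[measurable]: "(\<lambda>z n. X' n z) \<in> measurable Q' seqM" by (rule measurable_PiM_single') auto
  define K where "K k z = ((\<lambda>n. X n z), ohist k S z)" for k z
  define K' where "K' k S' z = ((\<lambda>n. X' n (fst z)), ohist k S' z)" for k S' and z :: "_ \<times> (nat \<Rightarrow> real)"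
  have mK[measurable]: "K k \<in> measurable Q ?H" for k
    unfolding K_def by (intro measurable_Pair measurable_ohist mX S)
  have mK': "K' k S' \<in> measurable (Q' \<Otimes>\<^sub>M noise) ?H" if "\<And>n. n < k \<Longrightarrow> S' n \<in> measurable (Q' \<Otimes>\<^sub>M noise) coffin_borel" for k S'
    unfolding K'_def by (intro measurable_Pair measurable_ohist measurable_compose[OF measurable_fst mX'] that)
  define Inv where "Inv k S' \<longleftrightarrow> (\<forall>n<k. S' n \<in> measurable (Q' \<Otimes>\<^sub>M noise) coffin_borel \<and>
     (\<forall>m\<ge>k. \<forall>\<omega> u r. S' n (\<omega>, u(m := r)) = S' n (\<omega>, u))) \<and>
     distr Q ?H (K k) = distr (Q' \<Otimes>\<^sub>M noise) ?H (K' k S')" for k S'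
  have "\<exists>f. \<forall>k. Inv k (f k) \<and> (\<exists>Y. f (Suc k) = (f k)(k := Y))"
  proof (rule dependent_nat_choice)
    have "distr Q ?H (K 0) = distr (distr Q seqM (\<lambda>z n. X n z)) ?H (\<lambda>x. (x, \<lambda>_. None))"
      by (subst distr_distr) (auto simp: comp_def K_def[abs_def] ohist_def intro!: measurable_Pair measurable_PiM_single')
    also have "\<dots> = distr (distr (Q' \<Otimes>\<^sub>M noise) Q' fst) ?H (\<lambda>z. (\<lambda>n. X' n z, \<lambda>_. None))"
      unfolding law N.distr_pair_fst
      by (subst distr_distr) (auto simp: comp_def intro!: measurable_Pair measurable_PiM_single')
    also have "\<dots> = distr (Q' \<Otimes>\<^sub>M noise) ?H (K' 0 (\<lambda>_ _. None))"
      by (subst distr_distr) (auto simp: comp_def K'_def[abs_def] ohist_def intro!: measurable_Pair measurable_PiM_single')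
    finally show "\<exists>S'. Inv 0 S'" by (auto simp: Inv_def)
  next
    fix S' k assume inv: "Inv k S'"
    have mS': "S' n \<in> measurable (Q' \<Otimes>\<^sub>M noise) coffin_borel" if "n < k" for n using inv that by (auto simp: Inv_def)
    have ins: "S' n (\<omega>, u(m := r)) = S' n (\<omega>, u)" if "n < k" "m \<ge> k" for n m \<omega> u r
      using inv that by (auto simp: Inv_def)
    have lawk: "distr Q ?H (K k) = distr (Q' \<Otimes>\<^sub>M noise) ?H (K' k S')" using inv by (simp add: Inv_def)
    have mK'k[measurable]: "K' k S' \<in> measurable (Q' \<Otimes>\<^sub>M noise) ?H" by (rule mK') (rule mS')
    define \<mu> where "\<mu> = distr Q (?H \<Otimes>\<^sub>M coffin_borel) (\<lambda>z. (K k z, S k z))"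
    have \<mu>: "prob_space \<mu>" unfolding \<mu>_def by (rule Q.prob_space_distr) measurable
    have fst\<mu>: "distr \<mu> ?H fst = distr Q ?H (K k)"
      unfolding \<mu>_def by (subst distr_distr) (auto simp: comp_def)
    \<comment> \<open>Index 0 is reserved for the coffin state, so \<open>Suc i\<close> stands for
      the value of \<open>X i\<close>.\<close>
    define \<phi> where "\<phi> n \<kappa> = (case n of 0 \<Rightarrow> None | Suc i \<Rightarrow> Some (fst \<kappa> i))" for n and \<kappa> :: "(nat \<Rightarrow> real) \<times> (nat \<Rightarrow> real option)"
    have \<phi>[measurable]: "\<phi> n \<in> measurable ?H coffin_borel" for n
      unfolding \<phi>_def by (cases n) simp_all
    have diag[measurable]: "Measurable.pred (?H \<Otimes>\<^sub>M coffin_borel) (\<lambda>z. snd z = \<phi> n (fst z))" for n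
      unfolding \<phi>_def by (cases n) simp_all
    have ex: "AE z in \<mu>. \<exists>n. snd z = \<phi> n (fst z)"
      unfolding \<mu>_def
    proof (subst AE_distr_iff)
      show "AE z in Q. \<exists>n. snd (K k z, S k z) = \<phi> n (fst (K k z, S k z))"
        using sub
      proof eventually_elim
        case (elim z)
        then consider "S k z = None" | n where "S k z = Some (X n z)" by metis
        then show ?case
        proof cases
          case 1 then show ?thesis by (intro exI[of _ 0]) (simp add: \<phi>_def)
        next
          case (2 n) then show ?thesis by (intro exI[of _ "Suc n"]) (simp add: \<phi>_def K_def)
        qed
      qed
    qed measurable
    have s\<mu>: "sets \<mu> = sets (?H \<Otimes>\<^sub>M coffin_borel)" by (simp add: \<mu>_def)
    obtain \<psi> where \<psi>[measurable]: "\<psi> \<in> measurable (?H \<Otimes>\<^sub>M borel) coffin_borel"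
      and \<psi>law: "distr (distr \<mu> ?H fst \<Otimes>\<^sub>M U01) (?H \<Otimes>\<^sub>M coffin_borel) (\<lambda>z. (fst z, \<psi> z)) = \<mu>"
      by (rule discrete_transfer[OF \<mu> s\<mu> \<phi> diag ex]) blast
    have insK: "K' k S' (\<omega>, u(m := r)) = K' k S' (\<omega>, u)" if "m \<ge> k" for \<omega> u m r
      using ins[OF _ that] by (auto simp: K'_def ohist_def fun_eq_iff)
    have fresh: "distr (Q' \<Otimes>\<^sub>M noise) (?H \<Otimes>\<^sub>M borel) (\<lambda>z. (K' k S' z, snd z k)) = distr \<mu> ?H fst \<Otimes>\<^sub>M U01"
      unfolding fst\<mu> lawk by (rule distr_fresh_coordinate[OF Q' mK'k]) (rule insK[OF order_refl])
    define Y where "Y z = \<psi> (K' k S' z, snd z k)" for z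
    have mKk[measurable]: "(\<lambda>z. (K' k S' z, snd z k)) \<in> measurable (Q' \<Otimes>\<^sub>M noise) (?H \<Otimes>\<^sub>M borel)" by measurable
    have mY[measurable]: "Y \<in> measurable (Q' \<Otimes>\<^sub>M noise) coffin_borel" unfolding Y_def by measurable
    have "\<mu> = distr (distr (Q' \<Otimes>\<^sub>M noise) (?H \<Otimes>\<^sub>M borel) (\<lambda>z. (K' k S' z, snd z k))) (?H \<Otimes>\<^sub>M coffin_borel) (\<lambda>z. (fst z, \<psi> z))"
      unfolding fresh by (rule \<psi>law[symmetric])
    also have "\<dots> = distr (Q' \<Otimes>\<^sub>M noise) (?H \<Otimes>\<^sub>M coffin_borel) (\<lambda>z. (K' k S' z, Y z))"
      by (subst distr_distr) (auto simp: comp_def Y_def)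
    finally have \<mu>': "\<mu> = distr (Q' \<Otimes>\<^sub>M noise) (?H \<Otimes>\<^sub>M coffin_borel) (\<lambda>z. (K' k S' z, Y z))" .
    let ?app = "\<lambda>y :: ((nat \<Rightarrow> real) \<times> (nat \<Rightarrow> real option)) \<times> real option. (fst (fst y), (snd (fst y))(k := snd y))"
    have app: "K (Suc k) = ?app \<circ> (\<lambda>z. (K k z, S k z))"
      "K' (Suc k) (S'(k := Y)) = ?app \<circ> (\<lambda>z. (K' k S' z, Y z))"
      by (simp_all add: fun_eq_iff K_def K'_def ohist_Suc ohist_upd)
    have "distr Q ?H (K (Suc k)) = distr \<mu> ?H ?app"
      unfolding \<mu>_def app by (rule distr_distr[symmetric]) measurable
    also have "\<dots> = distr (Q' \<Otimes>\<^sub>M noise) ?H (K' (Suc k) (S'(k := Y)))"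
      unfolding \<mu>' app by (rule distr_distr) measurable
    finally have lawS: "distr Q ?H (K (Suc k)) = distr (Q' \<Otimes>\<^sub>M noise) ?H (K' (Suc k) (S'(k := Y)))" .
    have "Inv (Suc k) (S'(k := Y))"
      unfolding Inv_def
    proof (intro conjI allI impI)
      fix n assume "n < Suc k"
      then show "(S'(k := Y)) n \<in> measurable (Q' \<Otimes>\<^sub>M noise) coffin_borel"
        using mS' mY by (cases "n = k") auto
      fix m \<omega> u r assume "Suc k \<le> m"
      then show "(S'(k := Y)) n (\<omega>, u(m := r)) = (S'(k := Y)) n (\<omega>, u)"
        using ins[of n m] insK[of m] \<open>n < Suc k\<close> by (cases "n = k") (auto simp: Y_def)
    qed (fact lawS)
    then show "\<exists>S''. Inv (Suc k) S'' \<and> (\<exists>Y. S'' = S'(k := Y))" by blast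
  qed
  then obtain f where Inv: "\<And>k. Inv k (f k)" and Step: "\<And>k. \<exists>Y. f (Suc k) = (f k)(k := Y)" by blast
  define S' where "S' n = f (Suc n) n" for n
  have f_Suc: "f (Suc k) n = (if n = k then S' k else f k n)" for k n
    using Step[of k] by (auto simp: S'_def)
  have agree: "f k n = S' n" if "n < k" for n k
    using that by (induction k) (auto simp: f_Suc less_Suc_eq)
  have mS'[measurable]: "S' n \<in> measurable (Q' \<Otimes>\<^sub>M noise) coffin_borel" for n
    using Inv[of "Suc n"] agree[of n "Suc n"] by (auto simp: Inv_def)
  have lawk: "distr Q ?H (K k) = distr (Q' \<Otimes>\<^sub>M noise) ?H (K' k S')" for k
  proof -
    have "ohist k (f k) = ohist k S'" using agree[of _ k] by (auto simp: ohist_def fun_eq_iff)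
    then show ?thesis using Inv[of k] by (simp add: Inv_def K'_def[abs_def])
  qed
  let ?PM = "PiM UNIV (\<lambda>_::nat. (borel :: real measure) \<Otimes>\<^sub>M coffin_borel)"
  have "distr Q ?PM (\<lambda>z n. (X n z, S n z)) = distr (Q' \<Otimes>\<^sub>M noise) ?PM (\<lambda>z n. (X' n (fst z), S' n z))"
    (is "?D = ?D'")
  proof (rule measure_eqI_PiM_infinite[where I=UNIV and M="\<lambda>_. borel \<Otimes>\<^sub>M coffin_borel"])
    have m[measurable]: "(\<lambda>z n. (X n z, S n z)) \<in> measurable Q ?PM" "(\<lambda>z n. (X' n (fst z), S' n z)) \<in> measurable (Q' \<Otimes>\<^sub>M noise) ?PM"
      by (auto intro!: measurable_PiM_single' simp: space_pair_measure)
    interpret D: prob_space ?D by (rule Q.prob_space_distr) (rule m)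
    show "finite_measure ?D" by (rule D.finite_measure_axioms)
    fix A :: "nat \<Rightarrow> (real \<times> real option) set" and J :: "nat set"
    assume J: "finite J" and A: "\<And>i. i \<in> J \<Longrightarrow> A i \<in> sets (borel \<Otimes>\<^sub>M coffin_borel)"
    obtain k where k: "J \<subseteq> {..<k}" using finite_nat_iff_bounded[of J] J by auto
    define E where "E = prod_emb UNIV (\<lambda>_. (borel :: real measure) \<Otimes>\<^sub>M coffin_borel) J (Pi\<^sub>E J A)"
    have E[measurable]: "E \<in> sets ?PM" unfolding E_def using J A by (intro sets_PiM_I) auto
    have Eiff: "x \<in> E \<longleftrightarrow> (\<forall>j\<in>J. x j \<in> A j)" for x
      by (auto simp: E_def prod_emb_def restrict_PiE_iff space_PiM space_pair_measure)
    \<comment> \<open>The joint law is stated for one sequence of pairs, so that a cylinder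
      restricts finitely many \<open>X n\<close> and \<open>S n\<close> at once; zipping connects it
      with the pair of sequences used in the recursion.\<close>
    define g :: "(nat \<Rightarrow> real) \<times> (nat \<Rightarrow> real option) \<Rightarrow> nat \<Rightarrow> real \<times> real option"
      where "g y = (\<lambda>n. (fst y n, snd y n))" for y
    have mg[measurable]: "g \<in> measurable ?H ?PM" unfolding g_def
      by (auto intro!: measurable_PiM_single' simp: space_pair_measure)
    define E2 where "E2 = g -` E \<inter> space ?H"
    have E2[measurable]: "E2 \<in> sets ?H" unfolding E2_def by (rule measurable_sets[OF mg E])
    have [simp]: "space ?H = UNIV" by (simp add: space_pair_measure space_PiM)
    have h: "K k z \<in> E2 \<longleftrightarrow> (\<lambda>n. (X n z, S n z)) \<in> E" for z
      using k by (auto simp: E2_def Eiff ohist_def g_def K_def subset_iff)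
    have h': "K' k S' z \<in> E2 \<longleftrightarrow> (\<lambda>n. (X' n (fst z), S' n z)) \<in> E" for z
      using k by (auto simp: E2_def Eiff ohist_def g_def K'_def subset_iff)
    have mK'S[measurable]: "K' k S' \<in> measurable (Q' \<Otimes>\<^sub>M noise) ?H" by (rule mK') (rule mS')
    have "emeasure ?D E = emeasure (distr Q ?H (K k)) E2"
      unfolding emeasure_distr[OF m(1) E] emeasure_distr[OF mK E2] by (simp add: vimage_def h)
    also have "\<dots> = emeasure ?D' E"
      unfolding lawk emeasure_distr[OF m(2) E] emeasure_distr[OF mK'S E2] by (simp add: vimage_def h')
    finally show "emeasure ?D (prod_emb UNIV (\<lambda>_. borel \<Otimes>\<^sub>M coffin_borel) J (Pi\<^sub>E J A)) = emeasure ?D' (prod_emb UNIV (\<lambda>_. borel \<Otimes>\<^sub>M coffin_borel) J (Pi\<^sub>E J A))"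
      unfolding E_def .
  qed auto
  with mS' that show thesis by blast
qed


text \<open>Two layers of noise are put on top of \<open>P'\<close>: the first enumerates the range
  of \<open>T'\<close> by a sequence distributed like an enumeration of the range of
  \<open>T\<close>, the second redraws \<open>S\<close> conditionally on this enumeration. The copy
  of \<open>S\<close> thus lives on an extension of \<open>P'\<close>, and pairing it with the
  original point of \<open>P'\<close> is the coupling.\<close>

theorem coupling_exists:
  assumes P: "prob_space P" "sample_like P T"
    and S: "\<And>i. S i \<in> measurable P coffin_borel" "AE z in P. seq_set (\<lambda>i. S i z) = range (\<lambda>i. T i z)"
    and P': "prob_space P'" "sample_like P' T'"
  obtains R where "is_coupling R (distr P cseqM (\<lambda>z i. S i z)) P'"
    "AE x in R. seq_set (fst x) = range (\<lambda>i. T' i (snd x))"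
proof -
  interpret P: prob_space P by fact
  interpret P': prob_space P' by fact
  interpret N: prob_space noise by (rule prob_space_noise)
  interpret PN: pair_prob_space P noise ..
  interpret PN': pair_prob_space P' noise ..
  interpret PNN': pair_prob_space "P' \<Otimes>\<^sub>M noise" noise ..
  obtain X X' where X: "\<And>n. X n \<in> borel_measurable (P \<Otimes>\<^sub>M noise)"
      "AE z in P \<Otimes>\<^sub>M noise. range (\<lambda>n. X n z) = range (\<lambda>i. T i (fst z))"
    and X': "\<And>n. X' n \<in> borel_measurable (P' \<Otimes>\<^sub>M noise)"
      "AE z in P' \<Otimes>\<^sub>M noise. range (\<lambda>n. X' n z) = range (\<lambda>i. T' i (fst z))"
    and law: "distr (P \<Otimes>\<^sub>M noise) seqM (\<lambda>z n. X n z) = distr (P' \<Otimes>\<^sub>M noise) seqM (\<lambda>z n. X' n z)"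
    by (rule back_and_forth[OF P P']) blast
  note X(1)[measurable] X'(1)[measurable] S(1)[measurable]
  have AEf: "AE z in A \<Otimes>\<^sub>M noise. \<Phi> (fst z)" if "AE z in A. \<Phi> z" for A :: "'z measure" and \<Phi>
  proof -
    from that have "AE z in distr (A \<Otimes>\<^sub>M noise) A fst. \<Phi> z" unfolding N.distr_pair_fst .
    from AE_distrD[OF _ this] show ?thesis by simp
  qed
  have AEf': "AE z in A \<Otimes>\<^sub>M noise. \<Phi> (fst z)" if "AE z in A. \<Phi> z" for A :: "'y measure" and \<Phi>
  proof -
    from that have "AE z in distr (A \<Otimes>\<^sub>M noise) A fst. \<Phi> z" unfolding N.distr_pair_fst .
    from AE_distrD[OF _ this] show ?thesis by simp
  qed
  have SX: "AE z in P \<Otimes>\<^sub>M noise. seq_set (\<lambda>i. S i (fst z)) = range (\<lambda>n. X n z)"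
    using AEf[OF S(2)] X(2) by eventually_elim simp
  then have sub: "AE z in P \<Otimes>\<^sub>M noise. \<forall>i. S i (fst z) = None \<or> (\<exists>n. S i (fst z) = Some (X n z))"
    by eventually_elim (simp add: seq_set_eq_range_iff)
  let ?PM = "PiM UNIV (\<lambda>_::nat. (borel :: real measure) \<Otimes>\<^sub>M coffin_borel)"
  have mS: "(\<lambda>z. S i (fst z)) \<in> measurable (P \<Otimes>\<^sub>M noise) coffin_borel" for i by measurable
  obtain S' where mS'[measurable]: "\<And>i. S' i \<in> measurable ((P' \<Otimes>\<^sub>M noise) \<Otimes>\<^sub>M noise) coffin_borel"
    and law2: "distr (P \<Otimes>\<^sub>M noise) ?PM (\<lambda>z n. (X n z, S n (fst z))) =
     distr ((P' \<Otimes>\<^sub>M noise) \<Otimes>\<^sub>M noise) ?PM (\<lambda>z n. (X' n (fst z), S' n z))"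
    by (rule transfer_enumeration[OF PN.prob_space_axioms X(1) mS sub PN'.prob_space_axioms X'(1) law]) blast
  have m1: "(\<lambda>z n. (X n z, S n (fst z))) \<in> measurable (P \<Otimes>\<^sub>M noise) ?PM"
    by (rule measurable_PiM_single') (auto simp: space_pair_measure)
  have m2: "(\<lambda>z n. (X' n (fst z), S' n z)) \<in> measurable ((P' \<Otimes>\<^sub>M noise) \<Otimes>\<^sub>M noise) ?PM"
    by (rule measurable_PiM_single') (auto simp: space_pair_measure)
  have mc1[measurable]: "(\<lambda>y. fst (y n)) \<in> borel_measurable ?PM" for n by measurable
  have mc2[measurable]: "(\<lambda>y. snd (y n)) \<in> measurable ?PM coffin_borel" for n by measurable
  have mp: "Measurable.pred ?PM (\<lambda>y. seq_set (\<lambda>i. snd (y i)) = range (\<lambda>n. fst (y n)))"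
    by (rule pred_seq_set_eq_range[OF mc2 mc1])
  \<comment> \<open>That the two sequences have the same set of values is a property of their joint
    law, so it passes to the copy.\<close>
  have "AE y in distr (P \<Otimes>\<^sub>M noise) ?PM (\<lambda>z n. (X n z, S n (fst z))). seq_set (\<lambda>i. snd (y i)) = range (\<lambda>n. fst (y n))"
    by (subst AE_distr_iff[OF m1]) (use mp SX in \<open>simp_all add: pred_def\<close>)
  then have "AE z in (P' \<Otimes>\<^sub>M noise) \<Otimes>\<^sub>M noise. seq_set (\<lambda>i. S' i z) = range (\<lambda>n. X' n (fst z))"
    unfolding law2 by (subst (asm) AE_distr_iff[OF m2]) (use mp in \<open>simp_all add: pred_def\<close>)
  moreover have "AE z in (P' \<Otimes>\<^sub>M noise) \<Otimes>\<^sub>M noise. range (\<lambda>n. X' n (fst z)) = range (\<lambda>i. T' i (fst (fst z)))"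
  proof -
    from X'(2) have "AE z in distr ((P' \<Otimes>\<^sub>M noise) \<Otimes>\<^sub>M noise) (P' \<Otimes>\<^sub>M noise) fst. range (\<lambda>n. X' n z) = range (\<lambda>i. T' i (fst z))"
      unfolding N.distr_pair_fst .
    from AE_distrD[OF _ this] show ?thesis by simp
  qed
  ultimately have S'T': "AE z in (P' \<Otimes>\<^sub>M noise) \<Otimes>\<^sub>M noise. seq_set (\<lambda>i. S' i z) = range (\<lambda>i. T' i (fst (fst z)))"
    by eventually_elim simp
  have lawS: "distr P cseqM (\<lambda>z i. S i z) = distr ((P' \<Otimes>\<^sub>M noise) \<Otimes>\<^sub>M noise) cseqM (\<lambda>z i. S' i z)"
  proof -
    have ms: "(\<lambda>y n. snd (y n)) \<in> measurable ?PM cseqM" by (rule measurable_PiM_single') auto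
    have mSP: "(\<lambda>z i. S i z) \<in> measurable P cseqM" by (rule measurable_PiM_single') auto
    have "distr P cseqM (\<lambda>z i. S i z) = distr (distr (P \<Otimes>\<^sub>M noise) P fst) cseqM (\<lambda>z i. S i z)"
      unfolding N.distr_pair_fst ..
    also have "\<dots> = distr (distr (P \<Otimes>\<^sub>M noise) ?PM (\<lambda>z n. (X n z, S n (fst z)))) cseqM (\<lambda>y n. snd (y n))"
      by (simp add: distr_distr[OF ms m1] distr_distr[OF mSP measurable_fst] comp_def)
    also have "\<dots> = distr ((P' \<Otimes>\<^sub>M noise) \<Otimes>\<^sub>M noise) cseqM (\<lambda>z i. S' i z)"
      unfolding law2 distr_distr[OF ms m2] by (simp add: comp_def)
    finally show ?thesis .
  qed
  define R where "R = distr ((P' \<Otimes>\<^sub>M noise) \<Otimes>\<^sub>M noise) (cseqM \<Otimes>\<^sub>M P') (\<lambda>z. (\<lambda>i. S' i z, fst (fst z)))"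
  have mS'': "(\<lambda>z i. S' i z) \<in> measurable ((P' \<Otimes>\<^sub>M noise) \<Otimes>\<^sub>M noise) cseqM" by (rule measurable_PiM_single') auto
  have mR: "(\<lambda>z. (\<lambda>i. S' i z, fst (fst z))) \<in> measurable ((P' \<Otimes>\<^sub>M noise) \<Otimes>\<^sub>M noise) (cseqM \<Otimes>\<^sub>M P')"
    by (intro measurable_Pair mS'') measurable
  have "is_coupling R (distr P cseqM (\<lambda>z i. S i z)) P'"
    unfolding is_coupling_def
  proof (intro conjI)
    show "prob_space R" unfolding R_def by (rule PNN'.prob_space_distr[OF mR])
    show "sets R = sets (distr P cseqM (\<lambda>z i. S i z) \<Otimes>\<^sub>M P')"
      unfolding R_def by (simp cong: sets_pair_measure_cong)
    have "distr R (distr P cseqM (\<lambda>z i. S i z)) fst = distr R cseqM fst"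
      by (rule distr_cong) auto
    also have "\<dots> = distr P cseqM (\<lambda>z i. S i z)"
      unfolding R_def lawS distr_distr[OF measurable_fst mR] by (simp add: comp_def)
    finally show "distr R (distr P cseqM (\<lambda>z i. S i z)) fst = distr P cseqM (\<lambda>z i. S i z)" .
    have "distr R P' snd = distr ((P' \<Otimes>\<^sub>M noise) \<Otimes>\<^sub>M noise) P' (fst \<circ> fst)"
      unfolding R_def distr_distr[OF measurable_snd mR] by (simp add: comp_def)
    also have "\<dots> = distr (distr ((P' \<Otimes>\<^sub>M noise) \<Otimes>\<^sub>M noise) (P' \<Otimes>\<^sub>M noise) fst) P' fst"
      by (rule distr_distr[symmetric]) measurable
    also have "\<dots> = P'" unfolding N.distr_pair_fst ..
    finally show "distr R P' snd = P'" .
  qed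
  moreover have "AE x in R. seq_set (fst x) = range (\<lambda>i. T' i (snd x))"
  proof -
    have [measurable]: "T' i \<in> borel_measurable P'" for i using P' by (simp add: sample_like_def)
    have mc: "(\<lambda>x. fst x i) \<in> measurable (cseqM \<Otimes>\<^sub>M P') coffin_borel"
      "(\<lambda>x. T' i (snd x)) \<in> borel_measurable (cseqM \<Otimes>\<^sub>M P')" for i by measurable
    show ?thesis
      unfolding R_def using S'T' pred_seq_set_eq_range[OF mc]
      by (subst AE_distr_iff[OF mR]) (simp_all add: pred_def)
  qed
  ultimately show thesis by (rule that)
qed

section \<open>Independent samples\<close>

definition pick :: "nat list \<Rightarrow> (nat \<Rightarrow> real) \<Rightarrow> nat \<Rightarrow> real" where
  "pick is t = (\<lambda>n. if n < length is then t (is ! n) else 0)"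

lemma pick_image: "pick is t ` {..<length is} = t ` set is"
proof -
  have "pick is t ` {..<length is} = (\<lambda>n. t (is ! n)) ` {..<length is}"
    by (intro image_cong) (auto simp: pick_def)
  also have "\<dots> = t ` set is" unfolding set_conv_nth by auto
  finally show ?thesis .
qed

lemma measurable_pick:
  assumes "\<And>i. (\<lambda>x. t x i) \<in> borel_measurable M"
  shows "(\<lambda>x. pick is (t x)) \<in> measurable M seqM"
  unfolding pick_def
proof (rule measurable_PiM_single')
  fix i show "(\<lambda>x. if i < length is then t x (is ! i) else 0) \<in> borel_measurable M"
    using assms by (cases "i < length is") auto
qed auto

text \<open>Deleting the finitely many already used points from a fibre does not change whether
  the fibre is null, so it suffices to find some point in every non-null fibre.\<close>

lemma sample_likeI:
  assumes T: "\<And>i. T i \<in> borel_measurable P"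
    and null: "\<And>is A j. A \<in> sets (seqM \<Otimes>\<^sub>M borel) \<Longrightarrow>
       AE \<omega> in P. emeasure lborel (Pair (pick is (\<lambda>i. T i \<omega>)) -` A) = 0 \<longrightarrow>
         T j \<omega> \<notin> (\<lambda>i. T i \<omega>) ` set is \<longrightarrow> (pick is (\<lambda>i. T i \<omega>), T j \<omega>) \<notin> A"
    and nonnull: "\<And>is A. A \<in> sets (seqM \<Otimes>\<^sub>M borel) \<Longrightarrow>
       AE \<omega> in P. emeasure lborel (Pair (pick is (\<lambda>i. T i \<omega>)) -` A) \<noteq> 0 \<longrightarrow>
         (\<exists>j. (pick is (\<lambda>i. T i \<omega>), T j \<omega>) \<in> A)"
  shows "sample_like P T"
  unfolding sample_like_def
proof (intro conjI allI ballI)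
  fix k and A :: "((nat \<Rightarrow> real) \<times> real) set" assume A: "A \<in> sets (seqM \<Otimes>\<^sub>M borel)"
  define A' where "A' = {x \<in> space (seqM \<Otimes>\<^sub>M borel). x \<in> A \<and> (\<forall>n<k. snd x \<noteq> fst x n)}"
  have A': "A' \<in> sets (seqM \<Otimes>\<^sub>M borel)"
  proof -
    have [measurable]: "(\<lambda>x. fst x n) \<in> borel_measurable (seqM \<Otimes>\<^sub>M (borel :: real measure))" for n
      by (rule measurable_compose[OF measurable_fst]) simp
    have "Measurable.pred (seqM \<Otimes>\<^sub>M borel) (\<lambda>x. \<forall>n<k. snd x \<noteq> fst x n)" by measurable
    moreover have "{x \<in> space (seqM \<Otimes>\<^sub>M (borel :: real measure)). x \<in> A} = A"
      using sets.sets_into_space[OF A] by blast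
    then have "Measurable.pred (seqM \<Otimes>\<^sub>M borel) (\<lambda>x. x \<in> A)" unfolding pred_def using A by (rule ssubst)
    ultimately have "Measurable.pred (seqM \<Otimes>\<^sub>M borel) (\<lambda>x. x \<in> A \<and> (\<forall>n<k. snd x \<noteq> fst x n))"
      by (intro pred_intros_logic)
    then show ?thesis unfolding A'_def pred_def .
  qed
  have A'iff: "x \<in> A' \<longleftrightarrow> x \<in> A \<and> snd x \<notin> fst x ` {..<k}" for x
    by (auto simp: A'_def space_pair_measure space_PiM)
  have em: "emeasure lborel (Pair h -` A) = emeasure lborel (Pair h -` A')" for h
  proof (rule emeasure_eq_AE)
    have "AE y in lborel. y \<notin> h ` {..<k}"
      by (rule AE_not_in) (auto intro: finite_imp_null_set_lborel)
    then show "AE y in lborel. y \<in> Pair h -` A \<longleftrightarrow> y \<in> Pair h -` A'"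
      by eventually_elim (auto simp: A'iff)
  qed (use sets_Pair1[OF A, of h] sets_Pair1[OF A', of h] in auto)
  have "AE \<omega> in P. \<forall>is j. emeasure lborel (Pair (pick is (\<lambda>i. T i \<omega>)) -` A) = 0 \<longrightarrow>
         T j \<omega> \<notin> (\<lambda>i. T i \<omega>) ` set is \<longrightarrow> (pick is (\<lambda>i. T i \<omega>), T j \<omega>) \<notin> A"
    unfolding AE_all_countable by (intro allI null A)
  moreover have "AE \<omega> in P. \<forall>is. emeasure lborel (Pair (pick is (\<lambda>i. T i \<omega>)) -` A') \<noteq> 0 \<longrightarrow>
         (\<exists>j. (pick is (\<lambda>i. T i \<omega>), T j \<omega>) \<in> A')"
    unfolding AE_all_countable by (intro allI nonnull A')
  ultimately show "AE \<omega> in P. \<forall>h. (\<forall>n<k. h n \<in> range (\<lambda>i. T i \<omega>)) \<and> (\<forall>n\<ge>k. h n = 0) \<longrightarrow>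
       (emeasure lborel (Pair h -` A) = 0 \<longrightarrow> (\<forall>j. T j \<omega> \<notin> h ` {..<k} \<longrightarrow> (h, T j \<omega>) \<notin> A)) \<and>
       (emeasure lborel (Pair h -` A) \<noteq> 0 \<longrightarrow> (\<exists>j. T j \<omega> \<notin> h ` {..<k} \<and> (h, T j \<omega>) \<in> A))"
  proof eventually_elim
    case (elim \<omega>)
    show ?case
    proof (intro allI impI)
      fix h :: "nat \<Rightarrow> real" assume h: "(\<forall>n<k. h n \<in> range (\<lambda>i. T i \<omega>)) \<and> (\<forall>n\<ge>k. h n = 0)"
      then have "\<forall>n<k. \<exists>i. h n = T i \<omega>" by blast
      then obtain f where f: "\<And>n. n < k \<Longrightarrow> h n = T (f n) \<omega>" by metis
      define "is" where "is = map f [0..<k]"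
      have hp: "h = pick is (\<lambda>i. T i \<omega>)"
      proof
        fix n
        have "h n = 0" if "\<not> n < k" using h that by auto
        then show "h n = pick is (\<lambda>i. T i \<omega>) n"
          using f[of n] by (cases "n < k") (simp_all add: is_def pick_def)
      qed
      have img: "(\<lambda>i. T i \<omega>) ` set is = h ` {..<k}"
        using pick_image[of "is" "\<lambda>i. T i \<omega>"] unfolding hp[symmetric] by (simp add: is_def)
      show "(emeasure lborel (Pair h -` A) = 0 \<longrightarrow> (\<forall>j. T j \<omega> \<notin> h ` {..<k} \<longrightarrow> (h, T j \<omega>) \<notin> A)) \<and>
       (emeasure lborel (Pair h -` A) \<noteq> 0 \<longrightarrow> (\<exists>j. T j \<omega> \<notin> h ` {..<k} \<and> (h, T j \<omega>) \<in> A))"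
      proof (intro conjI impI allI)
        fix j assume "emeasure lborel (Pair h -` A) = 0" "T j \<omega> \<notin> h ` {..<k}"
        then show "(h, T j \<omega>) \<notin> A" using spec[OF spec[OF elim(1), of "is"], of j, folded hp] by (simp only: img simp_thms)
      next
        assume "emeasure lborel (Pair h -` A) \<noteq> 0"
        then have "emeasure lborel (Pair h -` A') \<noteq> 0" by (simp add: em)
        then obtain j where "(h, T j \<omega>) \<in> A'" using spec[OF elim(2), of "is", folded hp] by blast
        then show "\<exists>j. T j \<omega> \<notin> h ` {..<k} \<and> (h, T j \<omega>) \<in> A" by (auto simp: A'iff)
      qed
    qed
  qed
qed (rule T)

text \<open>An entry whose index is not in the list can be redrawn independently of the picked
  values, so it avoids null fibres. Infinitely many such entries remain, and \<open>k\<close> of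
  them all miss a fibre of \<open>L\<close>-measure at least \<open>e\<close> with probability at
  most \<open>(1 - e) ^ k\<close>.\<close>

lemma sample_like_iid:
  fixes L :: "real measure"
  assumes L: "prob_space L" "sets L = sets borel"
    and ac: "absolutely_continuous lborel L" "absolutely_continuous L lborel"
  shows "sample_like (PiM UNIV (\<lambda>_::nat. L)) (\<lambda>i x. x i)"
proof (rule sample_likeI)
  interpret L: prob_space L by fact
  note L(2)[measurable_cong, simp]
  have spL[simp]: "space L = UNIV" using sets_eq_imp_space_eq[OF L(2)] by simp
  let ?P = "PiM (UNIV :: nat set) (\<lambda>_. L)"
  interpret P: prob_space ?P by (rule prob_space_PiM) (rule L)
  have sP[measurable_cong]: "sets ?P = sets seqM" by (rule sets_PiM_cong) (simp_all add: L)
  show "(\<lambda>x. x i) \<in> borel_measurable ?P" for i by measurable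
  fix "is" :: "nat list" and A :: "((nat \<Rightarrow> real) \<times> real) set"
  assume A[measurable]: "A \<in> sets (seqM \<Otimes>\<^sub>M borel)"
  have p[measurable]: "pick is \<in> measurable ?P seqM"
    using measurable_pick[of "\<lambda>x. x" ?P "is"] by simp
  have eA: "(\<lambda>y. emeasure lborel (Pair y -` A)) \<in> borel_measurable seqM"
    by (rule lborel.measurable_emeasure_Pair) simp
  have LA: "(\<lambda>y. emeasure L (Pair y -` A)) \<in> borel_measurable seqM"
    by (rule L.measurable_emeasure_Pair) (use A sets_pair_measure_cong[OF refl L(2), of seqM] in metis)
  note [measurable] = measurable_compose[OF p eA] measurable_compose[OF p LA]
  \<comment> \<open>Equivalence of \<open>L\<close> and Lebesgue measure: from here on null fibres
    may be measured by \<open>L\<close>.\<close>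
  have LA0: "emeasure lborel (Pair h -` A) = 0 \<longleftrightarrow> emeasure L (Pair h -` A) = 0" for h
  proof -
    have s: "Pair h -` A \<in> sets borel" using sets_Pair1[OF A, of h] .
    have "Pair h -` A \<in> null_sets lborel \<longleftrightarrow> Pair h -` A \<in> null_sets L"
      using ac unfolding absolutely_continuous_def by blast
    then show ?thesis unfolding null_sets_def using s L(2) by simp
  qed
  have upd: "pick is (x(j := r)) = pick is x" if "j \<notin> set is" for j x r
    using that by (auto simp: pick_def fun_eq_iff)
  have int_A: "(\<integral>\<^sup>+r. indicator A (h, r) \<partial>L) = emeasure L (Pair h -` A)" for h
    using nn_integral_indicator[of "Pair h -` A" L] sets_Pair1[OF A, of h] by (simp add: indicator_def)
  { fix j
    show "AE x in ?P. emeasure lborel (Pair (pick is (\<lambda>i. x i)) -` A) = 0 \<longrightarrow>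
         x j \<notin> (\<lambda>i. x i) ` set is \<longrightarrow> (pick is (\<lambda>i. x i), x j) \<notin> A"
    proof (cases "j \<in> set is")
      case False
      let ?f = "\<lambda>x. indicator {y. emeasure L (Pair y -` A) = 0} (pick is x) * indicator A (pick is x, x j) :: ennreal"
      have "(\<integral>\<^sup>+x. ?f x \<partial>?P) = (\<integral>\<^sup>+x. \<integral>\<^sup>+r. ?f (x(j := r)) \<partial>L \<partial>?P)"
        by (rule nn_integral_PiM_upd[OF L]) measurable
      also have "\<dots> = (\<integral>\<^sup>+x. 0 \<partial>?P)"
        using False by (intro nn_integral_cong) (auto simp: upd indicator_def[of "{y. _ y}"] int_A)
      finally have "(\<integral>\<^sup>+x. ?f x \<partial>?P) = 0" by simp
      moreover have "?f \<in> borel_measurable ?P" by measurable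
      ultimately have "AE x in ?P. ?f x = 0" by (simp only: nn_integral_0_iff_AE)
      then show ?thesis by eventually_elim (auto simp: LA0 indicator_def split: if_splits)
    qed auto }
  \<comment> \<open>\<open>Suc (sum_list is)\<close> exceeds every member of the list, so all
    indices from \<open>N\<close> on are unrelated to the picked values.\<close>
  define N where "N = Suc (sum_list is)"
  have N: "j \<notin> set is" if "N \<le> j" for j
    using that member_le_sum_list[of j "is"] by (auto simp: N_def)
  \<comment> \<open>The measure of the random fibre has no uniform positive lower bound, so
    countably many thresholds are treated separately.\<close>
  have "AE x in ?P. ennreal (1 / real (Suc m)) \<le> emeasure L (Pair (pick is x) -` A) \<longrightarrow> (\<exists>j. (pick is x, x j) \<in> A)" for m
  proof -
    define e where "e = 1 / real (Suc m)"
    have e: "0 < e" "e \<le> 1" by (auto simp: e_def)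
    define f :: "nat \<Rightarrow> (nat \<Rightarrow> real) \<Rightarrow> ennreal" where "f k x = indicator {y. ennreal e \<le> emeasure L (Pair y -` A)} (pick is x) *
        (\<Prod>j<k. indicator (- A) (pick is x, x (N + j)))" for k x
    have mA[measurable]: "- A \<in> sets (seqM \<Otimes>\<^sub>M borel)"
      using sets.compl_sets[OF A] by (simp add: Compl_eq_Diff_UNIV space_pair_measure space_PiM)
    have [measurable]: "f k \<in> borel_measurable ?P" for k unfolding f_def by measurable
    have bound: "(\<integral>\<^sup>+x. f k x \<partial>?P) \<le> ennreal ((1 - e) ^ k)" for k
    proof (induction k)
      case 0
      have "(\<integral>\<^sup>+x. f 0 x \<partial>?P) \<le> (\<integral>\<^sup>+x. 1 \<partial>?P)" by (intro nn_integral_mono) (auto simp: f_def indicator_def)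
      then show ?case by (simp add: P.emeasure_space_1)
    next
      case (Suc k)
      have "(\<integral>\<^sup>+x. f (Suc k) x \<partial>?P) = (\<integral>\<^sup>+x. \<integral>\<^sup>+r. f (Suc k) (x(N + k := r)) \<partial>L \<partial>?P)"
        by (rule nn_integral_PiM_upd[OF L]) measurable
      also have "\<dots> = (\<integral>\<^sup>+x. f k x * emeasure L (- (Pair (pick is x) -` A)) \<partial>?P)"
      proof (rule nn_integral_cong)
        fix x
        have "f (Suc k) (x(N + k := r)) = f k x * indicator (- (Pair (pick is x) -` A)) r" for r
          by (auto simp: f_def upd[OF N] mult.assoc indicator_def intro!: prod.cong)
        moreover have "- (Pair (pick is x) -` A) \<in> sets L"
          using sets.compl_sets[of "Pair (pick is x) -` A" L] sets_Pair1[OF A, of "pick is x"] by (simp add: Compl_eq_Diff_UNIV)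
        ultimately show "(\<integral>\<^sup>+r. f (Suc k) (x(N + k := r)) \<partial>L) = f k x * emeasure L (- (Pair (pick is x) -` A))"
          by (simp add: nn_integral_cmult_indicator)
      qed
      also have "\<dots> \<le> (\<integral>\<^sup>+x. ennreal (1 - e) * f k x \<partial>?P)"
      proof (rule nn_integral_mono)
        fix x
        have "emeasure L (- (Pair (pick is x) -` A)) \<le> ennreal (1 - e)" if "ennreal e \<le> emeasure L (Pair (pick is x) -` A)"
        proof -
          have s: "Pair (pick is x) -` A \<in> sets L" using sets_Pair1[OF A, of "pick is x"] by simp
          have "measure L (- (Pair (pick is x) -` A)) = 1 - measure L (Pair (pick is x) -` A)"
            using L.prob_compl[OF s] by (simp add: Compl_eq_Diff_UNIV)
          with that e show ?thesis by (auto simp: L.emeasure_eq_measure)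
        qed
        then show "f k x * emeasure L (- (Pair (pick is x) -` A)) \<le> ennreal (1 - e) * f k x"
          by (cases "ennreal e \<le> emeasure L (Pair (pick is x) -` A)")
             (auto simp: f_def mult.commute intro!: mult_mono)
      qed
      also have "\<dots> = ennreal (1 - e) * (\<integral>\<^sup>+x. f k x \<partial>?P)" by (rule nn_integral_cmult) measurable
      also have "\<dots> \<le> ennreal (1 - e) * ennreal ((1 - e) ^ k)" by (intro mult_mono Suc) auto
      finally show ?case using e by (simp add: ennreal_mult[symmetric])
    qed
    define B where "B = {x \<in> space ?P. ennreal e \<le> emeasure L (Pair (pick is x) -` A) \<and> (\<forall>j. (pick is x, x j) \<notin> A)}"
    have B[measurable]: "B \<in> sets ?P" unfolding B_def by measurable
    have "emeasure ?P B \<le> ennreal ((1 - e) ^ k)" for k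
    proof -
      have "emeasure ?P B = (\<integral>\<^sup>+x. indicator B x \<partial>?P)" by simp
      also have "\<dots> \<le> (\<integral>\<^sup>+x. f k x \<partial>?P)"
        by (intro nn_integral_mono) (auto simp: B_def f_def indicator_def)
      finally show ?thesis using bound[of k] by simp
    qed
    moreover have "(\<lambda>k. ennreal ((1 - e) ^ k)) \<longlonglongrightarrow> ennreal 0"
      using e by (intro tendsto_ennrealI LIMSEQ_realpow_zero) auto
    ultimately have "emeasure ?P B = 0"
      using LIMSEQ_le_const[of "\<lambda>k. ennreal ((1 - e) ^ k)" 0 "emeasure ?P B"] by auto
    then have "AE x in ?P. x \<notin> B" by (intro AE_not_in null_setsI B)
    then show ?thesis using AE_space by eventually_elim (auto simp: B_def e_def)
  qed
  then have "AE x in ?P. \<forall>m. ennreal (1 / real (Suc m)) \<le> emeasure L (Pair (pick is x) -` A) \<longrightarrow> (\<exists>j. (pick is x, x j) \<in> A)"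
    unfolding AE_all_countable by blast
  then show "AE x in ?P. emeasure lborel (Pair (pick is (\<lambda>i. x i)) -` A) \<noteq> 0 \<longrightarrow>
         (\<exists>j. (pick is (\<lambda>i. x i), x j) \<in> A)"
  proof eventually_elim
    case (elim x)
    show ?case
    proof
      assume "emeasure lborel (Pair (pick is (\<lambda>i. x i)) -` A) \<noteq> 0"
      then have "0 < measure L (Pair (pick is x) -` A)" by (simp add: LA0 L.emeasure_eq_measure zero_less_measure_iff)
      then obtain m where "1 / real (Suc m) < measure L (Pair (pick is x) -` A)"
        using reals_Archimedean[of "measure L (Pair (pick is x) -` A)"] by (auto simp: inverse_eq_divide)
      then have "ennreal (1 / real (Suc m)) \<le> emeasure L (Pair (pick is x) -` A)" by (simp add: L.emeasure_eq_measure)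
      with elim show "\<exists>j. (pick is (\<lambda>i. x i), x j) \<in> A" by blast
    qed
  qed
qed

section \<open>Independence of the increment fields\<close>

text \<open>The dyadic intervals of level \<open>n\<close> partition the line and have 0 as an
  endpoint, so on either side of 0 these are, up to sign, consecutive increments of one of the two
  Brownian motions.\<close>

definition dyadic_inc :: "nat \<Rightarrow> int \<Rightarrow> (real \<Rightarrow> real) \<Rightarrow> real" where
  "dyadic_inc n j \<omega> = \<omega> ((of_int j + 1) / 2 ^ n) - \<omega> (of_int j / 2 ^ n)"

text \<open>Independence of consecutive increments comes as a sequence starting at time 0;
  \<open>h\<close> renames its positions by the integer indices of the intervals, of which
  \<open>J\<close> may omit some.\<close>

lemma (in prob_space) prob_Inter_reindexed:
  fixes D :: "int \<Rightarrow> 'a \<Rightarrow> real"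
  assumes ind: "indep_vars (\<lambda>_. borel) (\<lambda>i. D (h i)) {..<N::nat}" and h: "inj_on h {..<N}"
    and J: "J \<subseteq> h ` {..<N}" and A: "\<And>j. j \<in> J \<Longrightarrow> A j \<in> sets borel"
  shows "prob {x \<in> space M. \<forall>j\<in>J. D j x \<in> A j} = (\<Prod>j\<in>J. prob (D j -` A j \<inter> space M))"
proof (cases "J = {}")
  case False
  define I where "I = {i. i < N \<and> h i \<in> J}"
  have I: "J = h ` I" "I \<subseteq> {..<N}" "finite I" using J by (auto simp: I_def)
  have inj: "inj_on h I" using h I(2) by (rule inj_on_subset)
  have "{x \<in> space M. \<forall>j\<in>J. D j x \<in> A j} = (\<Inter>i\<in>I. D (h i) -` A (h i) \<inter> space M)"
    using False unfolding I(1) by auto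
  also have "prob \<dots> = (\<Prod>i\<in>I. prob (D (h i) -` A (h i) \<inter> space M))"
    using False I A by (intro indep_varsD[OF ind]) auto
  also have "\<dots> = (\<Prod>j\<in>J. prob (D j -` A j \<inter> space M))"
    unfolding I(1) by (simp add: prod.reindex[OF inj] comp_def)
  finally show ?thesis .
qed (simp add: prob_space)

text \<open>A finite set of indices splits into nonnegative and negative ones. Each part factorises
  by the independent increments of its own half, and the two parts factorise against each other
  because they are events of the two independent half-line paths.\<close>

lemma dyadic_inc_indep:
  assumes P: "prob_space P" "space P = Omega0"
    and pos: "standard_brownian_motion P (\<lambda>t \<omega>. \<omega> t)"
    and neg: "standard_brownian_motion P (\<lambda>t \<omega>. \<omega> (- t))"
    and ind: "prob_space.indep_var P
       (PiM {0..} (\<lambda>_. borel)) (\<lambda>\<omega>. \<lambda>t\<in>{0..}. \<omega> t)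
       (PiM {0..} (\<lambda>_. borel)) (\<lambda>\<omega>. \<lambda>t\<in>{0..}. \<omega> (- t))"
  shows "prob_space.indep_vars P (\<lambda>_. borel) (dyadic_inc n) UNIV"
proof -
  interpret P: prob_space P by fact
  define \<tau> where "\<tau> i = real i / 2 ^ n" for i
  have \<tau>: "0 \<le> \<tau> 0" "strict_mono_on {..N} \<tau>" for N
    by (auto simp: \<tau>_def strict_mono_on_def divide_strict_right_mono)
  define hp where "hp i = int i" for i
  \<comment> \<open>Step \<open>i\<close> of the reversed path traverses the interval with index
    \<open>- i - 1\<close> backwards, hence the change of sign in \<open>indn\<close>.\<close>
  define hn where "hn i = - int i - 1" for i
  have indp: "P.indep_vars (\<lambda>_. borel) (\<lambda>i. dyadic_inc n (hp i)) {..<N}" for N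
  proof -
    have "P.indep_vars (\<lambda>_. borel) (\<lambda>i \<omega>. \<omega> (\<tau> (Suc i)) - \<omega> (\<tau> i)) {..<N}"
      using pos \<tau> unfolding standard_brownian_motion_def by blast
    moreover have "(\<lambda>\<omega>. \<omega> (\<tau> (Suc i)) - \<omega> (\<tau> i)) = dyadic_inc n (hp i)" for i
      by (auto simp: dyadic_inc_def \<tau>_def hp_def add.commute)
    ultimately show ?thesis by simp
  qed
  have indn: "P.indep_vars (\<lambda>_. borel) (\<lambda>i. dyadic_inc n (hn i)) {..<N}" for N
  proof -
    have "P.indep_vars (\<lambda>_. borel) (\<lambda>i \<omega>. \<omega> (- \<tau> (Suc i)) - \<omega> (- \<tau> i)) {..<N}"
      using neg \<tau> unfolding standard_brownian_motion_def by blast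
    then have "P.indep_vars (\<lambda>_. borel) (\<lambda>i \<omega>. - (\<omega> (- \<tau> (Suc i)) - \<omega> (- \<tau> i))) {..<N}"
      by (rule P.indep_vars_compose2) simp
    moreover have "(\<lambda>\<omega>. - (\<omega> (- \<tau> (Suc i)) - \<omega> (- \<tau> i))) = dyadic_inc n (hn i)" for i
    proof -
      have "- \<tau> (Suc i) = of_int (hn i) / 2 ^ n" "- \<tau> i = (of_int (hn i) + 1) / 2 ^ n"
        by (auto simp: \<tau>_def hn_def field_simps)
      then show ?thesis by (simp add: dyadic_inc_def fun_eq_iff)
    qed
    ultimately show ?thesis by simp
  qed
  have rv: "dyadic_inc n j \<in> borel_measurable P" for j
  proof (cases "0 \<le> j")
    case True
    then show ?thesis using indp[of "Suc (nat j)"] unfolding P.indep_vars_def2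
      by (auto simp: hp_def dest!: bspec[of _ _ "nat j"])
  next
    case False
    then show ?thesis using indn[of "Suc (nat (- j - 1))"] unfolding P.indep_vars_def2
      by (auto simp: hn_def dest!: bspec[of _ _ "nat (- j - 1)"])
  qed
  show ?thesis unfolding P.indep_vars_def2
  proof (intro conjI ballI rv P.indep_setsI)
    fix j show "{dyadic_inc n j -` A \<inter> space P |A. A \<in> sets borel} \<subseteq> P.events"
      using measurable_sets[OF rv] by auto
  next
    fix J :: "int set" and X assume J: "J \<noteq> {}" "finite J"
      and X: "\<forall>j\<in>J. X j \<in> {dyadic_inc n j -` A \<inter> space P |A. A \<in> sets borel}"
    then have "\<forall>j\<in>J. \<exists>A. X j = dyadic_inc n j -` A \<inter> space P \<and> A \<in> sets borel" by auto
    then obtain A where A: "\<And>j. j \<in> J \<Longrightarrow> X j = dyadic_inc n j -` A j \<inter> space P" "\<And>j. j \<in> J \<Longrightarrow> A j \<in> sets borel"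
      by metis
    define Jp where "Jp = {j \<in> J. 0 \<le> j}"
    define Jn where "Jn = {j \<in> J. j < 0}"
    have JJ: "J = Jp \<union> Jn" "Jp \<inter> Jn = {}" "finite Jp" "finite Jn" using J by (auto simp: Jp_def Jn_def)
    obtain N where N: "\<And>j. j \<in> J \<Longrightarrow> \<bar>j\<bar> < int N"
    proof -
      obtain M where "\<forall>x\<in>(\<lambda>j. nat \<bar>j\<bar>) ` J. x < M"
        using finite_nat_bounded[of "(\<lambda>j. nat \<bar>j\<bar>) ` J"] J by (auto simp: subset_eq)
      then have "\<bar>j\<bar> < int M" if "j \<in> J" for j using that by fastforce
      with that show thesis by blast
    qed
    have Jp: "Jp \<subseteq> hp ` {..<N}"
    proof
      fix j assume "j \<in> Jp" then have "j = hp (nat j)" "nat j < N" using N[of j] by (auto simp: hp_def Jp_def)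
      then show "j \<in> hp ` {..<N}" by blast
    qed
    have Jn: "Jn \<subseteq> hn ` {..<N}"
    proof
      fix j assume "j \<in> Jn" then have "j = hn (nat (- j - 1))" "nat (- j - 1) < N" using N[of j] by (auto simp: hn_def Jn_def)
      then show "j \<in> hn ` {..<N}" by blast
    qed
    have pp: "P.prob {\<omega> \<in> space P. \<forall>j\<in>Jp. dyadic_inc n j \<omega> \<in> A j} = (\<Prod>j\<in>Jp. P.prob (X j))"
      using P.prob_Inter_reindexed[OF indp _ Jp, of A] A by (simp add: hp_def inj_on_def Jp_def)
    have pn: "P.prob {\<omega> \<in> space P. \<forall>j\<in>Jn. dyadic_inc n j \<omega> \<in> A j} = (\<Prod>j\<in>Jn. P.prob (X j))"
      using P.prob_Inter_reindexed[OF indn _ Jn, of A] A by (simp add: hn_def inj_on_def Jn_def)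
    \<comment> \<open>Both events are rewritten as sets of paths on \<open>{0..}\<close>, the form
      in which the independence of the halves is given. For negative indices the times are negated;
      the right end of the interval with index -1 becomes 0.\<close>
    let ?H = "PiM {0::real..} (\<lambda>_. borel :: real measure)"
    define Bp where "Bp = {f \<in> space ?H. \<forall>j\<in>Jp. f ((of_int j + 1) / 2 ^ n) - f (of_int j / 2 ^ n) \<in> A j}"
    define Bn where "Bn = {f \<in> space ?H. \<forall>j\<in>Jn. f (- ((of_int j + 1) / 2 ^ n)) - f (- (of_int j / 2 ^ n)) \<in> A j}"
    have Bp: "Bp \<in> sets ?H" unfolding Bp_def
    proof (rule sets.sets_Collect_finite_All)
      fix j assume j: "j \<in> Jp"
      have [measurable]: "A j \<in> sets borel" using A j by (auto simp: Jp_def)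
      have [measurable]: "(\<lambda>f. f ((of_int j + 1) / 2 ^ n)) \<in> borel_measurable ?H" "(\<lambda>f. f (of_int j / 2 ^ n)) \<in> borel_measurable ?H"
        using j by (auto simp: Jp_def intro!: measurable_component_singleton)
      show "{f \<in> space ?H. f ((of_int j + 1) / 2 ^ n) - f (of_int j / 2 ^ n) \<in> A j} \<in> sets ?H" by measurable
    qed (fact JJ)
    have Bn: "Bn \<in> sets ?H" unfolding Bn_def
    proof (rule sets.sets_Collect_finite_All)
      fix j assume j: "j \<in> Jn"
      have [measurable]: "A j \<in> sets borel" using A j by (auto simp: Jn_def)
      have "0 \<le> - ((of_int j + 1) / 2 ^ n :: real)" "0 \<le> - (of_int j / 2 ^ n :: real)"
        using j by (auto simp: Jn_def divide_simps)
      then have [measurable]: "(\<lambda>f. f (- ((of_int j + 1) / 2 ^ n))) \<in> borel_measurable ?H" "(\<lambda>f. f (- (of_int j / 2 ^ n))) \<in> borel_measurable ?H"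
        by (auto intro!: measurable_component_singleton)
      show "{f \<in> space ?H. f (- ((of_int j + 1) / 2 ^ n)) - f (- (of_int j / 2 ^ n)) \<in> A j} \<in> sets ?H" by measurable
    qed (fact JJ)
    have Xp: "(\<lambda>\<omega>. \<lambda>t\<in>{0..}. \<omega> t) -` Bp \<inter> space P = {\<omega> \<in> space P. \<forall>j\<in>Jp. dyadic_inc n j \<omega> \<in> A j}"
      by (auto simp: Bp_def Jp_def dyadic_inc_def space_PiM)
    have Xn: "(\<lambda>\<omega>. \<lambda>t\<in>{0..}. \<omega> (- t)) -` Bn \<inter> space P = {\<omega> \<in> space P. \<forall>j\<in>Jn. dyadic_inc n j \<omega> \<in> A j}"
    proof -
      have "0 \<le> - ((of_int j + 1) / 2 ^ n :: real)" "0 \<le> - (of_int j / 2 ^ n :: real)" if "j \<in> Jn" for j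
        using that by (auto simp: Jn_def divide_simps)
      then show ?thesis by (auto simp: Bn_def dyadic_inc_def space_PiM)
    qed
    have "(\<Inter>j\<in>J. X j) = (\<lambda>\<omega>. (\<lambda>t\<in>{0..}. \<omega> t, \<lambda>t\<in>{0..}. \<omega> (- t))) -` (Bp \<times> Bn) \<inter> space P"
    proof -
      have "(\<Inter>j\<in>J. X j) = {\<omega> \<in> space P. \<forall>j\<in>Jp. dyadic_inc n j \<omega> \<in> A j} \<inter> {\<omega> \<in> space P. \<forall>j\<in>Jn. dyadic_inc n j \<omega> \<in> A j}"
        using J A JJ(1) by auto
      then show ?thesis unfolding Xp[symmetric] Xn[symmetric] by auto
    qed
    also have "P.prob \<dots> = (\<Prod>j\<in>Jp. P.prob (X j)) * (\<Prod>j\<in>Jn. P.prob (X j))"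
      unfolding P.indep_varD[OF ind Bp Bn] Xp Xn pp pn ..
    also have "\<dots> = (\<Prod>j\<in>J. P.prob (X j))" unfolding JJ(1) using JJ by (simp add: prod.union_disjoint)
    finally show "P.prob (\<Inter>j\<in>J. X j) = (\<Prod>j\<in>J. P.prob (X j))" .
  qed
qed

lemma sum_dyadic_inc:
  assumes "p \<le> q"
  shows "(\<Sum>j\<in>{p..<q}. dyadic_inc n j \<omega>) = \<omega> (of_int q / 2 ^ n) - \<omega> (of_int p / 2 ^ n)"
  using assms
proof (induction q rule: int_ge_induct)
  case (step q)
  have "{p..<q + 1} = insert q {p..<q}" using step(1) by auto
  then show ?case using step(2) by (simp add: dyadic_inc_def)
qed simp

lemma dyadic_floor_tendsto:
  "(\<lambda>k. of_int \<lfloor>2 ^ (m + k) * u\<rfloor> / 2 ^ (m + k) :: real) \<longlonglongrightarrow> u"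
proof (rule real_tendsto_sandwich)
  show "\<forall>\<^sub>F k in sequentially. of_int \<lfloor>2 ^ (m + k) * u\<rfloor> / 2 ^ (m + k) \<le> u"
    by (intro always_eventually allI) (simp add: divide_le_eq mult.commute)
  show "\<forall>\<^sub>F k in sequentially. u - 1 / 2 ^ (m + k) \<le> of_int \<lfloor>2 ^ (m + k) * u\<rfloor> / 2 ^ (m + k)"
  proof (intro always_eventually allI)
    fix k
    have "2 ^ (m + k) * u - 1 \<le> of_int \<lfloor>2 ^ (m + k) * u\<rfloor>" by linarith
    then have "(2 ^ (m + k) * u - 1) / 2 ^ (m + k) \<le> of_int \<lfloor>2 ^ (m + k) * u\<rfloor> / 2 ^ (m + k)"
      by (rule divide_right_mono) simp
    then show "u - 1 / 2 ^ (m + k) \<le> of_int \<lfloor>2 ^ (m + k) * u\<rfloor> / 2 ^ (m + k)"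
      by (simp add: diff_divide_distrib)
  qed
  have "(\<lambda>k. (1 / 2) ^ (k + m) :: real) \<longlonglongrightarrow> 0"
    by (rule LIMSEQ_ignore_initial_segment) (rule LIMSEQ_power_zero, simp)
  then have "(\<lambda>k. 1 / 2 ^ (m + k) :: real) \<longlonglongrightarrow> 0"
    by (simp add: power_one_over add.commute)
  from tendsto_diff[OF tendsto_const this, of u] show "(\<lambda>k. u - 1 / 2 ^ (m + k)) \<longlonglongrightarrow> u" by simp
qed simp

section \<open>Sigma-fields generated by dyadic increments\<close>

definition dyadic_field :: "nat \<Rightarrow> int set \<Rightarrow> (real \<Rightarrow> real) measure" where
  "dyadic_field n K = sigma Omega0 (\<Union>j\<in>K. {dyadic_inc n j -` A \<inter> Omega0 | A. A \<in> sets borel})"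

lemma space_dyadic_field[simp]: "space (dyadic_field n K) = Omega0"
  unfolding dyadic_field_def by (rule space_measure_of) auto

lemma sets_dyadic_field:
  "sets (dyadic_field n K) = sigma_sets Omega0 (\<Union>j\<in>K. {dyadic_inc n j -` A \<inter> Omega0 | A. A \<in> sets borel})"
  unfolding dyadic_field_def by (rule sets_measure_of) auto

lemma measurable_dyadic_inc: "j \<in> K \<Longrightarrow> dyadic_inc n j \<in> borel_measurable (dyadic_field n K)"
  by (rule measurableI) (auto simp: sets_dyadic_field intro!: sigma_sets.Basic)

text \<open>An increment is the sum of those over the two halves of its interval, which have indices
  \<open>2 * j\<close> and \<open>2 * j + 1\<close> at the next level.\<close>

lemma dyadic_field_refine:
  assumes "\<And>j. j \<in> K \<Longrightarrow> 2 * j \<in> K' \<and> 2 * j + 1 \<in> K'"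
  shows "sets (dyadic_field n K) \<subseteq> sets (dyadic_field (Suc n) K')"
  unfolding sets_dyadic_field[of n]
proof (rule sets.sigma_sets_subset', safe)
  fix j and A :: "real set" assume j: "j \<in> K" and A: "A \<in> sets borel"
  have "dyadic_inc n j \<omega> = dyadic_inc (Suc n) (2 * j) \<omega> + dyadic_inc (Suc n) (2 * j + 1) \<omega>" for \<omega>
  proof -
    have "(of_int (2 * j) :: real) / 2 ^ Suc n = of_int j / 2 ^ n"
      "(of_int (2 * j + 1) + 1 :: real) / 2 ^ Suc n = (of_int j + 1) / 2 ^ n"
      "(of_int (2 * j) + 1 :: real) / 2 ^ Suc n = of_int (2 * j + 1) / 2 ^ Suc n"
      by (auto simp: field_simps)
    then show ?thesis unfolding dyadic_inc_def by simp
  qed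
  moreover have "(\<lambda>\<omega>. dyadic_inc (Suc n) (2 * j) \<omega> + dyadic_inc (Suc n) (2 * j + 1) \<omega>) \<in> borel_measurable (dyadic_field (Suc n) K')"
    using assms[OF j] by (intro borel_measurable_add measurable_dyadic_inc) auto
  ultimately have "dyadic_inc n j \<in> borel_measurable (dyadic_field (Suc n) K')"
    by (simp add: fun_eq_iff[symmetric] cong: measurable_cong)
  from measurable_sets[OF this A] show "dyadic_inc n j -` A \<inter> Omega0 \<in> sets (dyadic_field (Suc n) K')" by simp
next
  show "Omega0 \<in> sets (dyadic_field (Suc n) K')" using sets.top[of "dyadic_field (Suc n) K'"] by simp
qed

text \<open>In the application \<open>m\<close> is a level at which the endpoints of a given
  interval are grid points, and the sets \<open>K k\<close> describe one and the same region of the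
  line at the levels \<open>m + k\<close>.\<close>

definition limit_field :: "nat \<Rightarrow> (nat \<Rightarrow> int set) \<Rightarrow> (real \<Rightarrow> real) measure" where
  "limit_field m K = sigma Omega0 (\<Union>k. sets (dyadic_field (m + k) (K k)))"

lemma limit_field_gen: "(\<Union>k. sets (dyadic_field (m + k) (K k))) \<subseteq> Pow Omega0"
  using sets.sets_into_space by fastforce

lemma space_limit_field[simp]: "space (limit_field m K) = Omega0"
  unfolding limit_field_def by (rule space_measure_of[OF limit_field_gen])

lemma sets_limit_field: "sets (limit_field m K) = sigma_sets Omega0 (\<Union>k. sets (dyadic_field (m + k) (K k)))"
  unfolding limit_field_def by (rule sets_measure_of[OF limit_field_gen])

text \<open>By continuity of paths the increment is the limit of increments between the times
  rounded down to dyadic ones, and these are finite sums of dyadic increments with indices in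
  \<open>K k\<close>.\<close>

lemma measurable_increment:
  assumes "u \<le> v" and K: "\<And>k j. \<lfloor>2 ^ (m + k) * u\<rfloor> \<le> j \<Longrightarrow> j < \<lfloor>2 ^ (m + k) * v\<rfloor> \<Longrightarrow> j \<in> K k"
  shows "(\<lambda>\<omega>. \<omega> v - \<omega> u) \<in> borel_measurable (limit_field m K)"
proof (rule borel_measurable_LIMSEQ_real)
  fix k
  have le: "\<lfloor>2 ^ (m + k) * u\<rfloor> \<le> \<lfloor>2 ^ (m + k) * v\<rfloor>" using assms(1) by (intro floor_mono mult_left_mono) auto
  have "dyadic_inc (m + k) j \<in> borel_measurable (limit_field m K)" if "j \<in> K k" for j
  proof (rule measurableI)
    fix A :: "real set" assume A: "A \<in> sets borel"
    have "dyadic_inc (m + k) j -` A \<inter> Omega0 \<in> sets (dyadic_field (m + k) (K k))"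
      using measurable_sets[OF measurable_dyadic_inc[OF that] A] by simp
    then show "dyadic_inc (m + k) j -` A \<inter> space (limit_field m K) \<in> sets (limit_field m K)"
      unfolding sets_limit_field by (auto intro!: sigma_sets.Basic)
  qed simp
  then have "(\<lambda>\<omega>. \<Sum>j\<in>{\<lfloor>2 ^ (m + k) * u\<rfloor>..<\<lfloor>2 ^ (m + k) * v\<rfloor>}. dyadic_inc (m + k) j \<omega>) \<in> borel_measurable (limit_field m K)"
    using K by (intro borel_measurable_sum) auto
  then show "(\<lambda>\<omega>. \<omega> (of_int \<lfloor>2 ^ (m + k) * v\<rfloor> / 2 ^ (m + k)) - \<omega> (of_int \<lfloor>2 ^ (m + k) * u\<rfloor> / 2 ^ (m + k))) \<in> borel_measurable (limit_field m K)"
    unfolding sum_dyadic_inc[OF le] .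
next
  fix \<omega> assume "\<omega> \<in> space (limit_field m K)"
  then have "isCont \<omega> x" for x by (simp add: Omega0_def continuous_on_eq_continuous_at)
  then show "(\<lambda>k. \<omega> (of_int \<lfloor>2 ^ (m + k) * v\<rfloor> / 2 ^ (m + k)) - \<omega> (of_int \<lfloor>2 ^ (m + k) * u\<rfloor> / 2 ^ (m + k))) \<longlonglongrightarrow> \<omega> v - \<omega> u"
    by (intro tendsto_diff isCont_tendsto_compose[OF _ dyadic_floor_tendsto])
qed

text \<open>Increment fields contain all events of probability 0 or 1, so the fields spanned by
  dyadic increments have to be enlarged by null modifications before they contain them. Replacing an
  event by its representative in \<open>S\<close> leaves probabilities unchanged, so independence
  survives the enlargement.\<close>

lemma completed_sub_field:
  assumes W: "prob_space W" "space W = Omega0" and S: "sigma_algebra Omega0 S" "S \<subseteq> sets W"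
  defines "F \<equiv> {E \<in> sets W. \<exists>E0\<in>S. AE \<omega> in W. \<omega> \<in> E \<longleftrightarrow> \<omega> \<in> E0}"
  shows "sigma_algebra Omega0 F"
    and "S \<subseteq> F" and "\<And>E. E \<in> sets W \<Longrightarrow> measure W E = 0 \<or> measure W E = 1 \<Longrightarrow> E \<in> F"
proof -
  interpret W: prob_space W by fact
  interpret S: sigma_algebra Omega0 S by fact
  show "sigma_algebra Omega0 F"
    unfolding sigma_algebra_iff2
  proof (intro conjI ballI allI impI)
    show "F \<subseteq> Pow Omega0" using sets.sets_into_space W by (auto simp: F_def)
    show "{} \<in> F" by (auto simp: F_def intro!: bexI[of _ "{}"])
    fix E assume "E \<in> F"
    then obtain E0 where E: "E \<in> sets W" "E0 \<in> S" "AE \<omega> in W. \<omega> \<in> E \<longleftrightarrow> \<omega> \<in> E0" by (auto simp: F_def)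
    then show "Omega0 - E \<in> F"
      using sets.compl_sets[of E W] W S.compl_sets[of E0] by (auto simp: F_def intro!: bexI[of _ "Omega0 - E0"])
  next
    fix A :: "nat \<Rightarrow> _" assume "range A \<subseteq> F"
    then have "\<forall>i. A i \<in> sets W \<and> (\<exists>E0\<in>S. AE \<omega> in W. \<omega> \<in> A i \<longleftrightarrow> \<omega> \<in> E0)" by (auto simp: F_def)
    then obtain E where E: "\<And>i. A i \<in> sets W" "\<And>i. E i \<in> S" "\<And>i. AE \<omega> in W. \<omega> \<in> A i \<longleftrightarrow> \<omega> \<in> E i" by metis
    have "AE \<omega> in W. \<forall>i. \<omega> \<in> A i \<longleftrightarrow> \<omega> \<in> E i" unfolding AE_all_countable using E(3) by blast
    then have "AE \<omega> in W. \<omega> \<in> (\<Union>i. A i) \<longleftrightarrow> \<omega> \<in> (\<Union>i. E i)" by eventually_elim auto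
    moreover have "(\<Union>i. E i) \<in> S" using E(2) by blast
    ultimately show "\<Union> (range A) \<in> F"
      using E(1) unfolding F_def by (auto intro!: bexI[of _ "\<Union>i. E i"])
  qed
  show "S \<subseteq> F" using S by (auto simp: F_def)
  fix E assume E: "E \<in> sets W" "measure W E = 0 \<or> measure W E = 1"
  from E(2) show "E \<in> F"
  proof
    assume "measure W E = 0"
    then have "AE \<omega> in W. \<omega> \<notin> E" using E(1) by (simp add: W.prob_eq_0)
    then show ?thesis using E by (auto simp: F_def intro!: bexI[of _ "{}"])
  next
    assume "measure W E = 1"
    then have "AE \<omega> in W. \<omega> \<in> E" using E(1) by (simp add: W.prob_eq_1)
    then show ?thesis using E W AE_space[of W] by (auto simp: F_def intro!: bexI[of _ Omega0])
  qed
qed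

text \<open>A history may have points on both sides of the interval, so the inside must be
  independent of both sides jointly; this is why one field \<open>Fo\<close> covers both. The
  endpoints are dyadic so that, from level \<open>m\<close> on, each dyadic interval lies entirely
  inside or entirely outside.\<close>

lemma wiener_local_indep:
  fixes a b :: int and m :: nat
  assumes W: "two_sided_wiener_measure W" and ab: "a < b"
  obtains Fi Fo where "sigma_algebra Omega0 Fi" "sigma_algebra Omega0 Fo" "prob_space.indep_set W Fi Fo"
    "sets (increment_field W (ereal (of_int a / 2 ^ m)) (ereal (of_int b / 2 ^ m))) \<subseteq> Fi"
    "sets (increment_field W (- \<infinity>) (ereal (of_int a / 2 ^ m))) \<subseteq> Fo"
    "sets (increment_field W (ereal (of_int b / 2 ^ m)) \<infinity>) \<subseteq> Fo"
proof -
  obtain P where P: "prob_space P" "space P = Omega0" "sets P = sets Omega0_borel"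
    and pos: "standard_brownian_motion P (\<lambda>t \<omega>. \<omega> t)"
    and neg: "standard_brownian_motion P (\<lambda>t \<omega>. \<omega> (- t))"
    and ind: "prob_space.indep_var P
       (PiM {0..} (\<lambda>_. borel)) (\<lambda>\<omega>. \<lambda>t\<in>{0..}. \<omega> t)
       (PiM {0..} (\<lambda>_. borel)) (\<lambda>\<omega>. \<lambda>t\<in>{0..}. \<omega> (- t))"
    and WP: "W = completion P"
    using W unfolding two_sided_wiener_measure_def by blast
  interpret P: prob_space P by fact
  interpret W: prob_space W unfolding WP by (rule P.prob_space_completion)
  have spW: "space W = Omega0" using P WP by simp
  have indv: "P.indep_vars (\<lambda>_. borel) (dyadic_inc n) UNIV" for n
    by (rule dyadic_inc_indep[OF P(1,2) pos neg ind])
  \<comment> \<open>At level \<open>m + k\<close> the endpoints \<open>a / 2 ^ m\<close> and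
    \<open>b / 2 ^ m\<close> have indices \<open>a * 2 ^ k\<close> and \<open>b * 2 ^ k\<close>; the
    right one is excluded because an index names the left end of its interval.\<close>
  define K where "K k = {a * 2 ^ k ..< b * 2 ^ k}" for k :: nat
  define K' where "K' k = - K k" for k
  have refine: "sets (dyadic_field (m + k) (K k)) \<subseteq> sets (dyadic_field (m + Suc k) (K (Suc k)))"
    "sets (dyadic_field (m + k) (K' k)) \<subseteq> sets (dyadic_field (m + Suc k) (K' (Suc k)))" for k
  proof -
    have "2 * j \<in> K (Suc k) \<and> 2 * j + 1 \<in> K (Suc k)" if "j \<in> K k" for j
      using that by (auto simp: K_def algebra_simps)
    then show "sets (dyadic_field (m + k) (K k)) \<subseteq> sets (dyadic_field (m + Suc k) (K (Suc k)))"
      using dyadic_field_refine[of "K k" "K (Suc k)" "m + k"] by simp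
    have "2 * j \<in> K' (Suc k) \<and> 2 * j + 1 \<in> K' (Suc k)" if "j \<in> K' k" for j
      using that by (auto simp: K'_def K_def algebra_simps)
    then show "sets (dyadic_field (m + k) (K' k)) \<subseteq> sets (dyadic_field (m + Suc k) (K' (Suc k)))"
      using dyadic_field_refine[of "K' k" "K' (Suc k)" "m + k"] by simp
  qed
  have mono: "sets (dyadic_field (m + k) (K k)) \<subseteq> sets (dyadic_field (m + l) (K l))"
    "sets (dyadic_field (m + k) (K' k)) \<subseteq> sets (dyadic_field (m + l) (K' l))" if "k \<le> l" for k l
    using lift_Suc_mono_le[of "\<lambda>k. sets (dyadic_field (m + k) (K k))", OF refine(1) that]
      lift_Suc_mono_le[of "\<lambda>k. sets (dyadic_field (m + k) (K' k))", OF refine(2) that] by blast+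
  have ind_k: "P.indep_set (sets (dyadic_field (m + k) (K k))) (sets (dyadic_field (m + k) (K' k)))" for k
  proof -
    let ?E = "\<lambda>j. {dyadic_inc (m + k) j -` A \<inter> space P |A. A \<in> sets borel}"
    have "P.indep_sets (\<lambda>x. sigma_sets (space P) (\<Union>j\<in>case_bool (K k) (K' k) x. ?E j)) UNIV"
    proof (rule P.indep_sets_collect_sigma)
      show "P.indep_sets ?E (\<Union>x\<in>UNIV. case_bool (K k) (K' k) x)"
        by (rule P.indep_sets_mono_index[of _ UNIV]) (use indv[of "m + k"] in \<open>auto simp: P.indep_vars_def2\<close>)
      show "Int_stable (?E j)" for j
        unfolding Int_stable_def by (auto, rule_tac x="A \<inter> Aa" in exI, auto)
      show "disjoint_family_on (case_bool (K k) (K' k)) UNIV"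
        by (auto simp: disjoint_family_on_def K'_def split: bool.splits)
    qed
    then show ?thesis unfolding P.indep_set_def
      by (rule P.indep_sets_mono_sets) (auto simp: sets_dyadic_field P(2) split: bool.splits)
  qed
  \<comment> \<open>Two events always belong to a common level, where independence is known. The
    unions increase with the level, so they are stable under intersection and independence extends
    to the sigma-fields they generate.\<close>
  have ind0: "P.indep_set (\<Union>k. sets (dyadic_field (m + k) (K k))) (\<Union>k. sets (dyadic_field (m + k) (K' k)))"
    unfolding P.indep_sets2_eq
  proof (intro conjI ballI)
    show "(\<Union>k. sets (dyadic_field (m + k) (K k))) \<subseteq> P.events" "(\<Union>k. sets (dyadic_field (m + k) (K' k))) \<subseteq> P.events"
      using ind_k unfolding P.indep_sets2_eq by blast+
    fix E E' assume "E \<in> (\<Union>k. sets (dyadic_field (m + k) (K k)))" "E' \<in> (\<Union>k. sets (dyadic_field (m + k) (K' k)))"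
    then obtain k l where "E \<in> sets (dyadic_field (m + k) (K k))" "E' \<in> sets (dyadic_field (m + l) (K' l))" by blast
    then have "E \<in> sets (dyadic_field (m + max k l) (K (max k l)))" "E' \<in> sets (dyadic_field (m + max k l) (K' (max k l)))"
      using mono[of k "max k l"] mono[of l "max k l"] by (meson max.cobounded1 max.cobounded2 subsetD)+
    then show "P.prob (E \<inter> E') = P.prob E * P.prob E'"
      using ind_k[of "max k l"] unfolding P.indep_sets2_eq by blast
  qed
  have stab: "Int_stable (\<Union>k. sets (dyadic_field (m + k) (L k)))"
    if "\<And>k l. k \<le> l \<Longrightarrow> sets (dyadic_field (m + k) (L k)) \<subseteq> sets (dyadic_field (m + l) (L l))" for L
  proof (rule Int_stableI)
    fix E E' assume "E \<in> (\<Union>k. sets (dyadic_field (m + k) (L k)))" "E' \<in> (\<Union>k. sets (dyadic_field (m + k) (L k)))"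
    then obtain k l where "E \<in> sets (dyadic_field (m + k) (L k))" "E' \<in> sets (dyadic_field (m + l) (L l))" by blast
    then have "E \<inter> E' \<in> sets (dyadic_field (m + max k l) (L (max k l)))"
      using that[of k "max k l"] that[of l "max k l"] by (meson max.cobounded1 max.cobounded2 subsetD sets.Int)
    then show "E \<inter> E' \<in> (\<Union>k. sets (dyadic_field (m + k) (L k)))" by blast
  qed
  have ind1: "P.indep_set (sets (limit_field m K)) (sets (limit_field m K'))"
    unfolding sets_limit_field P(2)[symmetric]
    by (rule P.indep_set_sigma_sets[OF ind0 stab[OF mono(1)] stab[OF mono(2)]])
  have subW: "sets (limit_field m K) \<subseteq> sets W" "sets (limit_field m K') \<subseteq> sets W"
    using ind1 unfolding P.indep_sets2_eq WP by (auto intro!: sets_completionI_sets)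
  define Fi where "Fi = {E \<in> sets W. \<exists>E0\<in>sets (limit_field m K). AE \<omega> in W. \<omega> \<in> E \<longleftrightarrow> \<omega> \<in> E0}"
  define Fo where "Fo = {E \<in> sets W. \<exists>E0\<in>sets (limit_field m K'). AE \<omega> in W. \<omega> \<in> E \<longleftrightarrow> \<omega> \<in> E0}"
  have sa: "sigma_algebra Omega0 (sets (limit_field m L))" for L
    using sets.sigma_algebra_axioms[of "limit_field m L"] by simp
  note Fi = completed_sub_field[OF W.prob_space_axioms spW sa subW(1), folded Fi_def]
  note Fo = completed_sub_field[OF W.prob_space_axioms spW sa subW(2), folded Fo_def]
  have "W.indep_set Fi Fo"
    unfolding W.indep_sets2_eq
  proof (intro conjI ballI)
    fix E E' assume "E \<in> Fi" "E' \<in> Fo"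
    then obtain E0 E0' where E: "E \<in> sets W" "E0 \<in> sets (limit_field m K)" "AE \<omega> in W. \<omega> \<in> E \<longleftrightarrow> \<omega> \<in> E0"
      and E': "E' \<in> sets W" "E0' \<in> sets (limit_field m K')" "AE \<omega> in W. \<omega> \<in> E' \<longleftrightarrow> \<omega> \<in> E0'"
      by (auto simp: Fi_def Fo_def)
    have s: "E0 \<in> sets P" "E0' \<in> sets P" using E(2) E'(2) ind1 unfolding P.indep_sets2_eq by auto
    have sW: "E0 \<in> sets W" "E0' \<in> sets W" using s WP by auto
    have "W.prob (E \<inter> E') = W.prob (E0 \<inter> E0')"
      using E E' sW by (intro measure_eq_AE) auto
    also have "\<dots> = P.prob (E0 \<inter> E0')" unfolding WP using s by simp
    also have "\<dots> = P.prob E0 * P.prob E0'" using ind1 E(2) E'(2) unfolding P.indep_sets2_eq by blast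
    also have "\<dots> = W.prob E0 * W.prob E0'" unfolding WP using s by simp
    also have "W.prob E0 = W.prob E" using E sW by (intro measure_eq_AE) auto
    also have "W.prob E0' = W.prob E'" using E' sW by (intro measure_eq_AE) auto
    finally show "W.prob (E \<inter> E') = W.prob E * W.prob E'" .
  qed (auto simp: Fi_def Fo_def)
  moreover have incr_sub: "sets (increment_field W s t) \<subseteq> F"
    if F: "sigma_algebra Omega0 F" "sets (limit_field m L) \<subseteq> F" "\<And>E. E \<in> sets W \<Longrightarrow> measure W E = 0 \<or> measure W E = 1 \<Longrightarrow> E \<in> F"
      and L: "\<And>u v k j. s \<le> ereal u \<Longrightarrow> u \<le> v \<Longrightarrow> ereal v \<le> t \<Longrightarrow> \<lfloor>2 ^ (m + k) * u\<rfloor> \<le> j \<Longrightarrow> j < \<lfloor>2 ^ (m + k) * v\<rfloor> \<Longrightarrow> j \<in> L k"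
    for s t F L
  proof -
    interpret F: sigma_algebra Omega0 F by fact
    let ?G = "{{\<omega>\<in>Omega0. \<omega> v - \<omega> u \<in> A} | u v A. s \<le> ereal u \<and> u \<le> v \<and> ereal v \<le> t \<and> A \<in> sets borel} \<union>
      {E \<in> sets W. measure W E = 0 \<or> measure W E = 1}"
    have "?G \<subseteq> F"
    proof safe
      fix u v and A :: "real set" assume uv: "s \<le> ereal u" "u \<le> v" "ereal v \<le> t" and A: "A \<in> sets borel"
      have "(\<lambda>\<omega>. \<omega> v - \<omega> u) \<in> borel_measurable (limit_field m L)"
        by (rule measurable_increment[OF uv(2)]) (rule L[OF uv])
      from measurable_sets[OF this A] have "{\<omega>\<in>Omega0. \<omega> v - \<omega> u \<in> A} \<in> sets (limit_field m L)"
        by (simp add: vimage_def Int_def conj_commute)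
      then show "{\<omega>\<in>Omega0. \<omega> v - \<omega> u \<in> A} \<in> F" using F(2) by blast
    qed (use F(3) in auto)
    moreover have "?G \<subseteq> Pow Omega0" using sets.sets_into_space[of _ W] spW by auto
    ultimately show ?thesis unfolding increment_field_def by (simp add: F.sigma_sets_subset)
  qed
  have "sets (increment_field W (ereal (of_int a / 2 ^ m)) (ereal (of_int b / 2 ^ m))) \<subseteq> Fi"
  proof (rule incr_sub[OF Fi])
    fix u v k j assume *: "ereal (of_int a / 2 ^ m) \<le> ereal u" "ereal v \<le> ereal (of_int b / 2 ^ m)"
      "\<lfloor>2 ^ (m + k) * u\<rfloor> \<le> j" "j < \<lfloor>2 ^ (m + k) * v\<rfloor>"
    \<comment> \<open>Rounding down cannot cross the left endpoint, which is itself a grid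
      point.\<close>
    have "a * 2 ^ k \<le> \<lfloor>2 ^ (m + k) * u\<rfloor>" unfolding le_floor_iff
      using * by (simp add: power_add divide_simps mult_ac)
    moreover have "\<lfloor>2 ^ (m + k) * v\<rfloor> \<le> b * 2 ^ k"
    proof -
      have "2 ^ (m + k) * v \<le> of_int (b * 2 ^ k)" using * by (simp add: power_add divide_simps mult_ac)
      then show ?thesis by linarith
    qed
    ultimately show "j \<in> K k" using * by (auto simp: K_def)
  qed
  moreover have "sets (increment_field W (- \<infinity>) (ereal (of_int a / 2 ^ m))) \<subseteq> Fo"
  proof (rule incr_sub[OF Fo])
    fix u v k j assume *: "ereal v \<le> ereal (of_int a / 2 ^ m)" "j < \<lfloor>2 ^ (m + k) * v\<rfloor>"
    have "2 ^ (m + k) * v \<le> of_int (a * 2 ^ k)" using * by (simp add: power_add divide_simps mult_ac)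
    then have "\<lfloor>2 ^ (m + k) * v\<rfloor> \<le> a * 2 ^ k" by linarith
    then show "j \<in> K' k" using * by (auto simp: K'_def K_def)
  qed
  moreover have "sets (increment_field W (ereal (of_int b / 2 ^ m)) \<infinity>) \<subseteq> Fo"
  proof (rule incr_sub[OF Fo])
    fix u v k j assume *: "ereal (of_int b / 2 ^ m) \<le> ereal u" "\<lfloor>2 ^ (m + k) * u\<rfloor> \<le> j"
    have "b * 2 ^ k \<le> \<lfloor>2 ^ (m + k) * u\<rfloor>" unfolding le_floor_iff
      using * by (simp add: power_add divide_simps mult_ac)
    then show "j \<in> K' k" using * by (auto simp: K'_def K_def)
  qed
  ultimately show thesis using that Fi(1) Fo(1) by blast
qed

section \<open>Stationary random sets\<close>

lemma compact_subset_pos_measure: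
  fixes A :: "real set"
  assumes A: "A \<in> sets borel" and pos: "emeasure lborel A \<noteq> 0"
  obtains K where "compact K" "K \<subseteq> A" "emeasure lborel K \<noteq> 0"
proof -
  have "\<exists>n::nat. emeasure lborel (A \<inter> cball 0 (real n)) \<noteq> 0"
  proof (rule ccontr)
    assume "\<not> ?thesis"
    then have "emeasure lborel (\<Union>n::nat. A \<inter> cball 0 (real n)) = 0"
      using A by (intro emeasure_UN_eq_0) auto
    moreover have "(\<Union>n::nat. A \<inter> cball 0 (real n)) = A"
    proof (intro equalityI subsetI)
      fix x assume x: "x \<in> A"
      obtain n :: nat where "\<bar>x\<bar> \<le> real n" using real_arch_simple by blast
      then have "x \<in> A \<inter> cball 0 (real n)" using x by (simp add: dist_real_def)
      then show "x \<in> (\<Union>n::nat. A \<inter> cball 0 (real n))" by blast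
    qed blast
    ultimately show False using pos by simp
  qed
  then obtain n :: nat where n: "emeasure lborel (A \<inter> cball 0 (real n)) \<noteq> 0" by blast
  define B where "B = A \<inter> cball 0 (real n)"
  have B: "B \<in> sets borel" "bounded B" using A by (auto simp: B_def)
  have fin: "emeasure lborel B < \<infinity>" by (rule emeasure_bounded_finite) fact
  \<comment> \<open>Half the measure of \<open>B\<close>, so that removing a set of measure below
    \<open>e\<close> leaves a non-null remainder.\<close>
  define e where "e = measure lborel B / 2"
  have em: "emeasure lborel B = ennreal (measure lborel B)" using fin by (intro emeasure_eq_ennreal_measure) auto
  have "measure lborel B \<noteq> 0" using n em unfolding B_def[symmetric] by auto
  then have e: "0 < e" using measure_nonneg[of lborel B] unfolding e_def by linarith
  obtain U where U: "open U" "- B \<subseteq> U" "emeasure lborel (U - (- B)) < e"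
    by (rule outer_regular_lborel[of "- B" e]) (use B e in auto)
  define K where "K = - U"
  have K: "closed K" "K \<subseteq> B" using U by (auto simp: K_def)
  have "compact K" using K B(2) by (auto simp: compact_eq_bounded_closed intro: bounded_subset)
  moreover have "emeasure lborel K \<noteq> 0"
  proof
    assume "emeasure lborel K = 0"
    moreover have BK: "B = K \<union> (U - (- B))" using K(2) unfolding K_def by blast
    have "emeasure lborel (K \<union> (U - (- B))) \<le> emeasure lborel K + emeasure lborel (U - (- B))"
      using K(1) U(1) B(1) by (intro emeasure_subadditive) auto
    then have "emeasure lborel B \<le> emeasure lborel K + emeasure lborel (U - (- B))"
      unfolding BK[symmetric] .
    ultimately have "emeasure lborel B < ennreal e" using U(3) by auto
    then have "measure lborel B < e" using em e by (simp add: ennreal_less_iff)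
    then show False using measure_nonneg[of lborel B] by (simp add: e_def)
  qed
  moreover have "K \<subseteq> A" using K(2) by (auto simp: B_def)
  ultimately show thesis using that by blast
qed

lemma emeasure_lborel_shift:
  fixes A :: "real set"
  assumes "A \<in> sets borel" shows "emeasure lborel {x. c + x \<in> A} = emeasure lborel A"
proof -
  have "emeasure lborel A = emeasure (distr lborel borel ((+) c)) A" by (simp add: lborel_distr_plus)
  also have "\<dots> = emeasure lborel {x. c + x \<in> A}" using assms by (subst emeasure_distr) (auto simp: vimage_def)
  finally show ?thesis ..
qed

text \<open>Choose an open \<open>U\<close> around \<open>K\<close> that exceeds it by less than the
  measure of \<open>K\<close>. A small translate of \<open>K\<close> stays inside \<open>U\<close>
  and is too large to fit into \<open>U - K\<close>, so it meets \<open>K\<close>.\<close>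

lemma steinhaus_compact:
  fixes K :: "real set"
  assumes K: "compact K" and pos: "emeasure lborel K \<noteq> 0"
  obtains d where "d > 0" "\<And>r. \<bar>r\<bar> < d \<Longrightarrow> \<exists>x\<in>K. r + x \<in> K"
proof -
  have B: "K \<in> sets borel" by (rule borel_compact[OF K])
  have fin: "emeasure lborel K < \<infinity>" by (rule emeasure_bounded_finite) (rule compact_imp_bounded[OF K])
  then have em: "emeasure lborel K = ennreal (measure lborel K)" by (intro emeasure_eq_ennreal_measure) auto
  have "measure lborel K \<noteq> 0" using pos em by auto
  then have e: "0 < measure lborel K" using measure_nonneg[of lborel K] by linarith
  obtain U where U: "open U" "K \<subseteq> U" "emeasure lborel (U - K) < measure lborel K"
    by (rule outer_regular_lborel[OF B e])
  obtain d where d: "d > 0" "(\<Union>x\<in>K. ball x d) \<subseteq> U"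
    by (rule compact_subset_open_imp_ball_epsilon_subset[OF K U(1,2)])
  have "\<exists>x\<in>K. r + x \<in> K" if r: "\<bar>r\<bar> < d" for r
  proof (rule ccontr)
    assume no: "\<not> ?thesis"
    define L where "L = {x. r + x \<in> K}"
    have L: "L \<in> sets borel" "emeasure lborel L = emeasure lborel K"
    proof -
      have "(\<lambda>x. r + x) -` K \<inter> space borel \<in> sets borel" using B by (intro measurable_sets[of _ borel borel]) auto
      then show "L \<in> sets borel" by (simp add: L_def vimage_def)
      show "emeasure lborel L = emeasure lborel K" unfolding L_def by (rule emeasure_lborel_shift[OF B])
    qed
    have "L \<subseteq> U - K"
    proof
      fix x assume x: "x \<in> L"
      then have "x \<in> ball (r + x) d" using r by (simp add: dist_real_def)
      moreover have "r + x \<in> K" using x by (simp add: L_def)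
      ultimately have "x \<in> U" using d(2) by blast
      then show "x \<in> U - K" using no x by (auto simp: L_def)
    qed
    then have "emeasure lborel L \<le> emeasure lborel (U - K)" using U(1) B by (intro emeasure_mono) auto
    then show False using U(3) L(2) em by auto
  qed
  with d(1) that show thesis by blast
qed

text \<open>Were \<open>C\<close> non-null, Fubini would make the integral over \<open>m\<close> of
  the measure of \<open>B\<close> intersected with \<open>C + m\<close> positive, so for some
  \<open>m0\<close> this intersection would contain a non-null compact set. By Steinhaus
  \<open>m0\<close> can then be replaced by any sufficiently close point, in particular by a point
  of \<open>D\<close>.\<close>

lemma null_translates_avoiding:
  fixes B C D :: "real set"
  assumes B: "B \<in> sets borel" "emeasure lborel B \<noteq> 0" and C: "C \<in> sets borel"
    and D: "closure D = UNIV" and avoid: "\<And>u m. u \<in> C \<Longrightarrow> m \<in> D \<Longrightarrow> u + m \<notin> B"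
  shows "emeasure lborel C = 0"
proof (rule ccontr)
  assume pos: "emeasure lborel C \<noteq> 0"
  note B(1)[measurable] C[measurable]
  have "\<exists>m. emeasure lborel {x \<in> B. x - m \<in> C} \<noteq> 0"
  proof (rule ccontr)
    assume "\<not> ?thesis"
    then have z: "emeasure lborel {x \<in> B. x - m \<in> C} = 0" for m by blast
    have "(\<integral>\<^sup>+x. \<integral>\<^sup>+m. indicator B x * indicator C (x - m) \<partial>lborel \<partial>lborel)
        = (\<integral>\<^sup>+m. \<integral>\<^sup>+x. indicator B x * indicator C (x - m) \<partial>lborel \<partial>lborel)"
      by (rule lborel_pair.Fubini') (simp add: split_beta)
    also have "\<dots> = (\<integral>\<^sup>+m. emeasure lborel {x \<in> B. x - m \<in> C} \<partial>lborel)"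
    proof (rule nn_integral_cong)
      fix m :: real
      have "{x \<in> space lborel. x \<in> B \<and> x - m \<in> C} \<in> sets lborel" by measurable
      then have "{x \<in> B. x - m \<in> C} \<in> sets lborel" by simp
      from nn_integral_indicator[OF this]
      show "(\<integral>\<^sup>+x. indicator B x * indicator C (x - m) \<partial>lborel) = emeasure lborel {x \<in> B. x - m \<in> C}"
        by (simp add: indicator_def of_bool_conj)
    qed
    also have "\<dots> = 0" by (simp add: z)
    finally have "(\<integral>\<^sup>+x. indicator B x * (\<integral>\<^sup>+m. indicator C (x - m) \<partial>lborel) \<partial>lborel) = 0"
      by (simp add: nn_integral_cmult)
    moreover have "(\<integral>\<^sup>+m. indicator C (x - m) \<partial>lborel) = emeasure lborel C" for x
    proof -
      have "(\<integral>\<^sup>+y. indicator C y \<partial>lborel) = (\<integral>\<^sup>+m. indicator C (x + (-1) * m) \<partial>lborel)"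
        by (subst nn_integral_real_affine[of _ "-1" x]) auto
      then show ?thesis by simp
    qed
    ultimately have "emeasure lborel B * emeasure lborel C = 0"
      by (simp add: nn_integral_multc)
    then show False using B(2) pos by simp
  qed
  then obtain m0 where m0: "emeasure lborel {x \<in> B. x - m0 \<in> C} \<noteq> 0" by blast
  have "{x \<in> space borel. x \<in> B \<and> x - m0 \<in> C} \<in> sets borel" by measurable
  then have "{x \<in> B. x - m0 \<in> C} \<in> sets borel" by simp
  from compact_subset_pos_measure[OF this m0]
  obtain K where K: "compact K" "K \<subseteq> {x \<in> B. x - m0 \<in> C}" "emeasure lborel K \<noteq> 0" .
  obtain d where d: "d > 0" "\<And>r. \<bar>r\<bar> < d \<Longrightarrow> \<exists>x\<in>K. r + x \<in> K"
    using steinhaus_compact[OF K(1,3)] by blast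
  obtain m where m: "m \<in> D" "dist m m0 < d"
    using D d(1) closure_approachable[of m0 D] by auto
  then obtain x where x: "x \<in> K" "(m - m0) + x \<in> K" using d(2)[of "m - m0"] by (auto simp: dist_real_def)
  \<comment> \<open>The shift \<open>x - m0\<close> lies in \<open>C\<close> and carries the point
    \<open>m\<close> of \<open>D\<close> into \<open>B\<close>.\<close>
  have "x - m0 \<in> C" "(x - m0) + m \<in> B" using x K(2) by (auto simp: algebra_simps)
  with avoid m(1) show False by blast
qed

section \<open>Hitting a fixed Borel set\<close>

lemma mem_seq_set: "y \<in> seq_set s \<longleftrightarrow> (\<exists>i. s i = Some y)"
  by (auto simp: seq_set_def in_these_eq image_iff) metis

lemma hit_seq_set_iff: "seq_set s \<inter> B \<noteq> {} \<longleftrightarrow> (\<exists>i. \<exists>y. s i = Some y \<and> y \<in> B)"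
  unfolding disjoint_iff mem_seq_set by blast

lemma pred_hit:
  assumes B: "B \<in> sets borel" and S: "\<And>i. (\<lambda>x. s x i) \<in> measurable M coffin_borel"
  shows "Measurable.pred M (\<lambda>x. seq_set (s x) \<inter> B \<noteq> {})"
proof -
  note B[measurable]
  have "Measurable.pred M (\<lambda>x. \<exists>y. s x i = Some y \<and> y \<in> B)" for i
  proof (rule pred_Some_in_coffin[OF S])
    have [measurable]: "(\<lambda>x. the (s x i)) \<in> borel_measurable M" using S by measurable
    show "Measurable.pred M (\<lambda>x. the (s x i) \<in> B)" by measurable
  qed
  then show ?thesis unfolding hit_seq_set_iff by (rule pred_intros_countable)
qed

lemma measurable_enumerationD:
  assumes "measurable_enumeration W W M S"
  shows "S i \<in> measurable W coffin_borel" "AE \<omega> in W. M \<omega> = seq_set (\<lambda>i. S i \<omega>)"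
    "(\<lambda>\<omega> i. S i \<omega>) \<in> measurable W cseqM"
  using assms by (auto simp: measurable_enumeration_def intro!: measurable_PiM_single')

lemma is_coupling_AE:
  assumes R: "is_coupling R P Q" and f: "Measurable.pred P f" and g: "Measurable.pred Q g"
    and fg: "AE x in R. f (fst x) \<longleftrightarrow> g (snd x)"
  shows "(AE x in P. f x) \<longleftrightarrow> (AE y in Q. g y)"
proof -
  have sR: "sets R = sets (P \<Otimes>\<^sub>M Q)" and P: "distr R P fst = P" and Q: "distr R Q snd = Q"
    using R by (auto simp: is_coupling_def)
  have m: "fst \<in> measurable R P" "snd \<in> measurable R Q" by (simp_all add: measurable_cong_sets[OF sR refl])
  have "(AE x in P. f x) \<longleftrightarrow> (AE x in R. f (fst x))"
    by (subst P[symmetric], subst AE_distr_iff[OF m(1)]) (use f in \<open>simp_all add: pred_def\<close>)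
  also have "\<dots> \<longleftrightarrow> (AE x in R. g (snd x))"
  proof
    assume "AE x in R. f (fst x)" then show "AE x in R. g (snd x)" using fg by eventually_elim simp
  next
    assume "AE x in R. g (snd x)" then show "AE x in R. f (fst x)" using fg by eventually_elim simp
  qed
  also have "\<dots> \<longleftrightarrow> (AE y in Q. g y)"
  proof -
    have "(AE y in distr R Q snd. g y) \<longleftrightarrow> (AE x in R. g (snd x))"
      by (subst AE_distr_iff[OF m(2)]) (use g in \<open>simp_all add: pred_def\<close>)
    then show ?thesis unfolding Q by blast
  qed
  finally show ?thesis .
qed


text \<open>Whether \<open>B\<close> is hit depends on an enumerating sequence only through its set
  of values, and these sets agree under the coupling that stationarity provides. Only events of full
  probability are compared, which is enough for a zero-one dichotomy.\<close>

lemma stationary_hit_shift: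
  assumes W: "prob_space W" and M: "stationary_in_law W M" and S: "measurable_enumeration W W M S"
    and B: "B \<in> sets borel"
  shows "(AE \<omega> in W. M \<omega> \<inter> B \<noteq> {}) \<longleftrightarrow> (AE \<omega> in W. (\<lambda>x. u + x) ` M \<omega> \<inter> B \<noteq> {})"
    and "(AE \<omega> in W. M \<omega> \<inter> B = {}) \<longleftrightarrow> (AE \<omega> in W. (\<lambda>x. u + x) ` M \<omega> \<inter> B = {})"
proof -
  obtain S1 S2 R where S1: "measurable_enumeration W W M S1"
    and S2: "measurable_enumeration W W (\<lambda>\<omega>. (\<lambda>x. u + x) ` M \<omega>) S2"
    and R: "is_coupling R (seq_law W S1) (seq_law W S2)" and eq: "AE (s, s') in R. seq_set s = seq_set s'"
    using M unfolding stationary_in_law_def same_law_def by meson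
  have hit: "Measurable.pred cseqM (\<lambda>s. seq_set s \<inter> B \<noteq> {})" by (rule pred_hit[OF B]) simp
  then have nohit: "Measurable.pred cseqM (\<lambda>s. seq_set s \<inter> B = {})"
    using pred_intros_logic(2)[OF hit] by simp
  \<comment> \<open>\<open>same_law\<close> comes with enumerations of its own; this leads back from
    them to the random sets.\<close>
  have AEM: "(AE s in seq_law W S'. P (seq_set s)) \<longleftrightarrow> (AE \<omega> in W. P (M' \<omega>))"
    if S': "measurable_enumeration W W M' S'" and P: "Measurable.pred cseqM (\<lambda>s. P (seq_set s))" for S' M' P
  proof -
    have "(AE s in seq_law W S'. P (seq_set s)) \<longleftrightarrow> (AE \<omega> in W. P (seq_set (\<lambda>i. S' i \<omega>)))"
      unfolding seq_law_def
      by (subst AE_distr_iff[OF measurable_enumerationD(3)[OF S']]) (use P in \<open>simp_all add: pred_def\<close>)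
    also have "\<dots> \<longleftrightarrow> (AE \<omega> in W. P (M' \<omega>))"
    proof
      assume "AE \<omega> in W. P (seq_set (\<lambda>i. S' i \<omega>))"
      then show "AE \<omega> in W. P (M' \<omega>)" using measurable_enumerationD(2)[OF S'] by eventually_elim simp
    next
      assume "AE \<omega> in W. P (M' \<omega>)"
      then show "AE \<omega> in W. P (seq_set (\<lambda>i. S' i \<omega>))" using measurable_enumerationD(2)[OF S'] by eventually_elim simp
    qed
    finally show ?thesis .
  qed
  have sl: "sets (seq_law W S') = sets cseqM" for S' by (simp add: seq_law_def)
  have trans: "(AE \<omega> in W. P (M \<omega>)) \<longleftrightarrow> (AE \<omega> in W. P ((\<lambda>x. u + x) ` M \<omega>))"
    if P: "Measurable.pred cseqM (\<lambda>s. P (seq_set s))" for P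
    unfolding AEM[OF S1 P, symmetric] AEM[OF S2 P, symmetric]
  proof (rule is_coupling_AE[OF R])
    show "Measurable.pred (seq_law W S1) (\<lambda>s. P (seq_set s))" "Measurable.pred (seq_law W S2) (\<lambda>s. P (seq_set s))"
      by (simp_all only: measurable_cong_sets[OF sl refl] P)
    show "AE x in R. P (seq_set (fst x)) \<longleftrightarrow> P (seq_set (snd x))"
      using eq by (simp add: split_beta) (erule eventually_mono, simp)
  qed
  show "(AE \<omega> in W. M \<omega> \<inter> B \<noteq> {}) \<longleftrightarrow> (AE \<omega> in W. (\<lambda>x. u + x) ` M \<omega> \<inter> B \<noteq> {})"
    by (rule trans[of "\<lambda>A. A \<inter> B \<noteq> {}", OF hit])
  show "(AE \<omega> in W. M \<omega> \<inter> B = {}) \<longleftrightarrow> (AE \<omega> in W. (\<lambda>x. u + x) ` M \<omega> \<inter> B = {})"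
    by (rule trans[of "\<lambda>A. A \<inter> B = {}", OF nohit])
qed

text \<open>The probability of hitting \<open>B\<close> does not depend on the shift, so it may be averaged over all shifts.\<close>

lemma stationary_hits:
  assumes W: "prob_space W" and M: "random_countable_set W M" "stationary_in_law W M"
    and B: "B \<in> sets borel"
  shows "emeasure lborel B = 0 \<Longrightarrow> AE \<omega> in W. M \<omega> \<inter> B = {}"
    and "dense_random_set W M \<Longrightarrow> emeasure lborel B \<noteq> 0 \<Longrightarrow> AE \<omega> in W. M \<omega> \<inter> B \<noteq> {}"
proof -
  interpret W: prob_space W by fact
  interpret WL: pair_sigma_finite W "lborel :: real measure" ..
  obtain S where S: "measurable_enumeration W W M S" using M unfolding random_countable_set_def by blast
  note B[measurable] measurable_enumerationD(1)[OF S, measurable]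
  \<comment> \<open>Stated through the enumeration, because Fubini needs joint measurability in path
    and shift, which the set-valued map \<open>M\<close> does not provide directly.\<close>
  define hit where "hit x \<longleftrightarrow> (\<exists>i y. S i (fst x) = Some y \<and> snd x + y \<in> B)" for x
  have mhit[measurable]: "Measurable.pred (W \<Otimes>\<^sub>M lborel) hit"
  proof -
    have "Measurable.pred (W \<Otimes>\<^sub>M lborel) (\<lambda>x. \<exists>y. S i (fst x) = Some y \<and> snd x + y \<in> B)" for i
    proof (rule pred_Some_in_coffin)
      show m: "(\<lambda>x. S i (fst x)) \<in> measurable (W \<Otimes>\<^sub>M lborel) coffin_borel" by measurable
      note measurable_compose[OF m measurable_the_coffin, measurable]
      show "Measurable.pred (W \<Otimes>\<^sub>M lborel) (\<lambda>x. snd x + the (S i (fst x)) \<in> B)" by measurable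
    qed
    then show ?thesis unfolding hit_def[abs_def] by (rule pred_intros_countable)
  qed
  have hit_iff: "hit (\<omega>, u) \<longleftrightarrow> (\<lambda>x. u + x) ` M \<omega> \<inter> B \<noteq> {}" if "M \<omega> = seq_set (\<lambda>i. S i \<omega>)" for \<omega> u
  proof -
    have "(\<lambda>x. u + x) ` M \<omega> \<inter> B \<noteq> {} \<longleftrightarrow> (\<exists>y. y \<in> M \<omega> \<and> u + y \<in> B)" by blast
    then show ?thesis unfolding that hit_def mem_seq_set by auto
  qed
  note eqM = measurable_enumerationD(2)[OF S]
  have conv: "(AE \<omega> in W. \<Phi> (hit (\<omega>, u))) \<longleftrightarrow> (AE \<omega> in W. \<Phi> ((\<lambda>x. u + x) ` M \<omega> \<inter> B \<noteq> {}))" for \<Phi> u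
  proof
    assume "AE \<omega> in W. \<Phi> (hit (\<omega>, u))"
    then show "AE \<omega> in W. \<Phi> ((\<lambda>x. u + x) ` M \<omega> \<inter> B \<noteq> {})" using eqM by eventually_elim (simp add: hit_iff)
  next
    assume "AE \<omega> in W. \<Phi> ((\<lambda>x. u + x) ` M \<omega> \<inter> B \<noteq> {})"
    then show "AE \<omega> in W. \<Phi> (hit (\<omega>, u))" using eqM by eventually_elim (simp add: hit_iff)
  qed
  have swap: "AE u in lborel. AE \<omega> in W. \<Phi> (hit (\<omega>, u))" if "AE \<omega> in W. AE u in lborel. \<Phi> (hit (\<omega>, u))" for \<Phi>
  proof -
    have "(\<lambda>x. \<Phi> (hit x)) \<in> measurable (W \<Otimes>\<^sub>M lborel) (count_space UNIV)"
      by (rule measurable_compose[OF mhit]) simp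
    then have p: "{x \<in> space (W \<Otimes>\<^sub>M lborel). \<Phi> (hit x)} \<in> sets (W \<Otimes>\<^sub>M lborel)" by (simp add: pred_def)
    have "{x \<in> space (W \<Otimes>\<^sub>M lborel). \<Phi> (hit (fst x, snd x))} \<in> sets (W \<Otimes>\<^sub>M lborel)" using p by simp
    from WL.AE_commute[OF this] that show ?thesis by simp
  qed
  \<comment> \<open>Lebesgue measure is not zero, so what holds for almost every shift holds for
    some shift, from which stationarity leads back to \<open>M\<close> itself.\<close>
  have ex: "\<exists>u::real. P u" if "AE u in lborel. P u" for P
  proof (rule ccontr)
    assume none: "\<not> ?thesis"
    from that have "AE u::real in lborel. False" by eventually_elim (use none in blast)
    moreover have "emeasure lborel (UNIV :: real set) \<noteq> 0" by simp
    ultimately show False using AE_iff_measurable[of "UNIV :: real set" lborel "\<lambda>_. False"] by simp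
  qed
  { assume null: "emeasure lborel B = 0"
    \<comment> \<open>For a fixed path, the shifts that move a given entry into \<open>B\<close>
      form a translate of the null set \<open>B\<close>, and there are countably many entries. A
      coffin entry merely adds the translate belonging to \<open>the None\<close>.\<close>
    have "AE u in lborel. \<not> hit (\<omega>, u)" if \<omega>: "\<omega> \<in> space W" for \<omega>
    proof -
      have "AE u in lborel. u + y \<notin> B" for y
      proof -
        have "{u. y + u \<in> B} \<in> sets borel"
        proof -
          have "{u \<in> space borel. y + u \<in> B} \<in> sets borel" by measurable
          then show ?thesis by simp
        qed
        then have "{u. y + u \<in> B} \<in> null_sets lborel"
          using emeasure_lborel_shift[OF B, of y] null by (intro null_setsI) auto
        from AE_not_in[OF this] show ?thesis by (simp add: add.commute)
      qed
      then have "AE u in lborel. u + the (S i \<omega>) \<notin> B" for i by simp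
      then have "AE u in lborel. \<forall>i. u + the (S i \<omega>) \<notin> B" unfolding AE_all_countable by blast
      then show ?thesis
      proof eventually_elim
        case (elim u)
        show ?case unfolding hit_def fst_conv snd_conv
        proof (intro notI, elim exE conjE)
          fix i y assume "S i \<omega> = Some y" "u + y \<in> B"
          then show False using spec[OF elim, of i] by simp
        qed
      qed
    qed
    then have "AE \<omega> in W. AE u in lborel. \<not> hit (\<omega>, u)" by (rule AE_I2)
    from ex[OF swap[of Not, OF this]] obtain u where "AE \<omega> in W. \<not> hit (\<omega>, u)" by blast
    then have "AE \<omega> in W. (\<lambda>x. u + x) ` M \<omega> \<inter> B = {}" unfolding conv by simp
    then show "AE \<omega> in W. M \<omega> \<inter> B = {}" using stationary_hit_shift(2)[OF W M(2) S B] by blast }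
  { assume dense: "dense_random_set W M" and pos: "emeasure lborel B \<noteq> 0"
    have "AE \<omega> in W. AE u in lborel. hit (\<omega>, u)"
      using dense[unfolded dense_random_set_def] eqM AE_space
    proof eventually_elim
      case (elim \<omega>)
      define C where "C = {u. \<not> hit (\<omega>, u)}"
      have [measurable]: "Measurable.pred borel (\<lambda>u. hit (\<omega>, u))"
      proof -
        have "Pair \<omega> \<in> measurable lborel (W \<Otimes>\<^sub>M lborel)" using elim by simp
        from measurable_compose[OF this mhit] show ?thesis by simp
      qed
      have "{u \<in> space borel. \<not> hit (\<omega>, u)} \<in> sets borel" by measurable
      then have C: "C \<in> sets borel" by (simp add: C_def)
      have "emeasure lborel C = 0"
      proof (rule null_translates_avoiding[OF B pos C elim(1)])
        fix u m assume "u \<in> C" "m \<in> M \<omega>"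
        then show "u + m \<notin> B" using elim(2) by (auto simp: C_def hit_def mem_seq_set)
      qed
      then have "AE u in lborel. u \<notin> C" using C by (intro AE_not_in null_setsI) auto
      then show ?case by eventually_elim (simp add: C_def)
    qed
    from ex[OF swap[of "\<lambda>b. b", OF this]] obtain u where "AE \<omega> in W. hit (\<omega>, u)" by blast
    then have "AE \<omega> in W. (\<lambda>x. u + x) ` M \<omega> \<inter> B \<noteq> {}" using conv[of "\<lambda>b. b"] by simp
    then show "AE \<omega> in W. M \<omega> \<inter> B \<noteq> {}" using stationary_hit_shift(1)[OF W M(2) S B] by blast }
qed

section \<open>Local stationary random sets\<close>

lemma dyadic_interval_avoiding:
  fixes x :: real
  assumes "finite F" "x \<notin> F"
  shows "\<exists>(m::nat) (a::int) b. a < b \<and> of_int a / 2 ^ m < x \<and> x < of_int b / 2 ^ m \<and>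
    F \<inter> {of_int a / 2 ^ m .. of_int b / 2 ^ m} = {}"
proof -
  obtain d where d: "d > 0" "\<And>y. y \<in> F \<Longrightarrow> d \<le> dist x y"
    using finite_set_avoid[OF assms(1), of x] assms(2) by metis
  obtain m where m: "(1 / 2 :: real) ^ m < d / 2"
    using real_arch_pow_inv[of "d / 2" "1 / 2"] d(1) by auto
  define q where "q = (2 :: real) ^ m"
  have q: "0 < q" "2 / q < d" using m by (auto simp: q_def power_one_over)
  \<comment> \<open>Subtracting 1 puts the left endpoint strictly below \<open>x\<close> even if
    \<open>x\<close> is a grid point; both endpoints are still within \<open>2 / q < d\<close> of
    \<open>x\<close>.\<close>
  define a where "a = \<lfloor>q * x\<rfloor> - 1"
  define b where "b = \<lfloor>q * x\<rfloor> + 1"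
  have ab: "of_int a < q * x" "q * x < of_int b" "q * x - 2 \<le> of_int a" "of_int b \<le> q * x + 1"
    unfolding a_def b_def by linarith+
  have lo: "of_int a / q < x" "x < of_int b / q" using ab q(1) by (simp_all add: divide_simps mult.commute)
  have "(q * x - 2) / q \<le> of_int a / q" "of_int b / q \<le> (q * x + 1) / q"
    using ab q(1) by (auto intro: divide_right_mono)
  then have "x - 2 / q \<le> of_int a / q" "of_int b / q \<le> x + 1 / q"
    using q(1) by (simp_all add: diff_divide_distrib add_divide_distrib)
  moreover have "1 / q \<le> 2 / q" using q(1) by (simp add: divide_right_mono)
  ultimately have hi: "x - d < of_int a / q" "of_int b / q < x + d" using q(2) by linarith+
  have "F \<inter> {of_int a / q .. of_int b / q} = {}"
  proof (rule ccontr)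
    assume "\<not> ?thesis"
    then obtain y where "y \<in> F" "of_int a / q \<le> y" "y \<le> of_int b / q" by auto
    with d(2)[of y] hi show False by (auto simp: dist_real_def)
  qed
  moreover have "a < b" by (simp add: a_def b_def)
  ultimately show ?thesis using lo unfolding q_def by blast
qed

lemma space_increment_field[simp]: "space (increment_field W s t) = Omega0"
  unfolding increment_field_def by (rule space_measure_of_conv)

lemma measurable_larger_field:
  assumes f: "f \<in> measurable (increment_field W s t) C" and S: "sigma_algebra Omega0 S" "sets (increment_field W s t) \<subseteq> S"
  shows "f \<in> measurable (sigma Omega0 S) C"
proof (rule measurableI)
  have sp: "space (sigma Omega0 S) = Omega0" by (rule space_measure_of_conv)
  have st: "sets (sigma Omega0 S) = S" by (rule sigma_algebra.sets_measure_of_eq[OF S(1)])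
  show "x \<in> space (sigma Omega0 S) \<Longrightarrow> f x \<in> space C" for x
    using measurable_space[OF f] sp by simp
  show "A \<in> sets C \<Longrightarrow> f -` A \<inter> space (sigma Omega0 S) \<in> sets (sigma Omega0 S)" for A
    using measurable_sets[OF f] S(2) sp st by auto
qed

text \<open>Picked points outside \<open>{s..t}\<close> are determined by the outer field, and the
  part of \<open>M\<close> inside by the inner one. By independence the history can be frozen, and a
  frozen history has a fixed Borel fibre, to which \<open>stationary_hits\<close> applies. The
  endpoints are excluded together with the interval since the outer enumerations list only points
  strictly left of \<open>s\<close> or strictly right of \<open>t\<close>.\<close>

lemma local_hits:
  fixes a b :: int and m :: nat
  assumes W: "two_sided_wiener_measure W" "prob_space W" "space W = Omega0"
    and M: "random_countable_set W M" "dense_random_set W M" "local_random_set W M" "stationary_in_law W M"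
    and T: "AE \<omega> in W. M \<omega> = range (\<lambda>i. T i \<omega>)"
    and ab: "a < b" and A: "A \<in> sets (seqM \<Otimes>\<^sub>M borel)"
  defines "s \<equiv> of_int a / 2 ^ m" and "t \<equiv> of_int b / 2 ^ m"
  shows "AE \<omega> in W. (\<forall>i\<in>set is. T i \<omega> \<notin> {s..t}) \<longrightarrow>
    ((\<exists>y\<in>M \<omega> \<inter> {s<..<t}. (pick is (\<lambda>i. T i \<omega>), y) \<in> A) \<longleftrightarrow>
      emeasure lborel (Pair (pick is (\<lambda>i. T i \<omega>)) -` A \<inter> {s<..<t}) \<noteq> 0)"
proof -
  interpret W: prob_space W by fact
  have st: "s < t" using ab by (simp add: s_def t_def divide_strict_right_mono)
  obtain Fi Fo where F: "sigma_algebra Omega0 Fi" "sigma_algebra Omega0 Fo" "W.indep_set Fi Fo"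
    "sets (increment_field W (ereal s) (ereal t)) \<subseteq> Fi"
    "sets (increment_field W (- \<infinity>) (ereal s)) \<subseteq> Fo"
    "sets (increment_field W (ereal t) \<infinity>) \<subseteq> Fo"
    using wiener_local_indep[OF W(1) ab, of m] unfolding s_def t_def by blast
  have FW: "Fi \<subseteq> sets W" "Fo \<subseteq> sets W" using F(3) unfolding W.indep_sets2_eq by auto
  have loc: "\<exists>S. measurable_enumeration W (increment_field W s' t') (\<lambda>\<omega>. M \<omega> \<inter> {x. s' < ereal x \<and> ereal x < t'}) S"
    if "s' < t'" for s' t' using M(3) that unfolding local_random_set_def by blast
  obtain V where V: "measurable_enumeration W (increment_field W (ereal s) (ereal t)) (\<lambda>\<omega>. M \<omega> \<inter> {x. ereal s < ereal x \<and> ereal x < ereal t}) V"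
    using loc[of "ereal s" "ereal t"] st by auto
  obtain Vm where Vm: "measurable_enumeration W (increment_field W (- \<infinity>) (ereal s)) (\<lambda>\<omega>. M \<omega> \<inter> {x. - \<infinity> < ereal x \<and> ereal x < ereal s}) Vm"
    using loc[of "- \<infinity>" "ereal s"] by auto
  obtain Vp where Vp: "measurable_enumeration W (increment_field W (ereal t) \<infinity>) (\<lambda>\<omega>. M \<omega> \<inter> {x. ereal t < ereal x \<and> ereal x < \<infinity>}) Vp"
    using loc[of "ereal t" "\<infinity>"] by auto
  have AV: "AE \<omega> in W. seq_set (\<lambda>i. V i \<omega>) = M \<omega> \<inter> {s<..<t}"
    using V unfolding measurable_enumeration_def by (auto elim!: eventually_mono simp: set_eq_iff)
  have AVm: "AE \<omega> in W. seq_set (\<lambda>i. Vm i \<omega>) = M \<omega> \<inter> {..<s}"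
    using Vm unfolding measurable_enumeration_def by (auto elim!: eventually_mono simp: set_eq_iff)
  have AVp: "AE \<omega> in W. seq_set (\<lambda>i. Vp i \<omega>) = M \<omega> \<inter> {t<..}"
    using Vp unfolding measurable_enumeration_def by (auto elim!: eventually_mono simp: set_eq_iff)
  let ?Mi = "sigma Omega0 Fi" and ?Mo = "sigma Omega0 Fo"
  have mV: "V i \<in> measurable ?Mi coffin_borel" for i
    using V unfolding measurable_enumeration_def by (intro measurable_larger_field[OF _ F(1,4)]) auto
  have mVm[measurable]: "Vm i \<in> measurable ?Mo coffin_borel" for i
    using Vm unfolding measurable_enumeration_def by (intro measurable_larger_field[OF _ F(2,5)]) auto
  have mVp[measurable]: "Vp i \<in> measurable ?Mo coffin_borel" for i
    using Vp unfolding measurable_enumeration_def by (intro measurable_larger_field[OF _ F(2,6)]) auto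
  define VV where "VV \<omega> = (\<lambda>i. V i \<omega>)" for \<omega>
  have mVV: "VV \<in> measurable ?Mi cseqM" unfolding VV_def by (rule measurable_PiM_single') (auto intro: mV)
  \<comment> \<open>Outside \<open>{s..t}\<close> the chosen values \<open>T i\<close> agree, for a random choice of indices \<open>c\<close> from a countable
    set, with the vector \<open>G c\<close>, which is independent of the values in the interval.\<close>
  define G where "G c \<omega> = (\<lambda>n. if n < length c then the ((if fst (c ! n) then Vm else Vp) (snd (c ! n)) \<omega>) else 0)"
    for c :: "(bool \<times> nat) list" and \<omega>
  have mG: "G c \<in> measurable ?Mo seqM" for c unfolding G_def
  proof (rule measurable_PiM_single')
    fix n
    have "(\<lambda>\<omega>. the ((if fst (c ! n) then Vm else Vp) (snd (c ! n)) \<omega>)) \<in> borel_measurable ?Mo"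
      by (cases "fst (c ! n)") simp_all
    then show "(\<lambda>\<omega>. if n < length c then the ((if fst (c ! n) then Vm else Vp) (snd (c ! n)) \<omega>) else 0) \<in> borel_measurable ?Mo"
      by (cases "n < length c") simp_all
  qed auto
  have up: "f \<in> measurable W C" if f: "f \<in> measurable (sigma Omega0 S) C" and S: "sigma_algebra Omega0 S" "S \<subseteq> sets W" for f C S
  proof (rule measurableI)
    show "x \<in> space W \<Longrightarrow> f x \<in> space C" for x using measurable_space[OF f] W(3) by (simp add: space_measure_of_conv)
    show "B \<in> sets C \<Longrightarrow> f -` B \<inter> space W \<in> sets W" for B
      using measurable_sets[OF f] S(2) W(3) by (auto simp: space_measure_of_conv sigma_algebra.sets_measure_of_eq[OF S(1)])
  qed
  have mVVW: "VV \<in> measurable W cseqM" by (rule up[OF mVV F(1) FW(1)])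
  have mGW: "G c \<in> measurable W seqM" for c by (rule up[OF mG F(2) FW(2)])
  have law: "distr W seqM (G c) \<Otimes>\<^sub>M distr W cseqM VV = distr W (seqM \<Otimes>\<^sub>M cseqM) (\<lambda>\<omega>. (G c \<omega>, VV \<omega>))" for c
  proof -
    interpret DG: prob_space "distr W seqM (G c)" by (rule W.prob_space_distr[OF mGW])
    interpret DV: prob_space "distr W cseqM VV" by (rule W.prob_space_distr[OF mVVW])
    have mgv: "(\<lambda>\<omega>. (G c \<omega>, VV \<omega>)) \<in> measurable W (seqM \<Otimes>\<^sub>M cseqM)" by (intro measurable_Pair mGW mVVW)
    show ?thesis
    proof (rule pair_measure_eqI[OF DG.sigma_finite_measure_axioms DV.sigma_finite_measure_axioms])
      show "sets (distr W seqM (G c) \<Otimes>\<^sub>M distr W cseqM VV) = sets (distr W (seqM \<Otimes>\<^sub>M cseqM) (\<lambda>\<omega>. (G c \<omega>, VV \<omega>)))"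
        unfolding sets_distr by (rule sets_pair_measure_cong) (rule sets_distr)+
      fix E E' assume E: "E \<in> sets (distr W seqM (G c))" and E': "E' \<in> sets (distr W cseqM VV)"
      have mE: "G c -` E \<inter> space W \<in> Fo" "VV -` E' \<inter> space W \<in> Fi"
        using measurable_sets[OF mG, of E c] measurable_sets[OF mVV, of E'] E E' W(3)
        by (simp_all add: space_measure_of_conv sigma_algebra.sets_measure_of_eq[OF F(1)] sigma_algebra.sets_measure_of_eq[OF F(2)])
      have "W.prob ((VV -` E' \<inter> space W) \<inter> (G c -` E \<inter> space W)) = W.prob (VV -` E' \<inter> space W) * W.prob (G c -` E \<inter> space W)"
        using F(3) mE unfolding W.indep_sets2_eq by blast
      moreover have "(VV -` E' \<inter> space W) \<inter> (G c -` E \<inter> space W) = (\<lambda>\<omega>. (G c \<omega>, VV \<omega>)) -` (E \<times> E') \<inter> space W" by auto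
      ultimately have "W.prob ((\<lambda>\<omega>. (G c \<omega>, VV \<omega>)) -` (E \<times> E') \<inter> space W) = W.prob (G c -` E \<inter> space W) * W.prob (VV -` E' \<inter> space W)"
        by (simp add: mult.commute)
      moreover have "E \<times> E' \<in> sets (seqM \<Otimes>\<^sub>M cseqM)" using E E' by (intro pair_measureI) auto
      ultimately show "emeasure (distr W seqM (G c)) E * emeasure (distr W cseqM VV) E' = emeasure (distr W (seqM \<Otimes>\<^sub>M cseqM) (\<lambda>\<omega>. (G c \<omega>, VV \<omega>))) (E \<times> E')"
        using E E' emeasure_distr[OF mGW, of E c] emeasure_distr[OF mVVW, of E'] emeasure_distr[OF mgv, of "E \<times> E'"]
        by (simp add: W.emeasure_eq_measure ennreal_mult)
    qed
  qed
  define J where "J = {s<..<t}"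
  \<comment> \<open>With fibres cut down to \<open>J\<close>, being hit by \<open>M\<close> and
    being hit by the part of \<open>M\<close> inside the interval are the same, so the dichotomy for
    \<open>M\<close> becomes a statement about \<open>VV\<close>.\<close>
  define AJ where "AJ = A \<inter> (UNIV \<times> J)"
  have UJ: "UNIV \<times> J \<in> sets (seqM \<Otimes>\<^sub>M borel)"
    using sets.top[of seqM] by (intro pair_measureI) (auto simp: J_def space_PiM)
  have AJ: "AJ \<in> sets (seqM \<Otimes>\<^sub>M borel)" unfolding AJ_def using A UJ by (rule sets.Int)
  have secAJ: "Pair g -` AJ = Pair g -` A \<inter> J" for g by (auto simp: AJ_def)
  define hit where "hit x \<longleftrightarrow> (\<exists>i y. snd x i = Some y \<and> (fst x, y) \<in> AJ)" for x :: "(nat \<Rightarrow> real) \<times> (nat \<Rightarrow> real option)"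
  have mhit: "Measurable.pred (seqM \<Otimes>\<^sub>M cseqM) hit"
  proof -
    have "Measurable.pred (seqM \<Otimes>\<^sub>M cseqM) (\<lambda>x. \<exists>y. snd x i = Some y \<and> (fst x, y) \<in> AJ)" for i
    proof (rule pred_Some_in_coffin)
      show m: "(\<lambda>x. snd x i) \<in> measurable (seqM \<Otimes>\<^sub>M cseqM) coffin_borel"
        by (rule measurable_compose[OF measurable_snd]) simp
      have "(\<lambda>x. (fst x, the (snd x i))) \<in> measurable (seqM \<Otimes>\<^sub>M cseqM) (seqM \<Otimes>\<^sub>M borel)"
        by (intro measurable_Pair measurable_fst measurable_compose[OF m measurable_the_coffin])
      from measurable_sets[OF this AJ]
      show "Measurable.pred (seqM \<Otimes>\<^sub>M cseqM) (\<lambda>x. (fst x, the (snd x i)) \<in> AJ)"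
        by (simp add: pred_def vimage_def Int_def conj_commute)
    qed
    then show ?thesis unfolding hit_def[abs_def] by (rule pred_intros_countable)
  qed
  define \<Psi> where "\<Psi> x \<longleftrightarrow> (hit x \<longleftrightarrow> emeasure lborel (Pair (fst x) -` AJ) \<noteq> 0)" for x
  have m\<Psi>: "Measurable.pred (seqM \<Otimes>\<^sub>M cseqM) \<Psi>"
  proof -
    have "(\<lambda>g. emeasure lborel (Pair g -` AJ)) \<in> borel_measurable seqM"
      by (rule lborel.measurable_emeasure_Pair) (use AJ in simp)
    from measurable_compose[OF measurable_fst this]
    have [measurable]: "(\<lambda>x. emeasure lborel (Pair (fst x) -` AJ)) \<in> borel_measurable (seqM \<Otimes>\<^sub>M cseqM)" .
    note mhit[measurable]
    show ?thesis unfolding \<Psi>_def[abs_def] by measurable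
  qed
  have \<Psi>g: "AE \<omega> in W. \<Psi> (g, VV \<omega>)" for g
  proof -
    have B: "Pair g -` AJ \<in> sets borel" by (rule sets_Pair1[OF AJ])
    have hg: "hit (g, VV \<omega>) \<longleftrightarrow> M \<omega> \<inter> Pair g -` AJ \<noteq> {}" if "seq_set (\<lambda>i. V i \<omega>) = M \<omega> \<inter> {s<..<t}" for \<omega>
    proof -
      have "hit (g, VV \<omega>) \<longleftrightarrow> seq_set (\<lambda>i. V i \<omega>) \<inter> Pair g -` AJ \<noteq> {}"
        unfolding hit_def hit_seq_set_iff VV_def by simp
      also have "\<dots> \<longleftrightarrow> M \<omega> \<inter> Pair g -` AJ \<noteq> {}" unfolding that secAJ J_def by blast
      finally show ?thesis .
    qed
    show ?thesis
    proof (cases "emeasure lborel (Pair g -` AJ) = 0")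
      case True
      from stationary_hits(1)[OF W(2) M(1,4) B True] AV show ?thesis
        by eventually_elim (simp add: \<Psi>_def hg True)
    next
      case False
      from stationary_hits(2)[OF W(2) M(1,4) B M(2) False] AV show ?thesis
        by eventually_elim (simp add: \<Psi>_def hg False)
    qed
  qed
  \<comment> \<open>The exceptional set is null for every frozen history \<open>g\<close>, hence
    null for the product law, and by independence the product law is the joint law.\<close>
  have \<Psi>G: "AE \<omega> in W. \<Psi> (G c \<omega>, VV \<omega>)" for c
  proof -
    interpret DG: prob_space "distr W seqM (G c)" by (rule W.prob_space_distr[OF mGW])
    interpret DV: prob_space "distr W cseqM VV" by (rule W.prob_space_distr[OF mVVW])
    interpret DD: pair_sigma_finite "distr W seqM (G c)" "distr W cseqM VV" ..
    have mgv: "(\<lambda>\<omega>. (G c \<omega>, VV \<omega>)) \<in> measurable W (seqM \<Otimes>\<^sub>M cseqM)" by (intro measurable_Pair mGW mVVW)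
    have "AE x in distr W seqM (G c) \<Otimes>\<^sub>M distr W cseqM VV. \<Psi> x"
    proof (rule DD.AE_pair_measure)
      have "sets (distr W seqM (G c) \<Otimes>\<^sub>M distr W cseqM VV) = sets (seqM \<Otimes>\<^sub>M cseqM)"
        by (intro sets_pair_measure_cong) auto
      then show "{x \<in> space (distr W seqM (G c) \<Otimes>\<^sub>M distr W cseqM VV). \<Psi> x} \<in> sets (distr W seqM (G c) \<Otimes>\<^sub>M distr W cseqM VV)"
        using m\<Psi> by (simp add: pred_def space_pair_measure)
      show "AE g in distr W seqM (G c). AE v in distr W cseqM VV. \<Psi> (g, v)"
      proof (rule AE_I2)
        fix g
        have "Pair g \<in> measurable cseqM (seqM \<Otimes>\<^sub>M cseqM)" by (intro measurable_Pair1') (simp add: space_PiM)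
        from measurable_compose[OF this m\<Psi>] have "Measurable.pred cseqM (\<lambda>v. \<Psi> (g, v))" .
        then show "AE v in distr W cseqM VV. \<Psi> (g, v)"
          using \<Psi>g[of g] by (subst AE_distr_iff[OF mVVW]) (simp_all add: pred_def)
      qed
    qed
    then show ?thesis unfolding law by (rule AE_distrD[OF mgv])
  qed
  \<comment> \<open>The list \<open>c\<close> that reproduces the picked points depends on the path;
    since there are only countably many lists, all of them are treated at once.\<close>
  have "AE \<omega> in W. \<forall>c. \<Psi> (G c \<omega>, VV \<omega>)" unfolding AE_all_countable using \<Psi>G by blast
  then show ?thesis using AV AVm AVp T
  proof eventually_elim
    case (elim \<omega>)
    show ?case
    proof (intro impI)
      assume out: "\<forall>i\<in>set is. T i \<omega> \<notin> {s..t}"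
      have "\<exists>p. (if fst p then Vm else Vp) (snd p) \<omega> = Some (T i \<omega>)" if "i \<in> set is" for i
      proof -
        have "T i \<omega> < s \<or> t < T i \<omega>" using out that by force
        then show ?thesis
        proof
          assume "T i \<omega> < s"
          then have "T i \<omega> \<in> seq_set (\<lambda>i. Vm i \<omega>)" using elim by auto
          then obtain k where "Vm k \<omega> = Some (T i \<omega>)" unfolding mem_seq_set by blast
          then show ?thesis by (intro exI[of _ "(True, k)"]) simp
        next
          assume "t < T i \<omega>"
          then have "T i \<omega> \<in> seq_set (\<lambda>i. Vp i \<omega>)" using elim by auto
          then obtain k where "Vp k \<omega> = Some (T i \<omega>)" unfolding mem_seq_set by blast
          then show ?thesis by (intro exI[of _ "(False, k)"]) simp
        qed
      qed
      then obtain p where p: "\<And>i. i \<in> set is \<Longrightarrow> (if fst (p i) then Vm else Vp) (snd (p i)) \<omega> = Some (T i \<omega>)" by metis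
      have GH: "G (map p is) \<omega> = pick is (\<lambda>i. T i \<omega>)"
      proof
        fix n show "G (map p is) \<omega> n = pick is (\<lambda>i. T i \<omega>) n"
          using p[of "is ! n"] by (cases "n < length is") (simp_all add: G_def pick_def)
      qed
      have "hit (pick is (\<lambda>i. T i \<omega>), VV \<omega>) \<longleftrightarrow> emeasure lborel (Pair (pick is (\<lambda>i. T i \<omega>)) -` AJ) \<noteq> 0"
        using spec[OF elim(1), of "map p is"] unfolding GH \<Psi>_def by simp
      moreover have "hit (pick is (\<lambda>i. T i \<omega>), VV \<omega>) \<longleftrightarrow> (\<exists>y\<in>M \<omega> \<inter> {s<..<t}. (pick is (\<lambda>i. T i \<omega>), y) \<in> A)"
      proof -
        have mem: "(\<exists>i. V i \<omega> = Some y) \<longleftrightarrow> y \<in> M \<omega> \<inter> {s<..<t}" for y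
          using elim(2) mem_seq_set[of y "\<lambda>i. V i \<omega>"] by simp
        have "hit (pick is (\<lambda>i. T i \<omega>), VV \<omega>) \<longleftrightarrow> (\<exists>y. (\<exists>i. V i \<omega> = Some y) \<and> (pick is (\<lambda>i. T i \<omega>), y) \<in> AJ)"
          unfolding hit_def VV_def fst_conv snd_conv by blast
        also have "\<dots> \<longleftrightarrow> (\<exists>y\<in>M \<omega> \<inter> {s<..<t}. (pick is (\<lambda>i. T i \<omega>), y) \<in> A)"
          unfolding mem AJ_def J_def by blast
        finally show ?thesis .
      qed
      ultimately show "(\<exists>y\<in>M \<omega> \<inter> {s<..<t}. (pick is (\<lambda>i. T i \<omega>), y) \<in> A) \<longleftrightarrow>
        emeasure lborel (Pair (pick is (\<lambda>i. T i \<omega>)) -` A \<inter> {s<..<t}) \<noteq> 0" unfolding secAJ J_def by blast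
    qed
  qed
qed


text \<open>The dyadic intervals whose closure misses the history form a countable cover of its
  complement. A value outside the history lies in one of them, and a non-null fibre has a non-null
  part in one of them because the finitely many points of the history are negligible.\<close>

lemma local_sample_like:
  assumes W: "two_sided_wiener_measure W" "prob_space W" "space W = Omega0"
    and M: "random_countable_set W M" "dense_random_set W M" "local_random_set W M" "stationary_in_law W M"
    and T: "\<And>i. T i \<in> borel_measurable W" "AE \<omega> in W. M \<omega> = range (\<lambda>i. T i \<omega>)"
  shows "sample_like W T"
proof -
  \<comment> \<open>Level and numerators form a single index \<open>p\<close> of countable type, so
    the exceptional sets of all intervals can be united.\<close>
  define lo where "lo p = (of_int (fst (snd p)) / 2 ^ fst p :: real)" for p :: "nat \<times> int \<times> int"
  define hi where "hi p = (of_int (snd (snd p)) / 2 ^ fst p :: real)" for p :: "nat \<times> int \<times> int"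
  have cover: "\<exists>p. fst (snd p) < snd (snd p) \<and> lo p < x \<and> x < hi p \<and> F \<inter> {lo p..hi p} = {}" if "finite F" "x \<notin> F" for F and x :: real
  proof -
    note Fx = that
    obtain m a b where "(a::int) < b" "of_int a / 2 ^ m < x" "x < of_int b / 2 ^ m" "F \<inter> {of_int a / 2 ^ m .. of_int b / 2 ^ m} = {}"
      using dyadic_interval_avoiding[OF Fx] by blast
    then show ?thesis by (intro exI[of _ "(m, a, b)"]) (simp add: lo_def hi_def)
  qed
  have key: "AE \<omega> in W. \<forall>p. fst (snd p) < snd (snd p) \<longrightarrow> (\<forall>i\<in>set is. T i \<omega> \<notin> {lo p..hi p}) \<longrightarrow>
    ((\<exists>y\<in>M \<omega> \<inter> {lo p<..<hi p}. (pick is (\<lambda>i. T i \<omega>), y) \<in> A) \<longleftrightarrow>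
      emeasure lborel (Pair (pick is (\<lambda>i. T i \<omega>)) -` A \<inter> {lo p<..<hi p}) \<noteq> 0)"
    if A: "A \<in> sets (seqM \<Otimes>\<^sub>M borel)" for "is" A
    unfolding AE_all_countable
  proof
    fix p :: "nat \<times> int \<times> int"
    show "AE \<omega> in W. fst (snd p) < snd (snd p) \<longrightarrow> (\<forall>i\<in>set is. T i \<omega> \<notin> {lo p..hi p}) \<longrightarrow>
    ((\<exists>y\<in>M \<omega> \<inter> {lo p<..<hi p}. (pick is (\<lambda>i. T i \<omega>), y) \<in> A) \<longleftrightarrow>
      emeasure lborel (Pair (pick is (\<lambda>i. T i \<omega>)) -` A \<inter> {lo p<..<hi p}) \<noteq> 0)"
    proof (cases "fst (snd p) < snd (snd p)")
      case True
      from local_hits[OF W M T(2) True A, of "is" "fst p"]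
      show ?thesis unfolding lo_def hi_def by eventually_elim blast
    qed simp
  qed
  show ?thesis
  proof (rule sample_likeI[OF T(1)])
    fix "is" j and A :: "((nat \<Rightarrow> real) \<times> real) set" assume A: "A \<in> sets (seqM \<Otimes>\<^sub>M borel)"
    show "AE \<omega> in W. emeasure lborel (Pair (pick is (\<lambda>i. T i \<omega>)) -` A) = 0 \<longrightarrow>
         T j \<omega> \<notin> (\<lambda>i. T i \<omega>) ` set is \<longrightarrow> (pick is (\<lambda>i. T i \<omega>), T j \<omega>) \<notin> A"
      using key[OF A, of "is"] T(2)
    proof eventually_elim
      case (elim \<omega>)
      define h where "h = pick is (\<lambda>i. T i \<omega>)"
      show ?case unfolding h_def[symmetric]
      proof (intro impI)
        assume null: "emeasure lborel (Pair h -` A) = 0" and j: "T j \<omega> \<notin> (\<lambda>i. T i \<omega>) ` set is"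
        obtain p where p: "fst (snd p) < snd (snd p)" "lo p < T j \<omega>" "T j \<omega> < hi p" "(\<lambda>i. T i \<omega>) ` set is \<inter> {lo p..hi p} = {}"
          using cover[of "(\<lambda>i. T i \<omega>) ` set is" "T j \<omega>"] j by auto
        have "emeasure lborel (Pair h -` A \<inter> {lo p<..<hi p}) \<le> emeasure lborel (Pair h -` A)"
          using sets_Pair1[OF A, of h] by (intro emeasure_mono) auto
        then have "emeasure lborel (Pair h -` A \<inter> {lo p<..<hi p}) = 0" using null by simp
        moreover have "\<forall>i\<in>set is. T i \<omega> \<notin> {lo p..hi p}" using p(4) by blast
        ultimately have "\<not> (\<exists>y\<in>M \<omega> \<inter> {lo p<..<hi p}. (h, y) \<in> A)"
          using spec[OF elim(1), of p] p(1) unfolding h_def[symmetric] by blast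
        moreover have "T j \<omega> \<in> M \<omega> \<inter> {lo p<..<hi p}" using p elim(2) by auto
        ultimately show "(h, T j \<omega>) \<notin> A" by blast
      qed
    qed
  next
    fix "is" and A :: "((nat \<Rightarrow> real) \<times> real) set" assume A: "A \<in> sets (seqM \<Otimes>\<^sub>M borel)"
    show "AE \<omega> in W. emeasure lborel (Pair (pick is (\<lambda>i. T i \<omega>)) -` A) \<noteq> 0 \<longrightarrow>
         (\<exists>j. (pick is (\<lambda>i. T i \<omega>), T j \<omega>) \<in> A)"
      using key[OF A, of "is"] T(2)
    proof eventually_elim
      case (elim \<omega>)
      define h where "h = pick is (\<lambda>i. T i \<omega>)"
      define F where "F = (\<lambda>i. T i \<omega>) ` set is"
      have F: "finite F" by (simp add: F_def)
      show ?case unfolding h_def[symmetric]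
      proof
        assume nonnull: "emeasure lborel (Pair h -` A) \<noteq> 0"
        have hA: "Pair h -` A \<in> sets borel" by (rule sets_Pair1[OF A])
        define I where "I = {p. fst (snd p) < snd (snd p) \<and> F \<inter> {lo p..hi p} = {}}"
        have "\<exists>p\<in>I. emeasure lborel (Pair h -` A \<inter> {lo p<..<hi p}) \<noteq> 0"
        proof (rule ccontr)
          assume none: "\<not> ?thesis"
          have "F \<in> null_sets lborel" using F by (rule finite_imp_null_set_lborel)
          moreover have "(\<Union>p\<in>I. Pair h -` A \<inter> {lo p<..<hi p}) \<in> null_sets lborel"
          proof (rule null_sets_UN')
            fix p assume "p \<in> I"
            then show "Pair h -` A \<inter> {lo p<..<hi p} \<in> null_sets lborel"
              using none hA by (intro null_setsI) auto
          qed simp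
          ultimately have "F \<union> (\<Union>p\<in>I. Pair h -` A \<inter> {lo p<..<hi p}) \<in> null_sets lborel" by (rule null_sets.Un)
          moreover have "Pair h -` A \<subseteq> F \<union> (\<Union>p\<in>I. Pair h -` A \<inter> {lo p<..<hi p})"
          proof
            fix x assume x: "x \<in> Pair h -` A"
            show "x \<in> F \<union> (\<Union>p\<in>I. Pair h -` A \<inter> {lo p<..<hi p})"
            proof (cases "x \<in> F")
              case False
              from cover[OF F this] obtain p where "p \<in> I" "x \<in> {lo p<..<hi p}" unfolding I_def by auto
              with x show ?thesis by blast
            qed blast
          qed
          ultimately have "Pair h -` A \<in> null_sets lborel" using hA by (intro null_sets_subset[of _ lborel "Pair h -` A"]) auto
          with nonnull show False by (simp add: null_setsD1)
        qed
        then obtain p where p: "p \<in> I" "emeasure lborel (Pair h -` A \<inter> {lo p<..<hi p}) \<noteq> 0" by blast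
        have "\<forall>i\<in>set is. T i \<omega> \<notin> {lo p..hi p}" using p(1) unfolding I_def F_def by blast
        moreover have "fst (snd p) < snd (snd p)" using p(1) by (simp add: I_def)
        ultimately have "\<exists>y\<in>M \<omega> \<inter> {lo p<..<hi p}. (h, y) \<in> A"
          using spec[OF elim(1), of p] p(2) unfolding h_def[symmetric] by blast
        then show "\<exists>j. (h, T j \<omega>) \<in> A" using elim(2) by auto
      qed
    qed
  qed
qed

section \<open>Enumerations without coffin state, and transport of couplings\<close>

lemma two_sided_wiener_measureD:
  assumes "two_sided_wiener_measure W"
  shows "prob_space W" "space W = Omega0"
proof -
  obtain P where "prob_space P" "space P = Omega0" "W = completion P"
    using assms unfolding two_sided_wiener_measure_def by blast
  then show "prob_space W" "space W = Omega0" by (auto intro: prob_space.prob_space_completion)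
qed

lemma infinite_of_closure_UNIV:
  fixes A :: "real set"
  assumes "closure A = UNIV" shows "infinite A"
proof
  assume "finite A"
  then have "closure A = A" by (simp add: finite_imp_closed)
  with \<open>finite A\<close> assms show False using infinite_UNIV_char_0[where 'a=real] by simp
qed

text \<open>A dense set is infinite, so beyond every index there is an entry other than the coffin
  state; \<open>T i\<close> is the first such entry from index \<open>i\<close> on. Entries may be
  repeated, but none is lost: if \<open>S j\<close> is a real then \<open>L j = j\<close>.\<close>

lemma real_enumeration:
  assumes S: "measurable_enumeration W W M S" and dense: "dense_random_set W M"
  obtains T :: "nat \<Rightarrow> (real \<Rightarrow> real) \<Rightarrow> real" where "\<And>i. T i \<in> borel_measurable W" "AE \<omega> in W. M \<omega> = range (\<lambda>i. T i \<omega>)"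
    "AE \<omega> in W. seq_set (\<lambda>i. S i \<omega>) = range (\<lambda>i. T i \<omega>)"
proof -
  define L :: "nat \<Rightarrow> (real \<Rightarrow> real) \<Rightarrow> nat" where "L i \<omega> = (LEAST j. i \<le> j \<and> S j \<omega> \<noteq> None)" for i \<omega>
  define T where "T i \<omega> = the (S (L i \<omega>) \<omega>)" for i \<omega>
  note mS = measurable_enumerationD(1)[OF S]
  have "Measurable.pred W (\<lambda>\<omega>. i \<le> j \<and> S j \<omega> \<noteq> None)" for i j
    by (intro pred_intros_logic pred_eq_None_coffin mS) simp
  then have mL: "L i \<in> measurable W (count_space UNIV)" for i
    unfolding L_def by (rule measurable_Least)
  have "T i \<in> borel_measurable W" for i
    unfolding T_def by (rule measurable_compose_countable[OF _ mL]) (rule measurable_compose[OF mS measurable_the_coffin])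
  moreover have ran: "AE \<omega> in W. M \<omega> = range (\<lambda>i. T i \<omega>)"
    using measurable_enumerationD(2)[OF S] dense[unfolded dense_random_set_def]
  proof eventually_elim
    case (elim \<omega>)
    have inf: "infinite (seq_set (\<lambda>i. S i \<omega>))" using infinite_of_closure_UNIV[OF elim(2)] elim(1) by simp
    have ex: "\<exists>j. i \<le> j \<and> S j \<omega> \<noteq> None" for i
    proof (rule ccontr)
      assume none: "\<not> ?thesis"
      have "seq_set (\<lambda>i. S i \<omega>) \<subseteq> (\<lambda>j. the (S j \<omega>)) ` {..<i}"
      proof
        fix y assume "y \<in> seq_set (\<lambda>i. S i \<omega>)"
        then obtain j where j: "S j \<omega> = Some y" unfolding mem_seq_set by blast
        with none have "j < i" by (metis not_le option.distinct(1))
        then show "y \<in> (\<lambda>j. the (S j \<omega>)) ` {..<i}" using j by (intro image_eqI[of _ _ j]) auto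
      qed
      then show False using inf finite_subset by blast
    qed
    have sL: "S (L i \<omega>) \<omega> = Some (T i \<omega>)" for i
      using LeastI_ex[OF ex[of i]] unfolding T_def L_def by auto
    have "seq_set (\<lambda>i. S i \<omega>) = range (\<lambda>i. T i \<omega>)"
    proof (intro equalityI subsetI)
      fix y assume "y \<in> seq_set (\<lambda>i. S i \<omega>)"
      then obtain j where j: "S j \<omega> = Some y" unfolding mem_seq_set by blast
      then have "L j \<omega> = j" unfolding L_def by (intro Least_equality) auto
      then have "T j \<omega> = y" using j by (simp add: T_def)
      then show "y \<in> range (\<lambda>i. T i \<omega>)" by blast
    next
      fix y assume "y \<in> range (\<lambda>i. T i \<omega>)"
      then show "y \<in> seq_set (\<lambda>i. S i \<omega>)" unfolding mem_seq_set using sL by blast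
    qed
    then show ?case using elim(1) by simp
  qed
  moreover have "AE \<omega> in W. seq_set (\<lambda>i. S i \<omega>) = range (\<lambda>i. T i \<omega>)"
    using ran measurable_enumerationD(2)[OF S] by eventually_elim simp
  ultimately show thesis by (rule that)
qed

lemma is_coupling_distr_snd:
  assumes R: "is_coupling R P Q" and f: "f \<in> measurable Q N"
  shows "is_coupling (distr R (P \<Otimes>\<^sub>M N) (\<lambda>x. (fst x, f (snd x)))) P (distr Q N f)"
proof -
  have sR: "sets R = sets (P \<Otimes>\<^sub>M Q)" and P: "distr R P fst = P" and Q: "distr R Q snd = Q" and pR: "prob_space R"
    using R by (auto simp: is_coupling_def)
  have m: "fst \<in> measurable R P" "snd \<in> measurable R Q" by (simp_all add: measurable_cong_sets[OF sR refl])
  have mf: "(\<lambda>x. (fst x, f (snd x))) \<in> measurable R (P \<Otimes>\<^sub>M N)"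
    by (intro measurable_Pair m measurable_compose[OF m(2) f])
  let ?R = "distr R (P \<Otimes>\<^sub>M N) (\<lambda>x. (fst x, f (snd x)))"
  show ?thesis unfolding is_coupling_def
  proof (intro conjI)
    show "prob_space ?R" by (rule prob_space.prob_space_distr[OF pR mf])
    show "sets ?R = sets (P \<Otimes>\<^sub>M distr Q N f)" unfolding sets_distr
      by (rule sets_pair_measure_cong[OF refl sets_distr[symmetric]])
    have "distr ?R P fst = distr R P (fst \<circ> (\<lambda>x. (fst x, f (snd x))))" by (rule distr_distr[OF measurable_fst mf])
    also have "\<dots> = distr R P fst" by (simp add: comp_def)
    finally show "distr ?R P fst = P" using P by simp
    have "distr ?R (distr Q N f) snd = distr ?R N snd" by (rule distr_cong) auto
    also have "\<dots> = distr R N (snd \<circ> (\<lambda>x. (fst x, f (snd x))))" by (rule distr_distr[OF measurable_snd mf])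
    also have "\<dots> = distr R N (f \<circ> snd)" by (simp add: comp_def)
    also have "\<dots> = distr (distr R Q snd) N f" by (rule distr_distr[OF f m(2), symmetric])
    finally show "distr ?R (distr Q N f) snd = distr Q N f" unfolding Q .
  qed
qed

lemma is_coupling_swap:
  assumes R: "is_coupling R P Q"
  shows "is_coupling (distr R (Q \<Otimes>\<^sub>M P) (\<lambda>x. (snd x, fst x))) Q P"
proof -
  have sR: "sets R = sets (P \<Otimes>\<^sub>M Q)" and P: "distr R P fst = P" and Q: "distr R Q snd = Q" and pR: "prob_space R"
    using R by (auto simp: is_coupling_def)
  have m: "fst \<in> measurable R P" "snd \<in> measurable R Q" by (simp_all add: measurable_cong_sets[OF sR refl])
  have ms: "(\<lambda>x. (snd x, fst x)) \<in> measurable R (Q \<Otimes>\<^sub>M P)" by (intro measurable_Pair m)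
  let ?R = "distr R (Q \<Otimes>\<^sub>M P) (\<lambda>x. (snd x, fst x))"
  show ?thesis unfolding is_coupling_def
  proof (intro conjI)
    show "prob_space ?R" by (rule prob_space.prob_space_distr[OF pR ms])
    show "sets ?R = sets (Q \<Otimes>\<^sub>M P)" by (rule sets_distr)
    have "distr ?R Q fst = distr R Q snd" unfolding distr_distr[OF measurable_fst ms] by (simp add: comp_def)
    then show "distr ?R Q fst = Q" unfolding Q .
    have "distr ?R P snd = distr R P fst" unfolding distr_distr[OF measurable_snd ms] by (simp add: comp_def)
    then show "distr ?R P snd = P" unfolding P .
  qed
qed

text \<open>Inclusion in both directions is tested entry by entry; the alternative
  \<open>None\<close> keeps the unspecified value of \<open>the None\<close> out of the
  test.\<close>

lemma pred_seq_set_eq: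
  assumes s: "\<And>i. (\<lambda>x. s x i) \<in> measurable M coffin_borel" and t: "\<And>i. (\<lambda>x. t x i) \<in> measurable M coffin_borel"
  shows "Measurable.pred M (\<lambda>x. seq_set (s x) = seq_set (t x))"
proof -
  have p: "Measurable.pred M (\<lambda>x. \<forall>i. f x i = None \<or> (\<exists>j. g x j = Some (the (f x i))))"
    if "\<And>i. (\<lambda>x. f x i) \<in> measurable M coffin_borel" "\<And>i. (\<lambda>x. g x i) \<in> measurable M coffin_borel"
    for f g :: "_ \<Rightarrow> nat \<Rightarrow> real option"
  proof (rule pred_intros_countable(1), rule pred_intros_logic(5))
    fix i
    show "Measurable.pred M (\<lambda>x. f x i = None)" by (rule pred_eq_None_coffin) (rule that)
    show "Measurable.pred M (\<lambda>x. \<exists>j. g x j = Some (the (f x i)))"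
      by (rule pred_intros_countable(2), rule pred_eq_Some_coffin[OF that(2)])
         (rule measurable_compose[OF that(1) measurable_the_coffin])
  qed
  have sub: "seq_set a \<subseteq> seq_set b \<longleftrightarrow> (\<forall>i. a i = None \<or> (\<exists>j. b j = Some (the (a i))))" for a b :: "nat \<Rightarrow> real option"
  proof
    assume sub: "seq_set a \<subseteq> seq_set b"
    show "\<forall>i. a i = None \<or> (\<exists>j. b j = Some (the (a i)))"
    proof
      fix i show "a i = None \<or> (\<exists>j. b j = Some (the (a i)))"
      proof (cases "a i")
        case (Some y)
        then have "y \<in> seq_set b" using sub mem_seq_set[of y a] by blast
        then show ?thesis using Some unfolding mem_seq_set by simp
      qed simp
    qed
  next
    assume "\<forall>i. a i = None \<or> (\<exists>j. b j = Some (the (a i)))"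
    then have *: "a i = None \<or> (\<exists>j. b j = Some (the (a i)))" for i by blast
    show "seq_set a \<subseteq> seq_set b"
    proof
      fix y assume "y \<in> seq_set a"
      then obtain i where "a i = Some y" unfolding mem_seq_set by blast
      with *[of i] show "y \<in> seq_set b" unfolding mem_seq_set by simp
    qed
  qed
  have "Measurable.pred M (\<lambda>x. seq_set (s x) \<subseteq> seq_set (t x) \<and> seq_set (t x) \<subseteq> seq_set (s x))"
    unfolding sub by (rule pred_intros_logic(3)[OF p[OF s t] p[OF t s]])
  moreover have "(\<lambda>x. seq_set (s x) = seq_set (t x)) =
      (\<lambda>x. seq_set (s x) \<subseteq> seq_set (t x) \<and> seq_set (t x) \<subseteq> seq_set (s x))"
    by (intro ext set_eq_subset)
  ultimately show ?thesis by (rule ssubst[rotated])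
qed

theorem proposition3p15:
  fixes W :: "(real \<Rightarrow> real) measure" and M\<^sub>1 M\<^sub>2 :: random_set
  assumes "two_sided_wiener_measure W"
    and "random_countable_set W M\<^sub>1" and "dense_random_set W M\<^sub>1"
    and "local_random_set W M\<^sub>1" and "stationary_in_law W M\<^sub>1"
    and "random_countable_set W M\<^sub>2" and "dense_random_set W M\<^sub>2"
    and "local_random_set W M\<^sub>2" and "stationary_in_law W M\<^sub>2"
  shows "same_law W M\<^sub>1 M\<^sub>2 \<and>
    (\<forall>(L :: real measure) S.
       prob_space L \<and> sets L = sets borel \<and>
       absolutely_continuous lborel L \<and> absolutely_continuous L lborel \<and>
       measurable_enumeration W W M\<^sub>1 S \<longrightarrow>
       (\<exists>R. is_coupling R (PiM UNIV (\<lambda>_::nat. L)) (seq_law W S) \<and>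
          (AE (x, y) in R. seq_set (\<lambda>i. Some (x i)) = seq_set y)))"
proof (intro conjI allI impI)
  note W = assms(1) two_sided_wiener_measureD[OF assms(1)]
  obtain S1 where S1: "measurable_enumeration W W M\<^sub>1 S1"
    using assms(2) unfolding random_countable_set_def by blast
  obtain S2 where S2: "measurable_enumeration W W M\<^sub>2 S2"
    using assms(6) unfolding random_countable_set_def by blast
  obtain T1 :: "nat \<Rightarrow> (real \<Rightarrow> real) \<Rightarrow> real" where T1: "\<And>i. T1 i \<in> borel_measurable W" "AE \<omega> in W. M\<^sub>1 \<omega> = range (\<lambda>i. T1 i \<omega>)"
    "AE \<omega> in W. seq_set (\<lambda>i. S1 i \<omega>) = range (\<lambda>i. T1 i \<omega>)"
    by (rule real_enumeration[OF S1 assms(3)]) blast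
  obtain T2 :: "nat \<Rightarrow> (real \<Rightarrow> real) \<Rightarrow> real" where T2: "\<And>i. T2 i \<in> borel_measurable W" "AE \<omega> in W. M\<^sub>2 \<omega> = range (\<lambda>i. T2 i \<omega>)"
    "AE \<omega> in W. seq_set (\<lambda>i. S2 i \<omega>) = range (\<lambda>i. T2 i \<omega>)"
    by (rule real_enumeration[OF S2 assms(7)]) blast
  have sl1: "sample_like W T1" by (rule local_sample_like[OF W assms(2-5) T1(1,2)])
  have sl2: "sample_like W T2" by (rule local_sample_like[OF W assms(6-9) T2(1,2)])
  show "same_law W M\<^sub>1 M\<^sub>2"
  proof -
    \<comment> \<open>The second component is the Wiener path itself rather than an enumeration, so
      \<open>S2\<close> can be applied to it afterwards.\<close>
    obtain R where R: "is_coupling R (seq_law W S1) W" and AE: "AE x in R. seq_set (fst x) = range (\<lambda>i. T2 i (snd x))"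
      using coupling_exists[OF W(2) sl1 measurable_enumerationD(1)[OF S1] T1(3) W(2) sl2] unfolding seq_law_def by blast
    define f where "f = (\<lambda>\<omega> i. S2 i \<omega>)"
    have f: "f \<in> measurable W cseqM" unfolding f_def by (rule measurable_enumerationD(3)[OF S2])
    let ?R = "distr R (seq_law W S1 \<Otimes>\<^sub>M cseqM) (\<lambda>x. (fst x, f (snd x)))"
    have R2: "is_coupling ?R (seq_law W S1) (seq_law W S2)"
      using is_coupling_distr_snd[OF R f] unfolding f_def[symmetric] seq_law_def[of W S2] .
    have sR: "sets R = sets (seq_law W S1 \<Otimes>\<^sub>M W)" and Q: "distr R W snd = W" using R by (auto simp: is_coupling_def)
    have m: "fst \<in> measurable R (seq_law W S1)" "snd \<in> measurable R W" by (simp_all add: measurable_cong_sets[OF sR refl])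
    have mf: "(\<lambda>x. (fst x, f (snd x))) \<in> measurable R (seq_law W S1 \<Otimes>\<^sub>M cseqM)"
      by (intro measurable_Pair m measurable_compose[OF m(2) f])
    have "AE \<omega> in distr R W snd. seq_set (f \<omega>) = range (\<lambda>i. T2 i \<omega>)" using T2(3) unfolding Q f_def .
    from AE_distrD[OF m(2) this] AE have AE2: "AE x in R. seq_set (fst x) = seq_set (f (snd x))"
      by eventually_elim simp
    have c: "(\<lambda>x. fst x i) \<in> measurable (seq_law W S1 \<Otimes>\<^sub>M cseqM) coffin_borel"
      "(\<lambda>x. snd x i) \<in> measurable (seq_law W S1 \<Otimes>\<^sub>M cseqM) coffin_borel" for i
      by (rule measurable_compose[OF measurable_fst], simp add: seq_law_def)
         (rule measurable_compose[OF measurable_snd], simp)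
    have "AE x in ?R. seq_set (fst x) = seq_set (snd x)"
      using AE2 pred_seq_set_eq[OF c]
      by (subst AE_distr_iff[OF mf]) (simp_all add: pred_def)
    then show ?thesis unfolding same_law_def using S1 S2 R2 by (auto simp: split_beta)
  qed
  fix L :: "real measure" and S
  assume asm: "prob_space L \<and> sets L = sets borel \<and>
       absolutely_continuous lborel L \<and> absolutely_continuous L lborel \<and>
       measurable_enumeration W W M\<^sub>1 S"
  then have L: "prob_space L" "sets L = sets borel" "absolutely_continuous lborel L" "absolutely_continuous L lborel"
    and S: "measurable_enumeration W W M\<^sub>1 S" by auto
  \<comment> \<open>Sample-likeness was established for \<open>T1\<close>; the given
    \<open>S\<close> is linked to it only through the set that both enumerate.\<close>
  have ST: "AE \<omega> in W. seq_set (\<lambda>i. S i \<omega>) = range (\<lambda>i. T1 i \<omega>)"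
    using measurable_enumerationD(2)[OF S] T1(2) by eventually_elim simp
  have PL: "prob_space (PiM UNIV (\<lambda>_::nat. L))" by (rule prob_space_PiM) (rule L(1))
  let ?L = "PiM UNIV (\<lambda>_::nat. L)"
  obtain R where R: "is_coupling R (seq_law W S) ?L" and AE: "AE x in R. seq_set (fst x) = range (\<lambda>i. snd x i)"
    using coupling_exists[OF W(2) sl1 measurable_enumerationD(1)[OF S] ST PL sample_like_iid[OF L]] unfolding seq_law_def by blast
  \<comment> \<open>In the construction the coffin-valued sequence is the one redrawn over the space
    of the other, so the components arrive in the opposite order.\<close>
  let ?R = "distr R (?L \<Otimes>\<^sub>M seq_law W S) (\<lambda>x. (snd x, fst x))"
  have sR: "sets R = sets (seq_law W S \<Otimes>\<^sub>M ?L)" using R by (auto simp: is_coupling_def)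
  have m: "fst \<in> measurable R (seq_law W S)" "snd \<in> measurable R ?L" by (simp_all add: measurable_cong_sets[OF sR refl])
  have ms: "(\<lambda>x. (snd x, fst x)) \<in> measurable R (?L \<Otimes>\<^sub>M seq_law W S)" by (intro measurable_Pair m)
  have rng: "seq_set (\<lambda>i. Some (x i)) = range x" for x :: "nat \<Rightarrow> real"
    unfolding seq_set_eq_range_iff by blast
  have c: "(\<lambda>x. fst x i) \<in> borel_measurable (?L \<Otimes>\<^sub>M seq_law W S)"
    "(\<lambda>x. snd x i) \<in> measurable (?L \<Otimes>\<^sub>M seq_law W S) coffin_borel" for i
  proof -
    have "(\<lambda>x. x i) \<in> measurable ?L L" by simp
    then have "(\<lambda>x. x i) \<in> borel_measurable ?L" by (simp add: measurable_cong_sets[OF refl L(2)])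
    then show "(\<lambda>x. fst x i) \<in> borel_measurable (?L \<Otimes>\<^sub>M seq_law W S)" by (rule measurable_compose[OF measurable_fst])
    show "(\<lambda>x. snd x i) \<in> measurable (?L \<Otimes>\<^sub>M seq_law W S) coffin_borel"
      by (rule measurable_compose[OF measurable_snd]) (simp add: seq_law_def)
  qed
  have "AE x in ?R. seq_set (snd x) = range (fst x)"
    using AE pred_seq_set_eq_range[OF c(2,1)]
    by (subst AE_distr_iff[OF ms]) (simp_all add: pred_def)
  then have "AE (x, y) in ?R. seq_set (\<lambda>i. Some (x i)) = seq_set y"
    by (simp add: split_beta rng) (erule eventually_mono, simp)
  with is_coupling_swap[OF R]
  show "\<exists>R. is_coupling R (PiM UNIV (\<lambda>_::nat. L)) (seq_law W S) \<and>
          (AE (x, y) in R. seq_set (\<lambda>i. Some (x i)) = seq_set y)" by blast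
qed

end
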